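(* Suppose that $S$ satisfies the no-arbitrage condition (NA), that Assumption A (well-posedness) holds, and that $U$ satisfies either Assumption B or Assumption C. Then for every $c\in\mathbb{R}$ there exists a strategy $\phi^*=\phi^*(c)\in\Phi(U,c)$ satisfying $$u(c)=E\,U(V_T^{c,\phi^*})<\infty,\qquad\text{where } u(c):=\sup_{\phi\in\Phi(U,c)}E\,U(V_T^{c,\phi}).$$
   Context: Market: $(\Omega,\mathcal F,P)$ is a probability space with a filtration $(\mathcal F_t)_{0\le t\le T}$ ($T$ a finite integer horizon), $\mathcal F_0$ contains all $P$-null sets, and $(S_t)_{0\le t\le T}$ is an $\mathbb{R}^d$-valued adapted process; $\Delta S_t:=S_t-S_{t-1}$. $\Xi_t$ is the set of $\mathcal F_t$-measurable $\mathbb{R}^d$-valued random variables. A strategy is a predictable process $\phi=(\phi_t)_{1\le t\le T}$, i.e. $\phi_t\in\Xi_{t-1}$; $\Phi$ is the set of all strategies. For $c\in\mathbb{R}$, $V_t^{c,\phi}:=c+\sum_{i=1}^t\langle\phi_i,\Delta S_i\rangle$. $U:\mathbb{R}\to\mathbb{R}$ is a concave nondecreasing function. $\Phi(U,c)$ is the set of $\phi\in\Phi$ for which the expectation $EU(V_T^{c,\phi})$ is well defined. Conditional expectations are in the generalized sense ($E(X|\mathcal G)=E(X^+|\mathcal G)-E(X^-|\mathcal G)$ whenever this is not $\infty-\infty$). (NA): for all $\phi\in\Phi$, if $V_T^{0,\phi}\ge 0$ a.s. then $V_T^{0,\phi}=0$ a.s. Assumption A: the following random functions are well defined: $U_T(x):=U(x)$,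 and for $0\le t<T$, $x\in\mathbb{R}$, $U_t(x):=\operatorname{ess\,sup}_{\xi\in\Xi_t}E(U_{t+1}(x+\langle\xi,\Delta S_{t+1}\rangle)|\mathcal F_t)<\infty$ a.s. (where regular versions of $U_{t+1}$, i.e. a.s. nondecreasing, concave and finite-valued in $x$, are used), and $EU_0(x)<\infty$ for all $x\in\mathbb{R}$. Assumption B: $U$ is concave, nondecreasing, $U(0)=0$, and there exist $\tilde x>0$ and $0<\gamma<1$ such that $U(\lambda x)\le\lambda^\gamma U(x)$ for all $x\ge\tilde x$ and all $\lambda\ge1$. Assumption C: $U$ is concave, nondecreasing, $U(0)=0$, and there exist $\alpha>0$ and $\tilde x\le0$ such that $U(\lambda x)\le\lambda^{1+\alpha}U(x)$ for all $x\le\tilde x$ and all $\lambda\ge1$. *)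

theory Defs
  imports "HOL-Probability.Probability"
begin

text \<open>
  Expectations in the generalized sense: \<open>E X = E X\<^sup>+ - E X\<^sup>-\<close>, possibly infinite, which makes sense
  whenever the two terms are not both \<open>\<infinity>\<close>. As \<open>e2ennreal\<close> maps negative numbers to \<open>0\<close>,
  \<open>e2ennreal (X \<omega>)\<close> is \<open>X\<^sup>+ \<omega>\<close> and \<open>e2ennreal (- X \<omega>)\<close> is \<open>X\<^sup>- \<omega>\<close>. The values of \<open>gen_exp\<close> and
  \<open>gen_cond_exp\<close> are meaningful only together with the corresponding predicates \<open>has_gen_exp\<close>
  and \<open>has_gen_cond_exp\<close>, because \<open>\<infinity> - \<infinity> = \<infinity>\<close> in \<open>ereal\<close>.
\<close>

definition has_gen_exp :: "'a measure \<Rightarrow> ('a \<Rightarrow> ereal) \<Rightarrow> bool" where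
  "has_gen_exp M X \<longleftrightarrow> X \<in> borel_measurable M \<and>
     \<not> ((\<integral>\<^sup>+\<omega>. e2ennreal (X \<omega>) \<partial>M) = \<infinity> \<and> (\<integral>\<^sup>+\<omega>. e2ennreal (- X \<omega>) \<partial>M) = \<infinity>)"

definition gen_exp :: "'a measure \<Rightarrow> ('a \<Rightarrow> ereal) \<Rightarrow> ereal" where
  "gen_exp M X =
     enn2ereal (\<integral>\<^sup>+\<omega>. e2ennreal (X \<omega>) \<partial>M) - enn2ereal (\<integral>\<^sup>+\<omega>. e2ennreal (- X \<omega>) \<partial>M)"

definition has_gen_cond_exp :: "'a measure \<Rightarrow> 'a measure \<Rightarrow> ('a \<Rightarrow> ereal) \<Rightarrow> bool" where
  "has_gen_cond_exp M G X \<longleftrightarrow> X \<in> borel_measurable M \<and>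
     (AE \<omega> in M. \<not> (nn_cond_exp M G (\<lambda>\<omega>. e2ennreal (X \<omega>)) \<omega> = \<infinity> \<and>
                    nn_cond_exp M G (\<lambda>\<omega>. e2ennreal (- X \<omega>)) \<omega> = \<infinity>))"

definition gen_cond_exp :: "'a measure \<Rightarrow> 'a measure \<Rightarrow> ('a \<Rightarrow> ereal) \<Rightarrow> 'a \<Rightarrow> ereal" where
  "gen_cond_exp M G X \<omega> =
     enn2ereal (nn_cond_exp M G (\<lambda>\<omega>. e2ennreal (X \<omega>)) \<omega>)
     - enn2ereal (nn_cond_exp M G (\<lambda>\<omega>. e2ennreal (- X \<omega>)) \<omega>)"

text \<open>
  \<open>Y\<close> is (a version of) the essential supremum of a family of random variables; this is
  unrelated to the library's \<open>esssup\<close>, which concerns a single function.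
\<close>

definition is_ess_sup :: "'a measure \<Rightarrow> ('a \<Rightarrow> ereal) set \<Rightarrow> ('a \<Rightarrow> ereal) \<Rightarrow> bool" where
  "is_ess_sup M \<X> Y \<longleftrightarrow> Y \<in> borel_measurable M \<and>
     (\<forall>X\<in>\<X>. AE \<omega> in M. X \<omega> \<le> Y \<omega>) \<and>
     (\<forall>Z\<in>borel_measurable M. (\<forall>X\<in>\<X>. AE \<omega> in M. X \<omega> \<le> Z \<omega>) \<longrightarrow> (AE \<omega> in M. Y \<omega> \<le> Z \<omega>))"

definition market ::
  "'a measure \<Rightarrow> (nat \<Rightarrow> 'a measure) \<Rightarrow> (nat \<Rightarrow> 'a \<Rightarrow> real ^ 'd) \<Rightarrow> nat \<Rightarrow> bool" where
  "market M F S T \<longleftrightarrow> prob_space M \<and>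
     (\<forall>t\<le>T. subalgebra M (F t)) \<and>
     (\<forall>s t. s \<le> t \<and> t \<le> T \<longrightarrow> sets (F s) \<subseteq> sets (F t)) \<and>
     null_sets M \<subseteq> sets (F 0) \<and>
     (\<forall>t\<le>T. S t \<in> borel_measurable (F t))"

definition \<Xi> :: "(nat \<Rightarrow> 'a measure) \<Rightarrow> nat \<Rightarrow> ('a \<Rightarrow> real ^ 'd) set" where
  "\<Xi> F t = borel_measurable (F t)"

definition \<Delta> :: "(nat \<Rightarrow> 'a \<Rightarrow> real ^ 'd) \<Rightarrow> nat \<Rightarrow> 'a \<Rightarrow> real ^ 'd" where
  "\<Delta> S t \<omega> = S t \<omega> - S (t - 1) \<omega>"

definition strategies :: "(nat \<Rightarrow> 'a measure) \<Rightarrow> nat \<Rightarrow> (nat \<Rightarrow> 'a \<Rightarrow> real ^ 'd) set" where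
  "strategies F T = {\<phi>. \<forall>t\<in>{1..T}. \<phi> t \<in> \<Xi> F (t - 1)}"

definition wealth ::
  "(nat \<Rightarrow> 'a \<Rightarrow> real ^ 'd) \<Rightarrow> real \<Rightarrow> (nat \<Rightarrow> 'a \<Rightarrow> real ^ 'd) \<Rightarrow> nat \<Rightarrow> 'a \<Rightarrow> real" where
  "wealth S c \<phi> t \<omega> = c + (\<Sum>i=1..t. \<phi> i \<omega> \<bullet> \<Delta> S i \<omega>)"

definition no_arbitrage ::
  "'a measure \<Rightarrow> (nat \<Rightarrow> 'a measure) \<Rightarrow> (nat \<Rightarrow> 'a \<Rightarrow> real ^ 'd) \<Rightarrow> nat \<Rightarrow> bool" where
  "no_arbitrage M F S T \<longleftrightarrow> (\<forall>\<phi>\<in>strategies F T.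
     (AE \<omega> in M. wealth S 0 \<phi> T \<omega> \<ge> 0) \<longrightarrow> (AE \<omega> in M. wealth S 0 \<phi> T \<omega> = 0))"

text \<open>\<open>EU(V\<^sub>T\<^bsup>c,\<phi>\<^esup>)\<close>, the set \<open>\<Phi>(U,c)\<close> and the value \<open>u(c)\<close>.\<close>

definition exp_utility ::
  "'a measure \<Rightarrow> (nat \<Rightarrow> 'a \<Rightarrow> real ^ 'd) \<Rightarrow> nat \<Rightarrow> (real \<Rightarrow> real) \<Rightarrow> real
     \<Rightarrow> (nat \<Rightarrow> 'a \<Rightarrow> real ^ 'd) \<Rightarrow> ereal" where
  "exp_utility M S T U c \<phi> = gen_exp M (\<lambda>\<omega>. ereal (U (wealth S c \<phi> T \<omega>)))"

definition admissible ::
  "'a measure \<Rightarrow> (nat \<Rightarrow> 'a measure) \<Rightarrow> (nat \<Rightarrow> 'a \<Rightarrow> real ^ 'd) \<Rightarrow> nat \<Rightarrow> (real \<Rightarrow> real) \<Rightarrow> real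
     \<Rightarrow> (nat \<Rightarrow> 'a \<Rightarrow> real ^ 'd) set" where
  "admissible M F S T U c =
     {\<phi> \<in> strategies F T. has_gen_exp M (\<lambda>\<omega>. ereal (U (wealth S c \<phi> T \<omega>)))}"

definition max_utility ::
  "'a measure \<Rightarrow> (nat \<Rightarrow> 'a measure) \<Rightarrow> (nat \<Rightarrow> 'a \<Rightarrow> real ^ 'd) \<Rightarrow> nat \<Rightarrow> (real \<Rightarrow> real) \<Rightarrow> real
     \<Rightarrow> ereal" where
  "max_utility M F S T U c = (SUP \<phi>\<in>admissible M F S T U c. exp_utility M S T U c \<phi>)"

text \<open>
  Regular versions: a.s. nondecreasing, concave and finite-valued in \<open>x\<close>, with one exceptional
  null set for all \<open>x\<close>.
\<close>

definition regular_version :: "'a measure \<Rightarrow> (real \<Rightarrow> 'a \<Rightarrow> ereal) \<Rightarrow> bool" where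
  "regular_version M W \<longleftrightarrow> (\<forall>x. W x \<in> borel_measurable M) \<and>
     (AE \<omega> in M. (\<forall>x. \<bar>W x \<omega>\<bar> \<noteq> \<infinity>) \<and> mono (\<lambda>x. W x \<omega>) \<and>
                 concave_on UNIV (\<lambda>x. real_of_ereal (W x \<omega>)))"

text \<open>
  \<open>W\<close> solves the backward recursion for the random functions \<open>U\<^sub>0, \<dots>, U\<^sub>T\<close>. Being unique only
  up to null sets, they form a relation rather than a function. The conditional expectation has
  to be well defined for every \<open>\<xi>\<close>. Measurability of \<open>W t x\<close> with respect to \<open>F t\<close> is not
  imposed; it holds since \<open>F t\<close> contains the null sets and the essential supremum is a.s. the
  supremum of countably many \<open>F t\<close>-measurable functions.
\<close>

definition value_functions ::
  "'a measure \<Rightarrow> (nat \<Rightarrow> 'a measure) \<Rightarrow> (nat \<Rightarrow> 'a \<Rightarrow> real ^ 'd) \<Rightarrow> nat \<Rightarrow> (real \<Rightarrow> real)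
     \<Rightarrow> (nat \<Rightarrow> real \<Rightarrow> 'a \<Rightarrow> ereal) \<Rightarrow> bool" where
  "value_functions M F S T U W \<longleftrightarrow>
     (\<forall>x \<omega>. W T x \<omega> = ereal (U x)) \<and>
     (\<forall>t<T. regular_version M (W (t + 1)) \<and>
        (\<forall>x. (\<forall>\<xi>\<in>\<Xi> F t. has_gen_cond_exp M (F t) (\<lambda>\<omega>. W (t + 1) (x + \<xi> \<omega> \<bullet> \<Delta> S (t + 1) \<omega>) \<omega>)) \<and>
             is_ess_sup M
               ((\<lambda>\<xi>. gen_cond_exp M (F t) (\<lambda>\<omega>. W (t + 1) (x + \<xi> \<omega> \<bullet> \<Delta> S (t + 1) \<omega>) \<omega>)) ` \<Xi> F t)
               (W t x) \<and>
             (AE \<omega> in M. W t x \<omega> < \<infinity>)))"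

definition well_posed ::
  "'a measure \<Rightarrow> (nat \<Rightarrow> 'a measure) \<Rightarrow> (nat \<Rightarrow> 'a \<Rightarrow> real ^ 'd) \<Rightarrow> nat \<Rightarrow> (real \<Rightarrow> real) \<Rightarrow> bool" where
  "well_posed M F S T U \<longleftrightarrow> (\<exists>W. value_functions M F S T U W \<and>
     (\<forall>x. has_gen_exp M (W 0 x) \<and> gen_exp M (W 0 x) < \<infinity>))"

definition growth_at_plus_infinity :: "(real \<Rightarrow> real) \<Rightarrow> bool" where
  "growth_at_plus_infinity U \<longleftrightarrow> concave_on UNIV U \<and> mono U \<and> U 0 = 0 \<and>
     (\<exists>x0>0. \<exists>\<gamma>. 0 < \<gamma> \<and> \<gamma> < 1 \<and> (\<forall>x\<ge>x0. \<forall>l\<ge>1. U (l * x) \<le> l powr \<gamma> * U x))"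

definition growth_at_minus_infinity :: "(real \<Rightarrow> real) \<Rightarrow> bool" where
  "growth_at_minus_infinity U \<longleftrightarrow> concave_on UNIV U \<and> mono U \<and> U 0 = 0 \<and>
     (\<exists>\<alpha>>0. \<exists>x0\<le>0. \<forall>x\<le>x0. \<forall>l\<ge>1. U (l * x) \<le> l powr (1 + \<alpha>) * U x)"

end

theory Submission
  imports Defs
begin

text \<open>
  Both growth conditions imply \<open>U (x / 2) \<ge> p U\<^sup>+(x) - q U\<^sup>-(x) - C\<close> for some \<open>0 < q < p\<close>, and this
  inequality passes from \<open>U\<^sub>t\<^sub>+\<^sub>1\<close> to \<open>U\<^sub>t\<close> with the same constants. Comparing a nearly optimal position
  with its half, it bounds \<open>E(U\<^sub>t\<^sub>+\<^sub>1\<^sup>-(X + \<langle>\<xi>, \<Delta>S\<^sub>t\<^sub>+\<^sub>1\<rangle>)|F\<^sub>t)\<close> along maximizing sequences. As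
  \<open>U\<^sub>t\<^sub>+\<^sub>1(x) \<rightarrow> -\<infinity>\<close> for \<open>x \<rightarrow> -\<infinity>\<close>, absence of arbitrage then keeps maximizers of almost minimal norm
  bounded, by concavity and the parallelogram law they converge almost surely, and a conditional Fatou
  lemma shows that the limit is optimal for one step. The one-step optimizers are composed backwards;
  the same halving inequality makes the positive part of the terminal utility integrable. If \<open>U\<close> is
  constant, then \<open>U = 0\<close> and there is nothing to prove.
\<close>

section \<open>Measurable subsequences and essential suprema\<close>

text \<open>Well-posedness bounds only the difference between the conditional expectations of the
  positive and the negative part, so along a maximizing sequence both may still grow without bound.
  The halving inequality separates them: if a position is worth at least \<open>w\<close> and its
  half at most \<open>b\<close>, then \<open>(p - q) N \<le> b + C - p w\<close> for its conditional
  negative part \<open>N\<close>. Under Assumption B, \<open>p = 2 powr (- \<gamma>)\<close> stands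
  against \<open>q = 1/2\<close>; under Assumption C, \<open>p = 1/2\<close> against
  \<open>q = 2 powr (- (1 + \<alpha>))\<close>; concavity supplies the factor \<open>1/2\<close> in
  both cases. Choosing positions of nearly minimal norm takes the place of projecting redundant
  directions away, which avoids describing the conditional support of the price increments. The
  remaining obstacle is null sets: values are given for each constant wealth separately, whereas an
  optimal strategy meets random wealths. Versions regular at every \<omega>, countable grids and
  measurable pasting bridge this gap.\<close>

text \<open>A random Bolzano-Weierstrass theorem, with indices depending measurably on \<omega>. The
  pointwise \<open>limsup\<close> is a measurable cluster point, and taking the least later index
  within \<open>1 / (k + 1)\<close> of it keeps every stage of the recursion measurable.\<close>

lemma measurable_subsequence_real:
  fixes z :: "nat \<Rightarrow> 'a \<Rightarrow> real"
  assumes z[measurable]: "\<And>n. z n \<in> borel_measurable G" and B: "\<And>n \<omega>. \<bar>z n \<omega>\<bar> \<le> B"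
  obtains \<tau> :: "nat \<Rightarrow> 'a \<Rightarrow> nat" where "\<And>k. \<tau> k \<in> measurable G (count_space UNIV)"
    "\<And>\<omega>. strict_mono (\<lambda>k. \<tau> k \<omega>)" "\<And>\<omega>. convergent (\<lambda>k. z (\<tau> k \<omega>) \<omega>)"
proof -
  define l where "l \<omega> = real_of_ereal (limsup (\<lambda>n. ereal (z n \<omega>)))" for \<omega>
  have l[measurable]: "l \<in> borel_measurable G" unfolding l_def by measurable
  have ex: "\<exists>n>m. \<bar>z n \<omega> - l \<omega>\<bar> < e" if "e > 0" for m e \<omega>
  proof -
    let ?u = "\<lambda>n. ereal (z n \<omega>)"
    obtain r where r: "strict_mono r" "(?u \<circ> r) \<longlonglongrightarrow> limsup ?u"
      using limsup_subseq_lim by blast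
    \<comment> \<open>The bounds make the \<open>limsup\<close> finite, so
      \<open>real_of_ereal\<close> in \<open>l\<close> never returns its default value.\<close>
    have "- B \<le> z n \<omega>" "z n \<omega> \<le> B" for n using B[of n \<omega>] by linarith+
    then have "limsup ?u \<le> ereal B" "ereal (-B) \<le> limsup ?u"
      by (auto intro!: Limsup_bounded le_Limsup)
    then have "\<bar>limsup ?u\<bar> \<noteq> \<infinity>" by auto
    then have "limsup ?u = ereal (l \<omega>)" by (simp add: l_def ereal_real)
    then have "(\<lambda>n. z (r n) \<omega>) \<longlonglongrightarrow> l \<omega>" using r(2) by (simp add: comp_def)
    then have "eventually (\<lambda>n. \<bar>z (r n) \<omega> - l \<omega>\<bar> < e) sequentially"
      using \<open>e > 0\<close> by (auto simp: tendsto_iff dist_real_def)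
    then obtain N where N: "\<And>n. n \<ge> N \<Longrightarrow> \<bar>z (r n) \<omega> - l \<omega>\<bar> < e"
      by (auto simp: eventually_sequentially)
    have "r (max N (Suc m)) \<ge> Suc m"
      using r(1) by (meson le_trans max.cobounded2 seq_suble)
    then show ?thesis using N[of "max N (Suc m)"] by (intro exI[of _ "r (max N (Suc m))"]) auto
  qed
  define \<tau> where "\<tau> = rec_nat (\<lambda>\<omega>. 0)
    (\<lambda>k t \<omega>. LEAST n. n > t \<omega> \<and> \<bar>z n \<omega> - l \<omega>\<bar> < 1 / (real k + 1))"
  have \<tau>0: "\<tau> 0 = (\<lambda>\<omega>. 0)"
    and \<tau>S: "\<tau> (Suc k) = (\<lambda>\<omega>. LEAST n. n > \<tau> k \<omega> \<and> \<bar>z n \<omega> - l \<omega>\<bar> < 1 / (real k + 1))" for k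
    by (simp_all add: \<tau>_def)
  have \<tau>: "\<tau> (Suc k) \<omega> > \<tau> k \<omega> \<and> \<bar>z (\<tau> (Suc k) \<omega>) \<omega> - l \<omega>\<bar> < 1 / (real k + 1)" for k \<omega>
    unfolding \<tau>S using ex[of "1 / (real k + 1)" "\<tau> k \<omega>" \<omega>] by (rule LeastI2_ex) auto
  show ?thesis
  proof
    show "\<tau> k \<in> measurable G (count_space UNIV)" for k
    proof (induction k)
      case (Suc k)
      note [measurable] = Suc
      show ?case unfolding \<tau>S by measurable
    qed (simp add: \<tau>0)
    show "strict_mono (\<lambda>k. \<tau> k \<omega>)" for \<omega>
      using \<tau> by (simp add: strict_mono_Suc_iff)
    have "(\<lambda>k. z (\<tau> (Suc k) \<omega>) \<omega>) \<longlonglongrightarrow> l \<omega>" for \<omega>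
    proof (rule LIM_zero_cancel, rule Lim_null_comparison)
      show "eventually (\<lambda>k. norm (z (\<tau> (Suc k) \<omega>) \<omega> - l \<omega>) \<le> inverse (real (Suc k))) sequentially"
        using \<tau>[of _ \<omega>] by (auto intro!: always_eventually simp: less_imp_le inverse_eq_divide add.commute)
    qed (rule LIMSEQ_inverse_real_of_nat)
    then have "(\<lambda>k. z (\<tau> k \<omega>) \<omega>) \<longlonglongrightarrow> l \<omega>" for \<omega>
      using LIMSEQ_imp_Suc[of "\<lambda>k. z (\<tau> k \<omega>) \<omega>"] by blast
    then show "convergent (\<lambda>k. z (\<tau> k \<omega>) \<omega>)" for \<omega> by (rule convergentI)
  qed
qed

text \<open>Coordinates are treated one at a time: each extraction refines the previous one, and
  coordinates already convergent stay so along the finer subsequence.\<close>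

lemma measurable_subsequence:
  fixes z :: "nat \<Rightarrow> 'a \<Rightarrow> 'b::euclidean_space"
  assumes z[measurable]: "\<And>n. z n \<in> borel_measurable G" and B: "\<And>n \<omega>. norm (z n \<omega>) \<le> B"
  obtains \<tau> :: "nat \<Rightarrow> 'a \<Rightarrow> nat" where "\<And>k. \<tau> k \<in> measurable G (count_space UNIV)"
    "\<And>\<omega>. strict_mono (\<lambda>k. \<tau> k \<omega>)" "\<And>\<omega>. convergent (\<lambda>k. z (\<tau> k \<omega>) \<omega>)"
proof -
  have "\<exists>\<tau> :: nat \<Rightarrow> 'a \<Rightarrow> nat. (\<forall>k. \<tau> k \<in> measurable G (count_space UNIV)) \<and>
     (\<forall>\<omega>. strict_mono (\<lambda>k. \<tau> k \<omega>)) \<and> (\<forall>\<omega>. \<forall>b\<in>D. convergent (\<lambda>k. z (\<tau> k \<omega>) \<omega> \<bullet> b))"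
    if "D \<subseteq> Basis" for D :: "'b set"
  proof -
    have "finite D" using that finite_Basis finite_subset by blast
    then show ?thesis using that
    proof (induction D)
      case empty
      then show ?case by (intro exI[of _ "\<lambda>k \<omega>. k"]) (auto simp: strict_mono_def)
    next
      case (insert b D)
      then obtain \<tau> where \<tau>[measurable]: "\<And>k. \<tau> k \<in> measurable G (count_space UNIV)"
        and mono: "\<And>\<omega>. strict_mono (\<lambda>k. \<tau> k \<omega>)"
        and conv: "\<And>\<omega> b. b \<in> D \<Longrightarrow> convergent (\<lambda>k. z (\<tau> k \<omega>) \<omega> \<bullet> b)"
        by (metis insert_subset)
      have b: "b \<in> Basis" using insert.prems by auto
      obtain \<sigma> :: "nat \<Rightarrow> 'a \<Rightarrow> nat" where \<sigma>[measurable]: "\<And>k. \<sigma> k \<in> measurable G (count_space UNIV)"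
        and mono': "\<And>\<omega>. strict_mono (\<lambda>k. \<sigma> k \<omega>)"
        and conv': "\<And>\<omega>. convergent (\<lambda>k. z (\<tau> (\<sigma> k \<omega>) \<omega>) \<omega> \<bullet> b)"
      proof -
        have 1: "(\<lambda>\<omega>. z (\<tau> n \<omega>) \<omega> \<bullet> b) \<in> borel_measurable G" for n
          by (rule measurable_compose_countable[where f="\<lambda>i \<omega>. z i \<omega> \<bullet> b" and g="\<tau> n"]) measurable
        have 2: "\<bar>z (\<tau> n \<omega>) \<omega> \<bullet> b\<bar> \<le> B" for n \<omega>
          using Basis_le_norm[OF b] B order_trans by blast
        show ?thesis by (rule measurable_subsequence_real[OF 1 2]) (rule that)
      qed
      show ?case
      proof (intro exI[of _ "\<lambda>k \<omega>. \<tau> (\<sigma> k \<omega>) \<omega>"] conjI allI ballI)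
        show "(\<lambda>\<omega>. \<tau> (\<sigma> k \<omega>) \<omega>) \<in> measurable G (count_space UNIV)" for k
          by (rule measurable_compose_countable[where f="\<lambda>i \<omega>. \<tau> i \<omega>" and g="\<sigma> k"]) measurable
        show "strict_mono (\<lambda>k. \<tau> (\<sigma> k \<omega>) \<omega>)" for \<omega>
          using mono mono' unfolding strict_mono_def by blast
        show "convergent (\<lambda>k. z (\<tau> (\<sigma> k \<omega>) \<omega>) \<omega> \<bullet> c)" if "c \<in> insert b D" for \<omega> c
        proof (cases "c = b")
          case False
          then show ?thesis
            using convergent_subseq_convergent[OF conv[of c \<omega>] mono'[of \<omega>]] that
            by (simp add: comp_def)
        qed (simp add: conv')
      qed
    qed
  qed
  from this[of Basis] obtain \<tau> :: "nat \<Rightarrow> 'a \<Rightarrow> nat"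
    where "\<And>k. \<tau> k \<in> measurable G (count_space UNIV)" "\<And>\<omega>. strict_mono (\<lambda>k. \<tau> k \<omega>)"
      and c: "\<And>\<omega> b. b \<in> Basis \<Longrightarrow> convergent (\<lambda>k. z (\<tau> k \<omega>) \<omega> \<bullet> b)"
    by (metis order_refl)
  moreover have "convergent (\<lambda>k. z (\<tau> k \<omega>) \<omega>)" for \<omega>
  proof -
    have "(\<lambda>k. \<Sum>b\<in>Basis. (z (\<tau> k \<omega>) \<omega> \<bullet> b) *\<^sub>R b)
        \<longlonglongrightarrow> (\<Sum>b\<in>Basis. lim (\<lambda>k. z (\<tau> k \<omega>) \<omega> \<bullet> b) *\<^sub>R b)"
      using c by (intro tendsto_intros) (simp add: convergent_LIMSEQ_iff)
    then show ?thesis by (auto simp: euclidean_representation convergent_def)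
  qed
  ultimately show ?thesis using that by blast
qed

text \<open>An exhaustion argument: some countable union from the family attains the supremum of the
  measures of such unions. A member sticking out by a set of positive measure could be added and
  would exceed the supremum.\<close>

lemma (in finite_measure) countable_ess_cover:
  assumes "\<A> \<subseteq> sets M" "\<A> \<noteq> {}"
  obtains A :: "nat \<Rightarrow> 'a set" where "range A \<subseteq> \<A>"
    "\<And>B. B \<in> \<A> \<Longrightarrow> emeasure M (B - (\<Union>n. A n)) = 0"
proof -
  define X where "X = {measure M (\<Union>n. A n) | A :: nat \<Rightarrow> 'a set. range A \<subseteq> \<A>}"
  have bdd: "bdd_above X"
    unfolding X_def bdd_above_def using bounded_measure by blast
  have "X \<noteq> {}" using assms(2) unfolding X_def by (auto intro!: exI[of _ "\<lambda>n. SOME A. A \<in> \<A>"] simp: some_in_eq)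
  have "\<exists>A :: nat \<Rightarrow> 'a set. range A \<subseteq> \<A> \<and> measure M (\<Union>n. A n) > Sup X - 1 / (real k + 1)" for k :: nat
  proof -
    have "Sup X - 1 / (real k + 1) < Sup X" by simp
    then obtain x where x: "x \<in> X" "x > Sup X - 1 / (real k + 1)"
      using less_cSup_iff[OF \<open>X \<noteq> {}\<close> bdd] by blast
    from x(1) obtain A :: "nat \<Rightarrow> 'a set" where "x = measure M (\<Union>n. A n)" "range A \<subseteq> \<A>"
      unfolding X_def by auto
    with x(2) show ?thesis by (intro exI[of _ A]) simp
  qed
  then obtain A :: "nat \<Rightarrow> nat \<Rightarrow> 'a set" where A: "\<And>k. range (A k) \<subseteq> \<A>"
    "\<And>k. measure M (\<Union>n. A k n) > Sup X - 1 / (real k + 1)" by metis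
  \<comment> \<open>\<open>prod_decode\<close> merges the maximizing sequence of sequences into a
    single sequence.\<close>
  define A' where "A' n = (case prod_decode n of (k, i) \<Rightarrow> A k i)" for n
  have rA': "range A' \<subseteq> \<A>" using A(1) by (auto simp: A'_def image_subset_iff split: prod.split)
  then have mA': "A' n \<in> sets M" for n using assms(1) by blast
  have mA: "A k n \<in> sets M" for k n using assms(1) A(1) by blast
  have sub: "(\<Union>n. A k n) \<subseteq> (\<Union>n. A' n)" for k
  proof
    fix x assume "x \<in> (\<Union>n. A k n)"
    then obtain n where "x \<in> A k n" by auto
    then have "x \<in> A' (prod_encode (k, n))" by (simp add: A'_def)
    then show "x \<in> (\<Union>n. A' n)" by blast
  qed
  have "measure M (\<Union>n. A' n) > Sup X - 1 / (real k + 1)" for k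
    by (rule less_le_trans[OF A(2)[of k] finite_measure_mono[OF sub[of k]]]) (use mA' in auto)
  then have "Sup X < measure M (\<Union>n. A' n) + e" if "e > 0" for e
    using reals_Archimedean[OF that] by (smt (verit) inverse_eq_divide of_nat_Suc)
  then have ge: "measure M (\<Union>n. A' n) \<ge> Sup X"
    by (meson field_le_epsilon less_imp_le)
  have "emeasure M (B - (\<Union>n. A' n)) = 0" if "B \<in> \<A>" for B
  proof -
    define A'' where "A'' n = (case n of 0 \<Rightarrow> B | Suc m \<Rightarrow> A' m)" for n
    have [measurable]: "B \<in> sets M" "(\<Union>n. A' n) \<in> sets M" using that assms(1) mA' by auto
    have U: "(\<Union>n. A'' n) = (\<Union>n. A' n) \<union> (B - (\<Union>n. A' n))"
    proof -
      have "(\<Union>n. A'' n) = A'' 0 \<union> (\<Union>n. A'' (Suc n))" by (metis UN_insert UNIV_nat_eq image_image)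
      then show ?thesis by (auto simp: A''_def)
    qed
    have "range A'' \<subseteq> \<A>" using rA' that by (auto simp: image_subset_iff A''_def split: nat.split)
    then have "measure M (\<Union>n. A'' n) \<in> X" unfolding X_def by blast
    then have "measure M (\<Union>n. A'' n) \<le> Sup X" using bdd by (rule cSup_upper)
    moreover have "measure M (\<Union>n. A'' n) = measure M (\<Union>n. A' n) + measure M (B - (\<Union>n. A' n))"
      unfolding U by (rule finite_measure_Union) auto
    ultimately have "measure M (B - (\<Union>n. A' n)) = 0" using ge measure_nonneg[of M "B - (\<Union>n. A' n)"] by linarith
    then show ?thesis by (simp add: emeasure_eq_measure)
  qed
  with rA' show ?thesis using that by blast
qed

text \<open>At each rational level, the super-level sets of all members are covered up to null sets
  by those of countably many. Countability is what later permits a measurable choice of a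
  near-optimal member by a least index.\<close>

lemma (in finite_measure) countable_ess_sup:
  fixes f :: "'i \<Rightarrow> 'a \<Rightarrow> ereal"
  assumes "I \<noteq> {}" and f: "\<And>i. i \<in> I \<Longrightarrow> f i \<in> borel_measurable M"
  obtains s :: "nat \<Rightarrow> 'i" where "range s \<subseteq> I" "\<And>i. i \<in> I \<Longrightarrow> AE \<omega> in M. f i \<omega> \<le> (SUP n. f (s n) \<omega>)"
proof -
  define L where "L q i = {\<omega> \<in> space M. f i \<omega> > ereal (real_of_rat q)}" for q i
  have L: "L q i \<in> sets M" if "i \<in> I" for q i
    unfolding L_def using f[OF that] by measurable
  have "\<exists>s :: nat \<Rightarrow> 'i. range s \<subseteq> I \<and> (\<forall>i\<in>I. emeasure M (L q i - (\<Union>n. L q (s n))) = 0)" for q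
  proof -
    obtain A :: "nat \<Rightarrow> 'a set" where A: "range A \<subseteq> L q ` I" "\<And>B. B \<in> L q ` I \<Longrightarrow> emeasure M (B - (\<Union>n. A n)) = 0"
      using countable_ess_cover[of "L q ` I"] L assms(1) by blast
    then have "\<forall>n. \<exists>i\<in>I. A n = L q i" by blast
    then obtain s where "\<And>n. s n \<in> I" "\<And>n. A n = L q (s n)" by metis
    then show ?thesis using A(2) by (intro exI[of _ s]) auto
  qed
  then obtain s :: "rat \<Rightarrow> nat \<Rightarrow> 'i" where s: "\<And>q. range (s q) \<subseteq> I"
    "\<And>q i. i \<in> I \<Longrightarrow> emeasure M (L q i - (\<Union>n. L q (s q n))) = 0" by metis
  define s' where "s' n = (case from_nat n of (q, k) \<Rightarrow> s q k)" for n
  have sup: "f (s q k) \<omega> \<le> (SUP n. f (s' n) \<omega>)" for q k \<omega>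
    by (rule SUP_upper2[of "to_nat (q, k)"]) (auto simp: s'_def)
  show ?thesis
  proof
    show "range s' \<subseteq> I" using s(1) by (auto simp: s'_def image_subset_iff split: prod.split)
    fix i assume i: "i \<in> I"
    have "AE \<omega> in M. \<omega> \<notin> L q i - (\<Union>n. L q (s q n))" for q
    proof (rule AE_not_in)
      show "L q i - (\<Union>n. L q (s q n)) \<in> null_sets M"
        using s(2)[OF i, of q] s(1)[of q] L i by (intro null_setsI sets.Diff sets.countable_UN) auto
    qed
    then have "AE \<omega> in M. \<forall>q. \<omega> \<notin> L q i - (\<Union>n. L q (s q n))" by (simp add: AE_all_countable)
    with AE_space show "AE \<omega> in M. f i \<omega> \<le> (SUP n. f (s' n) \<omega>)"
    proof eventually_elim
      case (elim \<omega>)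
      show ?case
      proof (rule ccontr)
        assume "\<not> f i \<omega> \<le> (SUP n. f (s' n) \<omega>)"
        then have "(SUP n. f (s' n) \<omega>) < f i \<omega>" by simp
        from ereal_dense3[OF this] obtain q where q: "(SUP n. f (s' n) \<omega>) < ereal (real_of_rat q)" "ereal (real_of_rat q) < f i \<omega>"
          by auto
        then have "\<omega> \<in> L q i" using elim by (simp add: L_def)
        then obtain n where "\<omega> \<in> L q (s q n)" using elim by blast
        then have "ereal (real_of_rat q) < f (s q n) \<omega>" by (simp add: L_def)
        with sup[of q n \<omega>] q(1) show False by (meson less_asym less_le_trans)
      qed
    qed
  qed
qed

text \<open>Pasting along \<open>G\<close>-measurable indices makes one member nearly minimal at
  almost every \<omega> simultaneously. The slack \<open>e\<close> is there because the family is
  not assumed closed, so its essential infimum may not be attained.\<close>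

lemma (in finite_measure) near_minimal_norm:
  fixes \<C> :: "('a \<Rightarrow> 'b::euclidean_space) set"
  assumes "subalgebra M G" "\<C> \<noteq> {}" and meas: "\<And>c. c \<in> \<C> \<Longrightarrow> c \<in> borel_measurable G"
    and paste: "\<And>c N. (\<And>n::nat. c n \<in> \<C>) \<Longrightarrow> N \<in> measurable G (count_space UNIV) \<Longrightarrow> (\<lambda>\<omega>. c (N \<omega>) \<omega>) \<in> \<C>"
    and "e > 0"
  obtains c where "c \<in> \<C>" "\<And>c'. c' \<in> \<C> \<Longrightarrow> AE \<omega> in M. (norm (c \<omega>))\<^sup>2 \<le> (norm (c' \<omega>))\<^sup>2 + e"
proof -
  have measM: "c \<in> borel_measurable M" if "c \<in> \<C>" for c
    using measurable_from_subalg[OF assms(1) meas[OF that]] .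
  \<comment> \<open>The sign turns the essential infimum of the squared norms into an essential
    supremum.\<close>
  obtain s :: "nat \<Rightarrow> 'a \<Rightarrow> 'b" where s: "range s \<subseteq> \<C>"
    "\<And>c. c \<in> \<C> \<Longrightarrow> AE \<omega> in M. - ereal ((norm (c \<omega>))\<^sup>2) \<le> (SUP n. - ereal ((norm (s n \<omega>))\<^sup>2))"
    by (rule countable_ess_sup[of \<C> "\<lambda>c \<omega>. - ereal ((norm (c \<omega>))\<^sup>2)"]) (use assms(2) measM in auto)
  have sC: "s n \<in> \<C>" for n using s(1) by blast
  note [measurable] = meas[OF sC]
  define r where "r \<omega> = (INF n. (norm (s n \<omega>))\<^sup>2)" for \<omega>
  have bdd: "bdd_below (range (\<lambda>n. (norm (s n \<omega>))\<^sup>2))" for \<omega> by (intro bdd_belowI[of _ 0]) auto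
  have [measurable]: "r \<in> borel_measurable G"
    unfolding r_def by (rule borel_measurable_cINF) (use bdd in \<open>auto\<close>)
  define N where "N \<omega> = (LEAST n. (norm (s n \<omega>))\<^sup>2 < r \<omega> + e)" for \<omega>
  have N: "(norm (s (N \<omega>) \<omega>))\<^sup>2 < r \<omega> + e" for \<omega>
    unfolding N_def
  proof (rule LeastI_ex)
    have "r \<omega> < r \<omega> + e" using \<open>e > 0\<close> by simp
    then show "\<exists>n. (norm (s n \<omega>))\<^sup>2 < r \<omega> + e"
      unfolding r_def[of \<omega>] using cINF_less_iff[OF _ bdd] by blast
  qed
  have "N \<in> measurable G (count_space UNIV)" unfolding N_def by measurable
  then have "(\<lambda>\<omega>. s (N \<omega>) \<omega>) \<in> \<C>" by (rule paste[OF sC])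
  moreover have "AE \<omega> in M. (norm (s (N \<omega>) \<omega>))\<^sup>2 \<le> (norm (c' \<omega>))\<^sup>2 + e" if "c' \<in> \<C>" for c'
    using s(2)[OF that]
  proof eventually_elim
    case (elim \<omega>)
    have "r \<omega> \<le> (norm (s n \<omega>))\<^sup>2" for n unfolding r_def by (rule cINF_lower[OF bdd]) simp
    then have "(SUP n. - ereal ((norm (s n \<omega>))\<^sup>2)) \<le> - ereal (r \<omega>)" by (intro SUP_least) auto
    with elim have "- ereal ((norm (c' \<omega>))\<^sup>2) \<le> - ereal (r \<omega>)" by (rule order_trans)
    then have "r \<omega> \<le> (norm (c' \<omega>))\<^sup>2" by simp
    then show ?case using N[of \<omega>] by linarith
  qed
  ultimately show ?thesis using that by blast
qed

section \<open>Utility functions\<close>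

lemma concave_half:
  fixes U :: "real \<Rightarrow> real"
  assumes "concave_on UNIV U"
  shows "U ((x + y) / 2) \<ge> (U x + U y) / 2"
  using concave_onD[OF assms, of "1/2" x y] by (simp add: field_simps)

lemma concave_UNIV_continuous:
  fixes U :: "real \<Rightarrow> real"
  assumes "concave_on UNIV U"
  shows "continuous_on UNIV U"
  using convex_on_continuous[of UNIV "\<lambda>x. - U x"] assms continuous_on_minus[of UNIV "\<lambda>x. - U x"]
  by (simp add: concave_on_def)

text \<open>To the left of \<open>a\<close>, a concave function lies below the line through its
  values at \<open>a\<close> and \<open>b\<close>, whose slope is positive here.\<close>

lemma concave_mono_at_bot:
  fixes U :: "real \<Rightarrow> real"
  assumes "concave_on UNIV U" "mono U" "U a < U b"
  shows "filterlim U at_bot at_bot"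
proof -
  have "a < b" using assms(2,3) by (meson linorder_not_le monoD)
  define s where "s = (U b - U a) / (b - a)"
  have s: "s > 0" using \<open>a < b\<close> assms(3) by (simp add: s_def)
  have "U x \<le> U a + s * (x - a)" if "x < a" for x
  proof -
    define t where "t = (a - x) / (b - x)"
    have t: "0 \<le> t" "t \<le> 1" using that \<open>a < b\<close> by (auto simp: t_def)
    have a: "a = (1 - t) * x + t * b" using that \<open>a < b\<close> by (simp add: t_def divide_simps) (simp add: algebra_simps)
    have "U a \<ge> (1 - t) * U x + t * U b"
      using concave_onD[OF assms(1), of t x b] t a by simp
    then have *: "(1 - t) * U x \<le> (1 - t) * U a - t * (U b - U a)" by (simp add: algebra_simps)
    have t1: "1 - t = (b - a) / (b - x)" using that \<open>a < b\<close> by (simp add: t_def field_simps)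
    have "t * (U b - U a) = (1 - t) * (s * (a - x))"
      unfolding t1 using that \<open>a < b\<close> by (simp add: t_def s_def)
    with * have "(1 - t) * U x \<le> (1 - t) * (U a - s * (a - x))" by (simp only: right_diff_distrib)
    moreover have "1 - t > 0" using t1 that \<open>a < b\<close> by simp
    ultimately have "U x \<le> U a - s * (a - x)" by (metis mult_le_cancel_left_pos)
    then show ?thesis by (simp add: algebra_simps)
  qed
  then have "eventually (\<lambda>x. U x \<le> U a + s * (x - a)) at_bot"
    by (auto simp: eventually_at_bot_dense)
  moreover have "filterlim (\<lambda>x. U a + s * (x - a)) at_bot at_bot"
    unfolding filterlim_at_bot
  proof
    fix Z
    show "eventually (\<lambda>x. U a + s * (x - a) \<le> Z) at_bot"
      unfolding eventually_at_bot_linorder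
      using s by (intro exI[of _ "a + (Z - U a) / s"]) (auto simp: field_simps)
  qed
  ultimately show ?thesis using filterlim_at_bot_mono by blast
qed

text \<open>The common form in which both growth conditions are used: halving the argument costs less on the
  positive part than it gains on the negative part.\<close>

definition halving :: "real \<Rightarrow> real \<Rightarrow> real \<Rightarrow> (real \<Rightarrow> real) \<Rightarrow> bool" where
  "halving p q C V \<longleftrightarrow> (\<forall>x. V (x / 2) \<ge> p * max (V x) 0 - q * max (- V x) 0 - C)"

text \<open>The growth condition is applied at \<open>x / 2\<close> with \<open>l = 2\<close>, which
  is why its exceptional interval ends at \<open>2 * x0\<close>; the constant \<open>C\<close>
  absorbs that interval. On the other half-line concavity and \<open>U 0 = 0\<close> suffice. The
  strict inequality \<open>q < p\<close> comes from \<open>\<gamma> < 1\<close> or from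
  \<open>\<alpha> > 0\<close>.\<close>

lemma halving_growth:
  assumes "growth_at_plus_infinity U \<or> growth_at_minus_infinity U"
  obtains p q C where "0 < q" "q < p" "0 \<le> C" "halving p q C U"
  using assms
proof
  assume "growth_at_plus_infinity U"
  then obtain x0 \<gamma> where U: "concave_on UNIV U" "mono U" "U 0 = 0" "x0 > 0" "0 < \<gamma>" "\<gamma> < 1"
    and gr: "\<And>x l. x \<ge> x0 \<Longrightarrow> l \<ge> 1 \<Longrightarrow> U (l * x) \<le> l powr \<gamma> * U x"
    unfolding growth_at_plus_infinity_def by blast
  define p :: real where "p = 2 powr (- \<gamma>)"
  have p: "1/2 < p" "p \<le> 1" "p * 2 powr \<gamma> = 1"
    using U powr_less_mono[of "-1" "-\<gamma>" 2] powr_mono[of "-\<gamma>" 0 2]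
    by (auto simp: p_def powr_minus)
  have pos: "0 \<le> x \<Longrightarrow> 0 \<le> U x" and neg: "x \<le> 0 \<Longrightarrow> U x \<le> 0" for x
    using U(2,3) by (metis monoD)+
  have "U (x / 2) \<ge> p * max (U x) 0 - 1/2 * max (- U x) 0 - U (2 * x0)" for x
  proof -
    have C: "U (2 * x0) \<ge> 0" using U(4) by (intro pos) simp
    consider "x \<ge> 2 * x0" | "0 \<le> x" "x \<le> 2 * x0" | "x \<le> 0" by linarith
    then show ?thesis
    proof cases
      case 1
      then have "p * U x \<le> p * (2 powr \<gamma> * U (x / 2))"
        using gr[of "x/2" 2] p by (intro mult_left_mono) auto
      also have "\<dots> = U (x / 2)" using p(3) by (simp flip: mult.assoc)
      finally show ?thesis using pos[of x] 1 C U(4) by (auto simp: max_def)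
    next
      case 2
      have "p * U x \<le> 1 * U (2 * x0)"
        using 2 p pos[of x] U(2)[THEN monoD, of x "2*x0"] by (intro mult_mono) auto
      then show ?thesis using pos[of x] pos[of "x/2"] 2 by (auto simp: max_def)
    next
      case 3
      then show ?thesis using concave_half[OF U(1), of x 0] U(3) neg[of x] C by (auto simp: max_def)
    qed
  qed
  then show ?thesis using that[of "1/2" p "U (2 * x0)"] p(1) pos[of "2 * x0"] U(4)
    by (auto simp: halving_def)
next
  assume "growth_at_minus_infinity U"
  then obtain x0 \<alpha> where U: "concave_on UNIV U" "mono U" "U 0 = 0" "x0 \<le> 0" "0 < \<alpha>"
    and gr: "\<And>x l. x \<le> x0 \<Longrightarrow> l \<ge> 1 \<Longrightarrow> U (l * x) \<le> l powr (1 + \<alpha>) * U x"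
    unfolding growth_at_minus_infinity_def by blast
  define q :: real where "q = 2 powr (- (1 + \<alpha>))"
  have q: "0 < q" "q < 1/2" "q * 2 powr (1 + \<alpha>) = 1"
    using U powr_less_mono[of "-(1+\<alpha>)" "-1" 2]
    by (auto simp: q_def simp flip: powr_add)
  have pos: "0 \<le> x \<Longrightarrow> 0 \<le> U x" and neg: "x \<le> 0 \<Longrightarrow> U x \<le> 0" for x
    using U(2,3) by (metis monoD)+
  have C: "U (2 * x0) \<le> 0" using U(4) by (intro neg) simp
  have "U (x / 2) \<ge> 1/2 * max (U x) 0 - q * max (- U x) 0 - (- U (2 * x0))" for x
  proof -
    consider "x \<ge> 0" | "2 * x0 \<le> x" "x \<le> 0" | "x \<le> 0" "x \<le> 2 * x0" by linarith
    then show ?thesis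
    proof cases
      case 1
      then show ?thesis using concave_half[OF U(1), of x 0] U(3) pos[of x] C by (auto simp: max_def)
    next
      case 2
      have "U (2 * x0) \<le> U (x / 2)" using 2 by (intro monoD[OF U(2)]) auto
      moreover have "q * max (- U x) 0 \<ge> 0" using q by simp
      ultimately show ?thesis using neg[of x] 2 by (auto simp: max_def)
    next
      case 3
      then have "q * U x \<le> q * (2 powr (1 + \<alpha>) * U (x / 2))"
        using gr[of "x/2" 2] q by (intro mult_left_mono) auto
      also have "\<dots> = U (x / 2)" using q(3) by (simp flip: mult.assoc)
      finally show ?thesis using neg[of x] 3 C U(4) by (auto simp: max_def)
    qed
  qed
  then show ?thesis using that[of q "1/2" "- U (2 * x0)"] q C by (auto simp: halving_def)
qed

text \<open>The argument is rounded down to a grid of step \<open>1 / Suc k\<close>, where only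
  countably many values are composed; continuity in the real argument passes to the limit.\<close>

lemma measurable_random_continuous:
  fixes V :: "'a \<Rightarrow> real \<Rightarrow> real"
  assumes [measurable]: "\<And>x. (\<lambda>\<omega>. V \<omega> x) \<in> borel_measurable M"
    and cont: "\<And>\<omega>. continuous_on UNIV (V \<omega>)"
    and [measurable]: "X \<in> borel_measurable M"
  shows "(\<lambda>\<omega>. V \<omega> (X \<omega>)) \<in> borel_measurable M"
proof (rule borel_measurable_LIMSEQ_metric)
  show "(\<lambda>\<omega>. V \<omega> (of_int \<lfloor>real (Suc k) * X \<omega>\<rfloor> / real (Suc k))) \<in> borel_measurable M" for k
    by (rule measurable_compose_countable[where f="\<lambda>i \<omega>. V \<omega> (of_int i / real (Suc k))"
          and g="\<lambda>\<omega>. \<lfloor>real (Suc k) * X \<omega>\<rfloor>"]) measurable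
  show "(\<lambda>k. V \<omega> (of_int \<lfloor>real (Suc k) * X \<omega>\<rfloor> / real (Suc k))) \<longlonglongrightarrow> V \<omega> (X \<omega>)" for \<omega>
  proof (rule continuous_on_tendsto_compose[OF cont])
    show "(\<lambda>k. of_int \<lfloor>real (Suc k) * X \<omega>\<rfloor> / real (Suc k)) \<longlonglongrightarrow> X \<omega>"
    proof (rule tendsto_sandwich)
      show "eventually (\<lambda>k. X \<omega> - inverse (real (Suc k)) \<le> of_int \<lfloor>real (Suc k) * X \<omega>\<rfloor> / real (Suc k)) sequentially"
      proof (intro always_eventually allI)
        fix k
        have "real (Suc k) * X \<omega> - 1 \<le> of_int \<lfloor>real (Suc k) * X \<omega>\<rfloor>" by linarith
        then have "(real (Suc k) * X \<omega> - 1) / real (Suc k) \<le> of_int \<lfloor>real (Suc k) * X \<omega>\<rfloor> / real (Suc k)"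
          by (intro divide_right_mono) auto
        then show "X \<omega> - inverse (real (Suc k)) \<le> of_int \<lfloor>real (Suc k) * X \<omega>\<rfloor> / real (Suc k)"
          by (simp add: diff_divide_distrib inverse_eq_divide)
      qed
      show "eventually (\<lambda>k. of_int \<lfloor>real (Suc k) * X \<omega>\<rfloor> / real (Suc k) \<le> X \<omega>) sequentially"
      proof (intro always_eventually allI)
        fix k
        have "of_int \<lfloor>real (Suc k) * X \<omega>\<rfloor> \<le> real (Suc k) * X \<omega>" by linarith
        then show "of_int \<lfloor>real (Suc k) * X \<omega>\<rfloor> / real (Suc k) \<le> X \<omega>"
          by (simp add: field_simps)
      qed
      show "(\<lambda>k. X \<omega> - inverse (real (Suc k))) \<longlonglongrightarrow> X \<omega>"
        using tendsto_diff[OF tendsto_const[of "X \<omega>"] LIMSEQ_inverse_real_of_nat] by simp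
    qed auto
  qed auto
qed

section \<open>Generalized conditional expectations\<close>

lemma ennreal_eq_max: "ennreal x = ennreal (max x 0)"
  by (simp add: max_def ennreal_neg)

lemma ennreal_finiteE:
  assumes "x \<noteq> \<infinity>" obtains r where "x = ennreal r" "0 \<le> r"
  using assms by (metis ennreal_cases infinity_ennreal_def)

lemma ennreal_le3:
  assumes "0 \<le> a1" "0 \<le> a2" "0 \<le> a3" "0 \<le> b1" "0 \<le> b2" "0 \<le> b3"
    and "a1 * max x1 0 + a2 * max x2 0 + a3 * max x3 0 \<le> b1 * max y1 0 + b2 * max y2 0 + b3 * max y3 0"
  shows "ennreal a1 * ennreal x1 + ennreal a2 * ennreal x2 + ennreal a3 * ennreal x3
    \<le> ennreal b1 * ennreal y1 + ennreal b2 * ennreal y2 + ennreal b3 * ennreal y3"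
proof -
  have eq: "ennreal a * ennreal x = ennreal (a * max x 0)" if "0 \<le> a" for a x
    using that by (subst ennreal_eq_max) (simp add: ennreal_mult)
  have sum: "ennreal (a * max x 0) + ennreal (b * max y 0) + ennreal (c * max z 0)
      = ennreal (a * max x 0 + b * max y 0 + c * max z 0)"
    if "0 \<le> a" "0 \<le> b" "0 \<le> c" for a b c x y z
    using that by simp
  show ?thesis
    using assms by (simp only: eq sum) (rule ennreal_leI)
qed

section \<open>Conditional expectations: pasting, limit theorems, and the generalized version for
  real integrands\<close>

context finite_measure_subalgebra
begin

lemma measurable_F_M: "f \<in> measurable F N \<Longrightarrow> f \<in> measurable M N"
  by (rule measurable_from_subalg[OF subalg])

text \<open>On each of the countably many events \<open>N = i\<close> the integrands agree, and its
  indicator is \<open>F\<close>-measurable, hence may be moved through the conditional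
  expectation.\<close>

lemma nn_cond_exp_paste:
  fixes f :: "'i::countable \<Rightarrow> 'a \<Rightarrow> ennreal"
  assumes f[measurable]: "\<And>i. f i \<in> borel_measurable M"
    and N[measurable]: "N \<in> measurable F (count_space UNIV)"
  shows "AE \<omega> in M. nn_cond_exp M F (\<lambda>\<omega>. f (N \<omega>) \<omega>) \<omega> = nn_cond_exp M F (f (N \<omega>)) \<omega>"
proof -
  have [measurable]: "N \<in> measurable M (count_space UNIV)" by (rule measurable_F_M) measurable
  have fN[measurable]: "(\<lambda>\<omega>. f (N \<omega>) \<omega>) \<in> borel_measurable M"
    by (rule measurable_compose_countable[where f="\<lambda>i \<omega>. f i \<omega>" and g=N]) measurable
  define \<iota> :: "'i \<Rightarrow> 'a \<Rightarrow> ennreal" where "\<iota> i \<omega> = (if N \<omega> = i then 1 else 0)" for i \<omega>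
  have [measurable]: "\<iota> i \<in> borel_measurable F" for i unfolding \<iota>_def by measurable
  have "AE \<omega> in M. \<iota> i \<omega> * nn_cond_exp M F (\<lambda>\<omega>. f (N \<omega>) \<omega>) \<omega> = \<iota> i \<omega> * nn_cond_exp M F (f i) \<omega>" for i
  proof -
    have "(\<lambda>\<omega>. \<iota> i \<omega> * f (N \<omega>) \<omega>) = (\<lambda>\<omega>. \<iota> i \<omega> * f i \<omega>)" by (auto simp: \<iota>_def)
    then show ?thesis
      using nn_cond_exp_prod[of "\<iota> i" "\<lambda>\<omega>. f (N \<omega>) \<omega>"] nn_cond_exp_prod[of "\<iota> i" "f i"]
      by (auto elim: eventually_elim2)
  qed
  then have "AE \<omega> in M. \<forall>i. \<iota> i \<omega> * nn_cond_exp M F (\<lambda>\<omega>. f (N \<omega>) \<omega>) \<omega> = \<iota> i \<omega> * nn_cond_exp M F (f i) \<omega>"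
    by (simp add: AE_all_countable)
  then show ?thesis
  proof eventually_elim
    case (elim \<omega>)
    from elim[rule_format, of "N \<omega>"] show ?case by (simp add: \<iota>_def)
  qed
qed

text \<open>Conditional monotone convergence, obtained by checking the defining integrals over sets
  of \<open>F\<close> with the ordinary theorem.\<close>

lemma nn_cond_exp_SUP:
  assumes f[measurable]: "\<And>n. f n \<in> borel_measurable M" and "\<And>\<omega>. incseq (\<lambda>n. f n \<omega>)"
  shows "AE \<omega> in M. (SUP n. nn_cond_exp M F (f n) \<omega>) = nn_cond_exp M F (\<lambda>\<omega>. SUP n. f n \<omega>) \<omega>"
proof (rule nn_cond_exp_charact)
  fix A assume [measurable]: "A \<in> sets F"
  then have [measurable]: "A \<in> sets M" using subalg by (meson subalgebra_def subsetD)
  have mono: "AE \<omega> in M. nn_cond_exp M F (f n) \<omega> \<le> nn_cond_exp M F (f (Suc n)) \<omega>" for n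
    using assms(2) by (intro nn_cond_exp_mono) (auto intro!: AE_I2 simp: incseq_Suc_iff)
  have "(\<integral>\<^sup>+\<omega>\<in>A. (SUP n. f n \<omega>) \<partial>M) = (\<integral>\<^sup>+\<omega>. (SUP n. indicator A \<omega> * f n \<omega>) \<partial>M)"
    by (intro nn_integral_cong) (simp add: SUP_mult_left_ennreal mult.commute)
  also have "\<dots> = (SUP n. \<integral>\<^sup>+\<omega>. indicator A \<omega> * f n \<omega> \<partial>M)"
    using assms(2) by (intro nn_integral_monotone_convergence_SUP)
      (auto simp: incseq_def le_fun_def intro!: mult_left_mono)
  also have "\<dots> = (SUP n. \<integral>\<^sup>+\<omega>. indicator A \<omega> * nn_cond_exp M F (f n) \<omega> \<partial>M)"
    by (subst nn_cond_exp_intg) auto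
  also have "\<dots> = (\<integral>\<^sup>+\<omega>. (SUP n. indicator A \<omega> * nn_cond_exp M F (f n) \<omega>) \<partial>M)"
  proof (rule nn_integral_monotone_convergence_SUP_AE[symmetric])
    show "AE \<omega> in M. indicator A \<omega> * nn_cond_exp M F (f n) \<omega> \<le> indicator A \<omega> * nn_cond_exp M F (f (Suc n)) \<omega>" for n
      using mono[of n] by eventually_elim (auto intro: mult_left_mono)
  qed measurable
  also have "\<dots> = (\<integral>\<^sup>+\<omega>\<in>A. (SUP n. nn_cond_exp M F (f n) \<omega>) \<partial>M)"
    by (intro nn_integral_cong) (simp add: SUP_mult_left_ennreal mult.commute)
  finally show "(\<integral>\<^sup>+\<omega>\<in>A. (SUP n. f n \<omega>) \<partial>M) = (\<integral>\<^sup>+\<omega>\<in>A. (SUP n. nn_cond_exp M F (f n) \<omega>) \<partial>M)" .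
qed measurable

lemma nn_cond_exp_Fatou:
  assumes f[measurable]: "\<And>n. f n \<in> borel_measurable M"
  shows "AE \<omega> in M. nn_cond_exp M F (\<lambda>\<omega>. liminf (\<lambda>n. f n \<omega>)) \<omega> \<le> liminf (\<lambda>n. nn_cond_exp M F (f n) \<omega>)"
proof -
  define e where "e n \<omega> = (INF m\<in>{n..}. f m \<omega>)" for n \<omega>
  have [measurable]: "e n \<in> borel_measurable M" for n unfolding e_def by measurable
  have "AE \<omega> in M. nn_cond_exp M F (e n) \<omega> \<le> nn_cond_exp M F (f m) \<omega>" if "n \<le> m" for n m
    by (rule nn_cond_exp_mono) (use that in \<open>auto simp: e_def intro!: AE_I2 INF_lower\<close>)
  then have "AE \<omega> in M. \<forall>n m. n \<le> m \<longrightarrow> nn_cond_exp M F (e n) \<omega> \<le> nn_cond_exp M F (f m) \<omega>"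
    by (auto simp: AE_all_countable)
  moreover have "AE \<omega> in M. (SUP n. nn_cond_exp M F (e n) \<omega>) = nn_cond_exp M F (\<lambda>\<omega>. SUP n. e n \<omega>) \<omega>"
  proof (rule nn_cond_exp_SUP)
    show "incseq (\<lambda>n. e n \<omega>)" for \<omega>
      unfolding e_def incseq_def by (auto intro!: INF_superset_mono)
  qed measurable
  ultimately show ?thesis
  proof eventually_elim
    case (elim \<omega>)
    then show ?case
      unfolding liminf_SUP_INF e_def by (auto intro!: SUP_mono INF_greatest simp flip: elim(2)[unfolded e_def])
  qed
qed

text \<open>On the \<open>F\<close>-event where the conditional expectation is at most
  \<open>j\<close>, the integral of \<open>f\<close> equals that of its conditional expectation and
  is finite. This localization replaces integrability of \<open>f\<close>.\<close>

lemma nn_cond_exp_finite: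
  assumes f[measurable]: "f \<in> borel_measurable M"
  shows "AE \<omega> in M. nn_cond_exp M F f \<omega> \<noteq> \<infinity> \<longrightarrow> f \<omega> \<noteq> \<infinity>"
proof -
  define \<iota> :: "nat \<Rightarrow> 'a \<Rightarrow> ennreal" where "\<iota> j \<omega> = (if nn_cond_exp M F f \<omega> \<le> of_nat j then 1 else 0)" for j \<omega>
  have \<iota>[measurable]: "\<iota> j \<in> borel_measurable F" for j unfolding \<iota>_def by measurable
  note [measurable] = measurable_F_M[OF \<iota>]
  have "AE \<omega> in M. \<iota> j \<omega> * f \<omega> \<noteq> \<infinity>" for j
  proof (rule nn_integral_noteq_infinite)
    have "(\<integral>\<^sup>+\<omega>. \<iota> j \<omega> * f \<omega> \<partial>M) = (\<integral>\<^sup>+\<omega>. \<iota> j \<omega> * nn_cond_exp M F f \<omega> \<partial>M)"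
      by (rule nn_cond_exp_intg[symmetric]) measurable
    also have "\<dots> \<le> (\<integral>\<^sup>+\<omega>. of_nat j \<partial>M)"
      by (intro nn_integral_mono) (auto simp: \<iota>_def)
    also have "\<dots> < \<infinity>" by (simp add: ennreal_mult_less_top emeasure_eq_measure ennreal_of_nat_eq_real_of_nat)
    finally show "(\<integral>\<^sup>+\<omega>. \<iota> j \<omega> * f \<omega> \<partial>M) \<noteq> \<infinity>" by simp
  qed measurable
  then have "AE \<omega> in M. \<forall>j. \<iota> j \<omega> * f \<omega> \<noteq> \<infinity>" by (simp add: AE_all_countable)
  then show ?thesis
  proof eventually_elim
    case (elim \<omega>)
    show ?case
    proof
      assume "nn_cond_exp M F f \<omega> \<noteq> \<infinity>"
      then obtain r where r: "nn_cond_exp M F f \<omega> = ennreal r" "r \<ge> 0" by (rule ennreal_finiteE)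
      obtain j :: nat where "r \<le> real j" using real_arch_simple by blast
      then have "nn_cond_exp M F f \<omega> \<le> of_nat j" using r by (simp add: ennreal_of_nat_eq_real_of_nat ennreal_leI)
      then show "f \<omega> \<noteq> \<infinity>" using elim[rule_format, of j] by (simp add: \<iota>_def)
    qed
  qed
qed

lemma nn_cond_exp_le3:
  fixes a1 a2 a3 b1 b2 b3 :: ennreal
  assumes [measurable]: "f1 \<in> borel_measurable M" "f2 \<in> borel_measurable M" "f3 \<in> borel_measurable M"
      "g1 \<in> borel_measurable M" "g2 \<in> borel_measurable M" "g3 \<in> borel_measurable M"
    and le: "AE \<omega> in M. a1 * f1 \<omega> + a2 * f2 \<omega> + a3 * f3 \<omega> \<le> b1 * g1 \<omega> + b2 * g2 \<omega> + b3 * g3 \<omega>"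
  shows "AE \<omega> in M. a1 * nn_cond_exp M F f1 \<omega> + a2 * nn_cond_exp M F f2 \<omega> + a3 * nn_cond_exp M F f3 \<omega>
    \<le> b1 * nn_cond_exp M F g1 \<omega> + b2 * nn_cond_exp M F g2 \<omega> + b3 * nn_cond_exp M F g3 \<omega>"
proof -
  have lin: "AE \<omega> in M. a1 * nn_cond_exp M F f1 \<omega> + a2 * nn_cond_exp M F f2 \<omega> + a3 * nn_cond_exp M F f3 \<omega>
     = nn_cond_exp M F (\<lambda>\<omega>. a1 * f1 \<omega> + a2 * f2 \<omega> + a3 * f3 \<omega>) \<omega>"
    if [measurable]: "f1 \<in> borel_measurable M" "f2 \<in> borel_measurable M" "f3 \<in> borel_measurable M"
    for a1 a2 a3 :: ennreal and f1 f2 f3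
  proof -
    have "AE \<omega> in M. a1 * nn_cond_exp M F f1 \<omega> = nn_cond_exp M F (\<lambda>\<omega>. a1 * f1 \<omega>) \<omega>"
      "AE \<omega> in M. a2 * nn_cond_exp M F f2 \<omega> = nn_cond_exp M F (\<lambda>\<omega>. a2 * f2 \<omega>) \<omega>"
      "AE \<omega> in M. a3 * nn_cond_exp M F f3 \<omega> = nn_cond_exp M F (\<lambda>\<omega>. a3 * f3 \<omega>) \<omega>"
      "AE \<omega> in M. nn_cond_exp M F (\<lambda>\<omega>. a1 * f1 \<omega>) \<omega> + nn_cond_exp M F (\<lambda>\<omega>. a2 * f2 \<omega>) \<omega>
        = nn_cond_exp M F (\<lambda>\<omega>. a1 * f1 \<omega> + a2 * f2 \<omega>) \<omega>"
      "AE \<omega> in M. nn_cond_exp M F (\<lambda>\<omega>. a1 * f1 \<omega> + a2 * f2 \<omega>) \<omega> + nn_cond_exp M F (\<lambda>\<omega>. a3 * f3 \<omega>) \<omega>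
        = nn_cond_exp M F (\<lambda>\<omega>. a1 * f1 \<omega> + a2 * f2 \<omega> + a3 * f3 \<omega>) \<omega>"
      by (intro nn_cond_exp_prod nn_cond_exp_sum; measurable)+
    then show ?thesis by eventually_elim simp
  qed
  show ?thesis
    using lin[OF assms(1-3), of a1 a2 a3] lin[OF assms(4-6), of b1 b2 b3] nn_cond_exp_mono[OF le, simplified]
    by eventually_elim simp
qed

lemma nn_cond_exp_one: "AE \<omega> in M. nn_cond_exp M F (\<lambda>_. 1) \<omega> = 1"
  using nn_cond_exp_F_meas[of "\<lambda>_. 1"] by (auto elim: eventually_mono)

text \<open>As \<open>ennreal\<close> truncates at 0, \<open>nce h\<close> is the conditional
  expectation of the positive part of \<open>h\<close>; applied to the pointwise negative of
  \<open>h\<close> it gives that of the negative part.\<close>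

abbreviation nce :: "('a \<Rightarrow> real) \<Rightarrow> 'a \<Rightarrow> ennreal" where
  "nce h \<equiv> nn_cond_exp M F (\<lambda>\<omega>. ennreal (h \<omega>))"

abbreviation gce :: "('a \<Rightarrow> real) \<Rightarrow> 'a \<Rightarrow> ereal" where
  "gce h \<equiv> gen_cond_exp M F (\<lambda>\<omega>. ereal (h \<omega>))"

lemma gce_eq: "gce h \<omega> = enn2ereal (nce h \<omega>) - enn2ereal (nce (\<lambda>\<omega>. - h \<omega>) \<omega>)"
  by (simp add: gen_cond_exp_def)

lemma measurable_gce[measurable]: "gce h \<in> borel_measurable F"
  unfolding gen_cond_exp_def by measurable

text \<open>With a finite positive part, a real lower bound rules out the value minus infinity; the
  witness \<open>m\<close> is the conditional negative part, thereby finite.\<close>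

lemma ereal_le_gce_iff:
  assumes "nce h \<omega> \<noteq> \<infinity>"
  shows "ereal w \<le> gce h \<omega> \<longleftrightarrow>
    (\<exists>m. nce (\<lambda>\<omega>. - h \<omega>) \<omega> = ennreal m \<and> 0 \<le> m \<and> w + m \<le> enn2real (nce h \<omega>))"
proof -
  obtain p where "nce h \<omega> = ennreal p" "p \<ge> 0" using assms by (rule ennreal_finiteE)
  then show ?thesis
    by (cases "nce (\<lambda>\<omega>. - h \<omega>) \<omega>") (auto simp: gce_eq)
qed

text \<open>An infinite negative part makes the left side minus infinity, so the right side
  constrains only the case of a finite \<open>m\<close>.\<close>

lemma gce_le_ereal_iff:
  assumes "nce h \<omega> \<noteq> \<infinity>"
  shows "gce h \<omega> \<le> ereal b \<longleftrightarrow>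
    (\<forall>m. nce (\<lambda>\<omega>. - h \<omega>) \<omega> = ennreal m \<longrightarrow> 0 \<le> m \<longrightarrow> enn2real (nce h \<omega>) \<le> b + m)"
proof -
  obtain p where "nce h \<omega> = ennreal p" "p \<ge> 0" using assms by (rule ennreal_finiteE)
  then show ?thesis
    by (cases "nce (\<lambda>\<omega>. - h \<omega>) \<omega>") (auto simp: gce_eq)
qed

lemma gce_mono:
  assumes [measurable]: "h \<in> borel_measurable M" "k \<in> borel_measurable M"
    and "AE \<omega> in M. h \<omega> \<le> k \<omega>"
  shows "AE \<omega> in M. gce h \<omega> \<le> gce k \<omega>"
proof -
  have "AE \<omega> in M. nce h \<omega> \<le> nce k \<omega>" "AE \<omega> in M. nce (\<lambda>\<omega>. - k \<omega>) \<omega> \<le> nce (\<lambda>\<omega>. - h \<omega>) \<omega>"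
    using assms(3) by (intro nn_cond_exp_mono; auto elim!: eventually_mono intro: ennreal_leI)+
  then show ?thesis
    by eventually_elim (simp add: gce_eq ereal_minus_mono less_eq_ennreal.rep_eq)
qed

lemma gce_cong:
  assumes [measurable]: "h \<in> borel_measurable M" "k \<in> borel_measurable M"
    and "AE \<omega> in M. h \<omega> = k \<omega>"
  shows "AE \<omega> in M. gce h \<omega> = gce k \<omega>"
proof -
  have "AE \<omega> in M. gce h \<omega> \<le> gce k \<omega>" "AE \<omega> in M. gce k \<omega> \<le> gce h \<omega>"
    using assms(3) by (intro gce_mono; auto)+
  then show ?thesis by eventually_elim simp
qed

lemma gce_paste:
  fixes f :: "'i::countable \<Rightarrow> 'a \<Rightarrow> real"
  assumes [measurable]: "\<And>i. f i \<in> borel_measurable M" "N \<in> measurable F (count_space UNIV)"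
  shows "AE \<omega> in M. gce (\<lambda>\<omega>. f (N \<omega>) \<omega>) \<omega> = gce (f (N \<omega>)) \<omega>"
  using nn_cond_exp_paste[of "\<lambda>i \<omega>. ennreal (f i \<omega>)" N] nn_cond_exp_paste[of "\<lambda>i \<omega>. ennreal (- f i \<omega>)" N]
  by (auto simp: gce_eq elim: eventually_elim2)

lemma gce_const: "AE \<omega> in M. gce (\<lambda>_. c) \<omega> = ereal c"
proof -
  have "AE \<omega> in M. nce (\<lambda>_. c) \<omega> = ennreal c" "AE \<omega> in M. nce (\<lambda>_. - c) \<omega> = ennreal (- c)"
    using nn_cond_exp_F_meas[of "\<lambda>_. ennreal c"] nn_cond_exp_F_meas[of "\<lambda>_. ennreal (-c)"]
    by (auto elim: eventually_mono)
  then show ?thesis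
    by eventually_elim (cases "c \<ge> 0", auto simp: gce_eq ennreal_neg zero_ennreal.rep_eq)
qed

text \<open>Superlevel sets of the conditional value are closed under midpoints. To avoid infinite
  differences, \<open>h + k \<le> 2 m\<close> is rearranged into sums of positive and negative
  parts; finiteness of the conditional negative part of \<open>m\<close> then comes out as a
  conclusion.\<close>

lemma gce_midpoint:
  assumes [measurable]: "h \<in> borel_measurable M" "k \<in> borel_measurable M" "m \<in> borel_measurable M"
    and fin: "AE \<omega> in M. nce h \<omega> \<noteq> \<infinity>" "AE \<omega> in M. nce k \<omega> \<noteq> \<infinity>" "AE \<omega> in M. nce m \<omega> \<noteq> \<infinity>"
    and mid: "AE \<omega> in M. (h \<omega> + k \<omega>) / 2 \<le> m \<omega>"
    and w: "AE \<omega> in M. ereal (w \<omega>) \<le> gce h \<omega>" "AE \<omega> in M. ereal (w \<omega>) \<le> gce k \<omega>"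
  shows "AE \<omega> in M. ereal (w \<omega>) \<le> gce m \<omega>"
proof -
  have "AE \<omega> in M. ennreal 2 * nce (\<lambda>\<omega>. - m \<omega>) \<omega> + ennreal 1 * nce h \<omega> + ennreal 1 * nce k \<omega>
      \<le> ennreal 2 * nce m \<omega> + ennreal 1 * nce (\<lambda>\<omega>. - h \<omega>) \<omega> + ennreal 1 * nce (\<lambda>\<omega>. - k \<omega>) \<omega>"
  proof (rule nn_cond_exp_le3)
    show "AE \<omega> in M. ennreal 2 * ennreal (- m \<omega>) + ennreal 1 * ennreal (h \<omega>) + ennreal 1 * ennreal (k \<omega>)
        \<le> ennreal 2 * ennreal (m \<omega>) + ennreal 1 * ennreal (- h \<omega>) + ennreal 1 * ennreal (- k \<omega>)"
      using mid by eventually_elim (rule ennreal_le3, auto simp: max_def field_simps)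
  qed measurable
  then show ?thesis using fin w
  proof eventually_elim
    case (elim \<omega>)
    obtain h' k' m' where *: "nce h \<omega> = ennreal h'" "nce k \<omega> = ennreal k'" "nce m \<omega> = ennreal m'"
      "h' \<ge> 0" "k' \<ge> 0" "m' \<ge> 0"
      using elim(2,3,4) by (metis ennreal_cases infinity_ennreal_def)
    obtain h'' k'' where **: "nce (\<lambda>\<omega>. - h \<omega>) \<omega> = ennreal h''" "nce (\<lambda>\<omega>. - k \<omega>) \<omega> = ennreal k''"
      "h'' \<ge> 0" "k'' \<ge> 0" "w \<omega> + h'' \<le> h'" "w \<omega> + k'' \<le> k'"
      using elim(5,6) unfolding ereal_le_gce_iff[OF elim(2)] ereal_le_gce_iff[OF elim(3)]
      using * by auto
    have le: "ennreal 2 * nce (\<lambda>\<omega>. - m \<omega>) \<omega> + ennreal (h' + k') \<le> ennreal (2 * m' + h'' + k'')"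
      using elim(1) * ** by (simp add: ennreal_mult add.assoc)
    then have "nce (\<lambda>\<omega>. - m \<omega>) \<omega> \<noteq> \<infinity>"
      by (auto simp: ennreal_mult_top top_unique)
    then obtain m'' where m'': "nce (\<lambda>\<omega>. - m \<omega>) \<omega> = ennreal m''" "m'' \<ge> 0"
      by (rule ennreal_finiteE)
    then have "2 * m'' + (h' + k') \<le> 2 * m' + h'' + k''"
      using le * ** by (simp flip: ennreal_plus ennreal_mult' del: ennreal_numeral)
    then show ?case unfolding ereal_le_gce_iff[OF elim(4)] using m'' * ** by auto
  qed
qed

text \<open>Fatou's lemma is applied to the nonnegative functions \<open>Z - h n\<close>. The
  dominating function is only conditionally integrable; its conditional expectation is subtracted
  afterwards, pointwise where it is finite.\<close>

lemma gce_reverse_Fatou: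
  assumes [measurable]: "\<And>n. h n \<in> borel_measurable M" "k \<in> borel_measurable M" "Z \<in> borel_measurable M"
    and conv: "AE \<omega> in M. (\<lambda>n. h n \<omega>) \<longlonglongrightarrow> k \<omega>"
    and dom: "\<And>n. AE \<omega> in M. h n \<omega> \<le> Z \<omega>" and Z0: "\<And>\<omega>. 0 \<le> Z \<omega>"
    and fin: "AE \<omega> in M. nce Z \<omega> \<noteq> \<infinity>"
    and w: "\<And>n. AE \<omega> in M. ereal (w \<omega> - 1 / (real n + 1)) \<le> gce (h n) \<omega>"
  shows "AE \<omega> in M. ereal (w \<omega>) \<le> gce k \<omega>"
proof -
  \<comment> \<open>The pointwise identity \<open>(Z - f) + max f 0 = Z + max (- f) 0\<close> is
    conditioned; being one between sums, it involves no undefined difference.\<close>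
  have split: "AE \<omega> in M. nce (\<lambda>\<omega>. Z \<omega> - f \<omega>) \<omega> + nce f \<omega> = nce Z \<omega> + nce (\<lambda>\<omega>. - f \<omega>) \<omega>"
    if [measurable]: "f \<in> borel_measurable M" and le: "AE \<omega> in M. f \<omega> \<le> Z \<omega>" for f
  proof -
    have 1: "AE \<omega> in M. nce (\<lambda>\<omega>. Z \<omega> - f \<omega>) \<omega> + nce f \<omega> = nn_cond_exp M F (\<lambda>\<omega>. ennreal (Z \<omega> - f \<omega>) + ennreal (f \<omega>)) \<omega>"
      by (rule nn_cond_exp_sum) measurable
    have 2: "AE \<omega> in M. nce Z \<omega> + nce (\<lambda>\<omega>. - f \<omega>) \<omega> = nn_cond_exp M F (\<lambda>\<omega>. ennreal (Z \<omega>) + ennreal (- f \<omega>)) \<omega>"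
      by (rule nn_cond_exp_sum) measurable
    have 3: "AE \<omega> in M. nn_cond_exp M F (\<lambda>\<omega>. ennreal (Z \<omega> - f \<omega>) + ennreal (f \<omega>)) \<omega>
       = nn_cond_exp M F (\<lambda>\<omega>. ennreal (Z \<omega>) + ennreal (- f \<omega>)) \<omega>"
    proof (rule nn_cond_exp_cong)
      show "AE \<omega> in M. ennreal (Z \<omega> - f \<omega>) + ennreal (f \<omega>) = ennreal (Z \<omega>) + ennreal (- f \<omega>)"
        using le
      proof eventually_elim
        case (elim \<omega>)
        then show ?case using Z0[of \<omega>]
          by (cases "f \<omega> \<ge> 0") (simp_all add: ennreal_neg flip: ennreal_plus)
      qed
    qed measurable
    from 1 2 3 show ?thesis by eventually_elim simp
  qed
  have le: "AE \<omega> in M. nce f \<omega> \<le> nce Z \<omega>" if [measurable]: "f \<in> borel_measurable M" and "AE \<omega> in M. f \<omega> \<le> Z \<omega>" for f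
    using that(2) by (intro nn_cond_exp_mono) (auto elim!: eventually_mono intro: ennreal_leI)
  have kZ: "AE \<omega> in M. k \<omega> \<le> Z \<omega>"
  proof -
    have "AE \<omega> in M. \<forall>n. h n \<omega> \<le> Z \<omega>" using dom by (simp add: AE_all_countable)
    with conv show ?thesis by eventually_elim (blast intro: LIMSEQ_le_const2)
  qed
  \<comment> \<open>The second inequality is recorded separately: inside \<open>ennreal\<close> a
    negative real bound is truncated to 0, so \<open>w\<close> below the conditional expectation of
    \<open>Z\<close> could not be recovered from the first one.\<close>
  have up: "AE \<omega> in M. nce (\<lambda>\<omega>. Z \<omega> - h n \<omega>) \<omega> \<le> ennreal (enn2real (nce Z \<omega>) - w \<omega> + 1 / (real n + 1)) \<and>
      w \<omega> \<le> enn2real (nce Z \<omega>) + 1 / (real n + 1)" for n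
    using split[OF assms(1) dom[of n]] w[of n] le[OF assms(1) dom[of n]] fin
  proof eventually_elim
    case (elim \<omega>)
    have sp: "nce (\<lambda>\<omega>. Z \<omega> - h n \<omega>) \<omega> + nce (h n) \<omega> = nce Z \<omega> + nce (\<lambda>\<omega>. - h n \<omega>) \<omega>"
      using elim by simp
    have "nce (h n) \<omega> \<noteq> \<infinity>" using elim by (auto simp: top_unique)
    then obtain p where p: "nce (h n) \<omega> = ennreal p" "p \<ge> 0" by (rule ennreal_finiteE)
    obtain m where m: "nce (\<lambda>\<omega>. - h n \<omega>) \<omega> = ennreal m" "0 \<le> m" "w \<omega> - 1 / (real n + 1) + m \<le> p"
      using elim ereal_le_gce_iff[of "h n" \<omega>] p by auto
    obtain z where z: "nce Z \<omega> = ennreal z" "z \<ge> 0" using elim ennreal_finiteE[of "nce Z \<omega>"] by auto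
    have "nce (\<lambda>\<omega>. Z \<omega> - h n \<omega>) \<omega> = ennreal (z + m - p)"
      using sp p m z by (metis (no_types) add.commute ennreal_minus ennreal_add_diff_cancel_right ennreal_neq_top ennreal_plus)
    moreover have "p \<le> z" using elim p z by simp
    ultimately show ?case using z m by (auto intro!: ennreal_leI)
  qed
  have "AE \<omega> in M. nn_cond_exp M F (\<lambda>\<omega>. liminf (\<lambda>n. ennreal (Z \<omega> - h n \<omega>))) \<omega>
      \<le> liminf (\<lambda>n. nce (\<lambda>\<omega>. Z \<omega> - h n \<omega>) \<omega>)"
    by (rule nn_cond_exp_Fatou) measurable
  moreover have "AE \<omega> in M. nn_cond_exp M F (\<lambda>\<omega>. liminf (\<lambda>n. ennreal (Z \<omega> - h n \<omega>))) \<omega> = nce (\<lambda>\<omega>. Z \<omega> - k \<omega>) \<omega>"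
  proof (rule nn_cond_exp_cong)
    show "AE \<omega> in M. liminf (\<lambda>n. ennreal (Z \<omega> - h n \<omega>)) = ennreal (Z \<omega> - k \<omega>)"
      using conv
    proof eventually_elim
      case (elim \<omega>)
      show ?case
        by (intro lim_imp_Liminf tendsto_intros elim trivial_limit_sequentially)
    qed
  qed measurable
  moreover have "AE \<omega> in M. \<forall>n. nce (\<lambda>\<omega>. Z \<omega> - h n \<omega>) \<omega> \<le> ennreal (enn2real (nce Z \<omega>) - w \<omega> + 1 / (real n + 1)) \<and>
      w \<omega> \<le> enn2real (nce Z \<omega>) + 1 / (real n + 1)"
    using up by (simp add: AE_all_countable)
  ultimately show ?thesis using split[OF assms(2) kZ] le[OF assms(2) kZ] fin
  proof eventually_elim
    case (elim \<omega>)
    have sp: "nce (\<lambda>\<omega>. Z \<omega> - k \<omega>) \<omega> + nce k \<omega> = nce Z \<omega> + nce (\<lambda>\<omega>. - k \<omega>) \<omega>" using elim by simp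
    have k: "nce k \<omega> \<noteq> \<infinity>" using elim by (auto simp: top_unique)
    then obtain p where p: "nce k \<omega> = ennreal p" "p \<ge> 0" by (rule ennreal_finiteE)
    obtain z where z: "nce Z \<omega> = ennreal z" "z \<ge> 0" using elim ennreal_finiteE[of "nce Z \<omega>"] by auto
    have lim: "(\<lambda>n. ennreal (z - w \<omega> + 1 / (real n + 1))) \<longlonglongrightarrow> ennreal (z - w \<omega> + 0)"
    proof (intro tendsto_intros)
      show "(\<lambda>n. 1 / (real n + 1)) \<longlonglongrightarrow> 0"
        using LIMSEQ_inverse_real_of_nat by (simp add: inverse_eq_divide add.commute)
    qed
    have "nce (\<lambda>\<omega>. Z \<omega> - k \<omega>) \<omega> \<le> liminf (\<lambda>n. nce (\<lambda>\<omega>. Z \<omega> - h n \<omega>) \<omega>)"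
      using elim(1,2) by simp
    also have "\<dots> \<le> liminf (\<lambda>n. ennreal (z - w \<omega> + 1 / (real n + 1)))"
      using elim(3) z by (intro Liminf_mono always_eventually) auto
    also have "\<dots> = ennreal (z - w \<omega>)"
      using lim_imp_Liminf[OF trivial_limit_sequentially lim] by simp
    finally have le: "nce (\<lambda>\<omega>. Z \<omega> - k \<omega>) \<omega> \<le> ennreal (z - w \<omega>)" .
    then have "nce (\<lambda>\<omega>. Z \<omega> - k \<omega>) \<omega> \<noteq> \<infinity>" by (auto simp: top_unique)
    then obtain d where d: "nce (\<lambda>\<omega>. Z \<omega> - k \<omega>) \<omega> = ennreal d" "d \<ge> 0" by (rule ennreal_finiteE)
    have "nce (\<lambda>\<omega>. - k \<omega>) \<omega> \<noteq> \<infinity>" using sp d p by (metis ennreal_add_eq_top ennreal_neq_top infinity_ennreal_def)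
    then obtain m where m: "nce (\<lambda>\<omega>. - k \<omega>) \<omega> = ennreal m" "m \<ge> 0" by (rule ennreal_finiteE)
    have "d + p = z + m" using sp d p m z by (simp flip: ennreal_plus)
    moreover have "d \<le> max (z - w \<omega>) 0"
      using le d by (auto simp: max_def ennreal_le_iff2)
    moreover have "w \<omega> \<le> z"
    proof (rule LIMSEQ_le_const)
      show "(\<lambda>n. z + 1 / (real n + 1)) \<longlonglongrightarrow> z"
        using tendsto_add[OF tendsto_const[of z] LIMSEQ_inverse_real_of_nat] by (simp add: inverse_eq_divide add.commute)
      show "\<exists>N. \<forall>n\<ge>N. w \<omega> \<le> z + 1 / (real n + 1)" using elim(3) z by simp
    qed
    ultimately show ?case unfolding ereal_le_gce_iff[OF k] using p m z by (auto simp: max_def split: if_splits)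
  qed
qed

end

section \<open>The one-step problem\<close>

text \<open>The squared norms are nearly monotone and converge; the parallelogram law then turns
  near-minimality against midpoints into the Cauchy property. Non-divergence bounds a subsequence
  only, and \<open>incr\<close> spreads the bound to all indices.\<close>

lemma near_minimal_convergent:
  fixes x :: "nat \<Rightarrow> 'b::euclidean_space"
  assumes notop: "\<not> filterlim (\<lambda>n. norm (x n)) at_top sequentially"
    and incr: "\<And>n m. n \<le> m \<Longrightarrow> (norm (x n))\<^sup>2 \<le> (norm (x m))\<^sup>2 + 1 / (real n + 1)"
    and mid: "\<And>n m. n \<le> m \<Longrightarrow> (norm (x n))\<^sup>2 \<le> (norm ((1/2) *\<^sub>R (x n + x m)))\<^sup>2 + 1 / (real n + 1)"
  shows "convergent x"
proof -
  define b where "b n = (norm (x n))\<^sup>2" for n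
  define e where "e n = 1 / (real n + 1)" for n
  have e0: "e \<longlonglongrightarrow> 0"
    unfolding e_def using LIMSEQ_inverse_real_of_nat by (simp add: inverse_eq_divide add.commute)
  have e: "0 < e n" "e n \<le> 1" for n by (auto simp: e_def)
  from notop obtain Z where Z: "\<And>N. \<exists>n\<ge>N. norm (x n) < Z"
    unfolding filterlim_at_top eventually_sequentially by (auto simp: not_le)
  have bB: "b n \<le> Z\<^sup>2 + 1" for n
  proof -
    obtain m where m: "m \<ge> n" "norm (x m) < Z" using Z by blast
    have "(norm (x m))\<^sup>2 \<le> Z\<^sup>2" using m(2) by (intro power_mono) auto
    then show ?thesis using incr[OF m(1)] e(2)[of n] unfolding b_def e_def by linarith
  qed
  \<comment> \<open>Tail infima: \<open>s\<close> increases and \<open>b n\<close> exceeds it by at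
    most \<open>e n\<close>, so both have the same limit.\<close>
  define s where "s n = (INF m\<in>{n..}. b m)" for n
  have bdd: "bdd_below (b ` S)" for S by (intro bdd_belowI[of _ 0]) (auto simp: b_def)
  have sb: "s n \<le> b n" for n unfolding s_def by (rule cINF_lower[OF bdd]) simp
  have bs: "b n \<le> s n + e n" for n
  proof -
    have "b n - e n \<le> s n"
      unfolding s_def by (rule cINF_greatest) (use incr in \<open>auto simp: b_def e_def diff_le_eq\<close>)
    then show ?thesis by simp
  qed
  have "incseq s"
    unfolding incseq_def s_def by (auto intro!: cINF_superset_mono bdd)
  moreover have "\<forall>n. s n \<le> Z\<^sup>2 + 1" using sb bB order_trans by blast
  ultimately obtain L where L: "s \<longlonglongrightarrow> L" using incseq_convergent[of s "Z\<^sup>2 + 1"] by blast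
  have "(\<lambda>n. s n + e n) \<longlonglongrightarrow> L + 0" by (intro tendsto_add L e0)
  then have bL: "b \<longlonglongrightarrow> L"
    using tendsto_sandwich[OF _ _ L, of b "\<lambda>n. s n + e n"] sb bs by (auto intro: always_eventually)
  have d: "(dist (x n) (x m))\<^sup>2 \<le> 2 * (b m - b n) + 4 * e n" if "n \<le> m" for n m
  proof -
    have "(norm ((1/2) *\<^sub>R (x n + x m)))\<^sup>2 = (norm (x n + x m))\<^sup>2 / 4"
      by (simp add: power_divide)
    moreover have "(norm (x n - x m))\<^sup>2 + (norm (x n + x m))\<^sup>2 = 2 * b n + 2 * b m"
      unfolding b_def by (simp add: power2_norm_eq_inner algebra_simps)
    ultimately show ?thesis using mid[OF that] by (simp add: dist_norm b_def e_def)
  qed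
  have "Cauchy x"
  proof (rule metric_CauchyI)
    fix \<epsilon> :: real assume "\<epsilon> > 0"
    then have "\<epsilon>\<^sup>2 / 16 > 0" by simp
    then obtain N1 where N1: "\<And>n. n \<ge> N1 \<Longrightarrow> \<bar>b n - L\<bar> < \<epsilon>\<^sup>2 / 16"
      using bL unfolding LIMSEQ_def dist_real_def by blast
    obtain N2 where N2: "\<And>n. n \<ge> N2 \<Longrightarrow> \<bar>e n\<bar> < \<epsilon>\<^sup>2 / 16"
      using e0 \<open>\<epsilon>\<^sup>2 / 16 > 0\<close> unfolding LIMSEQ_def dist_real_def by (metis diff_zero)
    have *: "dist (x n) (x m) < \<epsilon>" if "n \<le> m" "n \<ge> max N1 N2" for n m
    proof -
      have "(dist (x n) (x m))\<^sup>2 \<le> 2 * (b m - b n) + 4 * e n" by (rule d[OF that(1)])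
      also have "\<dots> < \<epsilon>\<^sup>2" using N1[of n] N1[of m] N2[of n] that e(1)[of n] by (auto simp: abs_if split: if_splits)
      finally show ?thesis using \<open>\<epsilon> > 0\<close> by (meson less_imp_le power2_less_imp_less)
    qed
    show "\<exists>N. \<forall>m\<ge>N. \<forall>n\<ge>N. dist (x m) (x n) < \<epsilon>"
      by (intro exI[of _ "max N1 N2"]) (metis * dist_commute linear)
  qed
  then show ?thesis by (rule Cauchy_convergent)
qed

lemma (in finite_measure_subalgebra) nn_cond_exp_sum_finite:
  assumes "finite I" and [measurable]: "\<And>i. i \<in> I \<Longrightarrow> f i \<in> borel_measurable M"
    and "\<And>i. i \<in> I \<Longrightarrow> AE \<omega> in M. nn_cond_exp M F (f i) \<omega> \<noteq> \<infinity>"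
  shows "AE \<omega> in M. nn_cond_exp M F (\<lambda>\<omega>. \<Sum>i\<in>I. f i \<omega>) \<omega> \<noteq> \<infinity>"
  using assms
proof (induction I)
  case empty
  have "AE \<omega> in M. 0 = nn_cond_exp M F (\<lambda>\<omega>. 0) \<omega>" by (rule nn_cond_exp_F_meas) simp
  then show ?case by (auto elim: eventually_mono)
next
  case (insert i I)
  have "AE \<omega> in M. nn_cond_exp M F (f i) \<omega> + nn_cond_exp M F (\<lambda>\<omega>. \<Sum>i\<in>I. f i \<omega>) \<omega>
      = nn_cond_exp M F (\<lambda>\<omega>. f i \<omega> + (\<Sum>i\<in>I. f i \<omega>)) \<omega>"
    by (rule nn_cond_exp_sum) (auto intro!: insert.prems borel_measurable_sum)
  moreover have "AE \<omega> in M. nn_cond_exp M F (f i) \<omega> \<noteq> \<infinity>" using insert.prems by simp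
  moreover have "AE \<omega> in M. nn_cond_exp M F (\<lambda>\<omega>. \<Sum>i\<in>I. f i \<omega>) \<omega> \<noteq> \<infinity>"
    using insert by auto
  ultimately show ?case
  proof eventually_elim
    case (elim \<omega>)
    then show ?case using insert.hyps by (simp flip: elim(1))
  qed
qed

text \<open>An abstract period: \<open>Y\<close> is the price increment and \<open>V\<close> the
  value at its end. The conditions on the paths of \<open>V\<close> hold at every \<omega>, as
  versions corrected on a null set will provide. Finiteness is asked for constant wealth only, the
  form in which the value functions deliver it.\<close>

locale one_step = finite_measure_subalgebra M F for M F :: "'a measure" +
  fixes Y :: "'a \<Rightarrow> 'b::euclidean_space" and V :: "'a \<Rightarrow> real \<Rightarrow> real" and p q C :: real
  assumes Y[measurable]: "Y \<in> borel_measurable M"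
    and V_meas[measurable]: "\<And>x. (\<lambda>\<omega>. V \<omega> x) \<in> borel_measurable M"
    and V_mono: "\<And>\<omega>. mono (V \<omega>)" and V_concave: "\<And>\<omega>. concave_on UNIV (V \<omega>)"
    and V_bot: "\<And>\<omega>. filterlim (V \<omega>) at_bot at_bot"
    and V_halving: "\<And>\<omega>. halving p q C (V \<omega>)" and pq: "0 < q" "q < p" "0 \<le> C"
    and fin_const: "\<And>x \<xi>. \<xi> \<in> borel_measurable F \<Longrightarrow> AE \<omega> in M. nce (\<lambda>\<omega>. V \<omega> (x + \<xi> \<omega> \<bullet> Y \<omega>)) \<omega> \<noteq> \<infinity>"
    and NA: "\<And>\<theta>. \<theta> \<in> borel_measurable F \<Longrightarrow> AE \<omega> in M. 0 \<le> \<theta> \<omega> \<bullet> Y \<omega> \<Longrightarrow> AE \<omega> in M. \<theta> \<omega> \<bullet> Y \<omega> = 0"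
begin

section \<open>A priori estimates and existence of an optimal position in one period\<close>

definition pay :: "('a \<Rightarrow> real) \<Rightarrow> ('a \<Rightarrow> 'b) \<Rightarrow> 'a \<Rightarrow> real" where
  "pay X \<xi> \<omega> = V \<omega> (X \<omega> + \<xi> \<omega> \<bullet> Y \<omega>)"

lemma V_cont: "continuous_on UNIV (V \<omega>)"
  by (rule concave_UNIV_continuous[OF V_concave])

lemma measurable_V:
  assumes "X \<in> borel_measurable M" shows "(\<lambda>\<omega>. V \<omega> (X \<omega>)) \<in> borel_measurable M"
  by (rule measurable_random_continuous[OF V_meas V_cont assms])

lemma measurable_pay[measurable]:
  assumes "X \<in> borel_measurable F" "\<xi> \<in> borel_measurable F"
  shows "pay X \<xi> \<in> borel_measurable M"
proof -
  have [measurable]: "X \<in> borel_measurable M" "\<xi> \<in> borel_measurable M"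
    using assms by (auto intro: measurable_F_M)
  show ?thesis unfolding pay_def by (rule measurable_V) measurable
qed

text \<open>Random wealth is dominated by an integer-valued one, for which the countably many
  constant levels are pasted.\<close>

lemma fin:
  assumes [measurable]: "X \<in> borel_measurable F" "\<xi> \<in> borel_measurable F"
  shows "AE \<omega> in M. nce (pay X \<xi>) \<omega> \<noteq> \<infinity>"
proof -
  define N where "N \<omega> = nat \<lceil>X \<omega>\<rceil>" for \<omega>
  have N[measurable]: "N \<in> measurable F (count_space UNIV)" unfolding N_def by measurable
  have XN: "X \<omega> \<le> real (N \<omega>)" for \<omega> unfolding N_def by linarith
  have [measurable]: "(\<lambda>\<omega>. real (N \<omega>)) \<in> borel_measurable F" by measurable
  have "AE \<omega> in M. nce (pay X \<xi>) \<omega> \<le> nce (pay (\<lambda>\<omega>. real (N \<omega>)) \<xi>) \<omega>"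
  proof (rule nn_cond_exp_mono)
    show "AE \<omega> in M. ennreal (pay X \<xi> \<omega>) \<le> ennreal (pay (\<lambda>\<omega>. real (N \<omega>)) \<xi> \<omega>)"
      by (auto intro!: AE_I2 ennreal_leI monoD[OF V_mono] XN simp: pay_def)
  qed measurable
  moreover have "AE \<omega> in M. nce (pay (\<lambda>\<omega>. real (N \<omega>)) \<xi>) \<omega> = nce (pay (\<lambda>_. real (N \<omega>)) \<xi>) \<omega>"
  proof -
    have "AE \<omega> in M. nn_cond_exp M F (\<lambda>\<omega>. (\<lambda>n \<omega>. ennreal (pay (\<lambda>_. real n) \<xi> \<omega>)) (N \<omega>) \<omega>) \<omega>
        = nn_cond_exp M F ((\<lambda>n \<omega>. ennreal (pay (\<lambda>_. real n) \<xi> \<omega>)) (N \<omega>)) \<omega>"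
      by (rule nn_cond_exp_paste) measurable
    then show ?thesis by (simp add: pay_def)
  qed
  moreover have "AE \<omega> in M. \<forall>n::nat. nce (pay (\<lambda>_. real n) \<xi>) \<omega> \<noteq> \<infinity>"
    using fin_const by (simp add: AE_all_countable pay_def)
  ultimately show ?thesis by eventually_elim (auto simp: top_unique)
qed

lemma gce_pay_paste:
  fixes N :: "'a \<Rightarrow> nat" and c :: "nat \<Rightarrow> 'a \<Rightarrow> 'b"
  assumes [measurable]: "X \<in> borel_measurable F" "\<And>n. c n \<in> borel_measurable F"
    and [measurable]: "N \<in> measurable F (count_space UNIV)"
  shows "AE \<omega> in M. gce (pay X (\<lambda>\<omega>. c (N \<omega>) \<omega>)) \<omega> = gce (pay X (c (N \<omega>))) \<omega>"
proof -
  have "AE \<omega> in M. gce (\<lambda>\<omega>. (\<lambda>n. pay X (c n)) (N \<omega>) \<omega>) \<omega> = gce ((\<lambda>n. pay X (c n)) (N \<omega>)) \<omega>"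
    by (rule gce_paste) measurable
  then show ?thesis by (simp add: pay_def)
qed

text \<open>Let \<open>P\<close> and \<open>N\<close> be the conditional positive and negative parts
  of the payoff. Halving gives \<open>p P \<le> b + q N + C\<close>, while
  \<open>w + N \<le> P\<close>; eliminating \<open>P\<close> bounds \<open>N\<close>. The second
  conclusion is the halving inequality one period earlier, with unchanged constants. Both
  \<open>w\<close> and \<open>b\<close> are quantified inside the almost-sure statement so that they
  may depend on \<omega>.\<close>

lemma half_bounds:
  assumes [measurable]: "X \<in> borel_measurable F" "\<xi> \<in> borel_measurable F"
  shows "AE \<omega> in M. \<forall>w b. ereal w \<le> gce (pay X \<xi>) \<omega> \<longrightarrow>
    gce (pay (\<lambda>\<omega>. X \<omega> / 2) (\<lambda>\<omega>. \<xi> \<omega> /\<^sub>R 2)) \<omega> \<le> ereal b \<longrightarrow>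
      nce (\<lambda>\<omega>. - pay X \<xi> \<omega>) \<omega> \<le> ennreal ((b + C - p * w) / (p - q)) \<and>
      p * max w 0 - q * max (- w) 0 - C \<le> b"
proof -
  let ?h = "pay X \<xi>" and ?k = "pay (\<lambda>\<omega>. X \<omega> / 2) (\<lambda>\<omega>. \<xi> \<omega> /\<^sub>R 2)"
  have "AE \<omega> in M. ennreal p * nce ?h \<omega> + ennreal 1 * nce (\<lambda>\<omega>. - ?k \<omega>) \<omega> + ennreal 0 * nn_cond_exp M F (\<lambda>_. 1) \<omega>
      \<le> ennreal 1 * nce ?k \<omega> + ennreal q * nce (\<lambda>\<omega>. - ?h \<omega>) \<omega> + ennreal C * nn_cond_exp M F (\<lambda>_. 1) \<omega>"
  proof (rule nn_cond_exp_le3)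
    show "AE \<omega> in M. ennreal p * ennreal (?h \<omega>) + ennreal 1 * ennreal (- ?k \<omega>) + ennreal 0 * 1
      \<le> ennreal 1 * ennreal (?k \<omega>) + ennreal q * ennreal (- ?h \<omega>) + ennreal C * 1"
    proof (rule AE_I2)
      fix \<omega>
      have half: "X \<omega> / 2 + (\<xi> \<omega> /\<^sub>R 2) \<bullet> Y \<omega> = (X \<omega> + \<xi> \<omega> \<bullet> Y \<omega>) / 2" by (simp add: field_simps)
      have "p * max (?h \<omega>) 0 - q * max (- ?h \<omega>) 0 - C \<le> ?k \<omega>"
        unfolding pay_def half using V_halving[of \<omega>] by (simp add: halving_def)
      then have "ennreal p * ennreal (?h \<omega>) + ennreal 1 * ennreal (- ?k \<omega>) + ennreal 0 * ennreal 1
        \<le> ennreal 1 * ennreal (?k \<omega>) + ennreal q * ennreal (- ?h \<omega>) + ennreal C * ennreal 1"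
        using pq by (intro ennreal_le3) (auto simp: max_def split: if_splits)
      then show "ennreal p * ennreal (?h \<omega>) + ennreal 1 * ennreal (- ?k \<omega>) + ennreal 0 * 1
        \<le> ennreal 1 * ennreal (?k \<omega>) + ennreal q * ennreal (- ?h \<omega>) + ennreal C * 1" by simp
    qed
  qed measurable
  moreover have "AE \<omega> in M. nce ?h \<omega> \<noteq> \<infinity>" "AE \<omega> in M. nce ?k \<omega> \<noteq> \<infinity>"
    by (rule fin; measurable)+
  ultimately show ?thesis using nn_cond_exp_one
  proof eventually_elim
    case (elim \<omega>)
    show ?case
    proof (intro allI impI)
      fix w b assume w: "ereal w \<le> gce ?h \<omega>" and b: "gce ?k \<omega> \<le> ereal b"
      obtain P where P: "nce ?h \<omega> = ennreal P" "P \<ge> 0" using elim(2) by (rule ennreal_finiteE)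
      obtain Q where Q: "nce ?k \<omega> = ennreal Q" "Q \<ge> 0" using elim(3) by (rule ennreal_finiteE)
      obtain N where N: "nce (\<lambda>\<omega>. - ?h \<omega>) \<omega> = ennreal N" "0 \<le> N" "w + N \<le> P"
        using w P unfolding ereal_le_gce_iff[OF elim(2)] by auto
      have le: "ennreal (p * P) + nce (\<lambda>\<omega>. - ?k \<omega>) \<omega> \<le> ennreal (Q + q * N + C)"
        using elim(1,4) P Q N pq by (simp add: ennreal_mult)
      then have "nce (\<lambda>\<omega>. - ?k \<omega>) \<omega> \<noteq> \<infinity>" by (auto simp: top_unique)
      then obtain R where R: "nce (\<lambda>\<omega>. - ?k \<omega>) \<omega> = ennreal R" "R \<ge> 0" by (rule ennreal_finiteE)
      have "p * P + R \<le> Q + q * N + C"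
        using le R P Q N pq by (simp flip: ennreal_plus)
      moreover have "Q \<le> b + R" using b R Q unfolding gce_le_ereal_iff[OF elim(3)] by auto
      ultimately have *: "p * P \<le> b + q * N + C" by linarith
      have "p * (w + N) \<le> p * P" using N pq by (intro mult_left_mono) auto
      then have **: "p * w + (p - q) * N \<le> b + C" using * by (simp add: algebra_simps)
      have "N \<le> (b + C - p * w) / (p - q)" using ** pq by (simp add: field_simps)
      \<comment> \<open>For \<open>w \<ge> 0\<close> the term \<open>(p - q) N\<close> is dropped,
        for \<open>w < 0\<close> the term \<open>(p - q) P\<close>; both are nonnegative because
        \<open>q < p\<close>.\<close>
      moreover have "p * max w 0 - q * max (- w) 0 - C \<le> b"
      proof (cases "w \<ge> 0")
        case True
        have "(p - q) * N \<ge> 0" using pq N by simp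
        then show ?thesis using True ** by (simp add: max_def)
      next
        case False
        have "q * N \<le> q * (P - w)" using N pq by (intro mult_left_mono) auto
        moreover have "(p - q) * P \<ge> 0" using pq P by simp
        ultimately show ?thesis using False * by (simp add: max_def algebra_simps)
      qed
      ultimately show "nce (\<lambda>\<omega>. - ?h \<omega>) \<omega> \<le> ennreal ((b + C - p * w) / (p - q)) \<and>
          p * max w 0 - q * max (- w) 0 - C \<le> b"
        using N by (auto intro: ennreal_leI)
    qed
  qed
qed

text \<open>The positions reaching the level \<open>w\<close> form a class stable under pasting,
  since conditional values paste. Minimality in norm serves two ends: it excludes redundant
  components, and it makes a sequence of such choices converge.\<close>

lemma near_minimal_strategy:
  assumes [measurable]: "X \<in> borel_measurable F" and "e > 0"
    and ne: "\<exists>\<xi>\<in>borel_measurable F. AE \<omega> in M. ereal (w \<omega>) \<le> gce (pay X \<xi>) \<omega>"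
  shows "\<exists>\<xi>. \<xi> \<in> borel_measurable F \<and> (AE \<omega> in M. ereal (w \<omega>) \<le> gce (pay X \<xi>) \<omega>) \<and>
    (\<forall>\<xi>'. \<xi>' \<in> borel_measurable F \<longrightarrow> (AE \<omega> in M. ereal (w \<omega>) \<le> gce (pay X \<xi>') \<omega>) \<longrightarrow>
        (AE \<omega> in M. (norm (\<xi> \<omega>))\<^sup>2 \<le> (norm (\<xi>' \<omega>))\<^sup>2 + e))"
proof -
  define \<C> where "\<C> = {\<xi> \<in> borel_measurable F. AE \<omega> in M. ereal (w \<omega>) \<le> gce (pay X \<xi>) \<omega>}"
  obtain \<xi> where "\<xi> \<in> \<C>" "\<And>\<xi>'. \<xi>' \<in> \<C> \<Longrightarrow> AE \<omega> in M. (norm (\<xi> \<omega>))\<^sup>2 \<le> (norm (\<xi>' \<omega>))\<^sup>2 + e"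
  proof (rule near_minimal_norm[OF subalg, of \<C> e])
    show "\<C> \<noteq> {}" using ne by (auto simp: \<C>_def)
    show "c \<in> borel_measurable F" if "c \<in> \<C>" for c using that by (simp add: \<C>_def)
    fix c :: "nat \<Rightarrow> 'a \<Rightarrow> 'b" and N :: "'a \<Rightarrow> nat" assume c: "\<And>n. c n \<in> \<C>" and N[measurable]: "N \<in> measurable F (count_space UNIV)"
    have [measurable]: "c n \<in> borel_measurable F" for n using c by (simp add: \<C>_def)
    have "(\<lambda>\<omega>. c (N \<omega>) \<omega>) \<in> borel_measurable F"
      by (rule measurable_compose_countable[where f=c and g=N]) measurable
    moreover have "AE \<omega> in M. \<forall>n. ereal (w \<omega>) \<le> gce (pay X (c n)) \<omega>"
      using c by (simp add: \<C>_def AE_all_countable)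
    then have "AE \<omega> in M. ereal (w \<omega>) \<le> gce (pay X (\<lambda>\<omega>. c (N \<omega>) \<omega>)) \<omega>"
      using gce_pay_paste[of X c N] by (auto elim!: eventually_elim2)
    ultimately show "(\<lambda>\<omega>. c (N \<omega>) \<omega>) \<in> \<C>" by (simp add: \<C>_def)
  qed (use \<open>e > 0\<close> in auto)
  then show ?thesis by (auto simp: \<C>_def)
qed

lemma gce_pay_cong:
  assumes [measurable]: "X \<in> borel_measurable F" "\<xi> \<in> borel_measurable F" "\<xi>' \<in> borel_measurable F"
    and "AE \<omega> in M. \<xi>' \<omega> \<bullet> Y \<omega> = \<xi> \<omega> \<bullet> Y \<omega>"
  shows "AE \<omega> in M. gce (pay X \<xi>') \<omega> = gce (pay X \<xi>) \<omega>"
proof (rule gce_cong)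
  show "AE \<omega> in M. pay X \<xi>' \<omega> = pay X \<xi> \<omega>"
    using assms(4) by eventually_elim (simp add: pay_def)
qed measurable

text \<open>If the norms diverged, a cluster point of the directions would be an arbitrage opportunity or
  a redundant direction, and removing the latter would shorten the strategies.\<close>

lemma no_divergence:
  assumes A[measurable]: "A \<in> sets F"
    and x[measurable]: "\<And>n. x n \<in> borel_measurable F" and \<xi>[measurable]: "\<And>n. \<xi> n \<in> borel_measurable F"
    and bound: "\<And>n. AE \<omega> in M. \<omega> \<in> A \<longrightarrow> nce (\<lambda>\<omega>. - pay (x n) (\<xi> n) \<omega>) \<omega> \<le> ennreal (K \<omega>)"
    and upper: "\<And>n \<omega>. x n \<omega> \<le> X \<omega>"
    and minimal: "\<And>n \<xi>'. \<xi>' \<in> borel_measurable F \<Longrightarrow> AE \<omega> in M. \<xi>' \<omega> \<bullet> Y \<omega> = \<xi> n \<omega> \<bullet> Y \<omega> \<Longrightarrow>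
        AE \<omega> in M. norm (\<xi> n \<omega>) \<le> norm (\<xi>' \<omega>) + 1"
  shows "AE \<omega> in M. \<omega> \<in> A \<longrightarrow> \<not> filterlim (\<lambda>n. norm (x n \<omega>, \<xi> n \<omega>)) at_top sequentially"
proof -
  define r where "r n \<omega> = norm (x n \<omega>, \<xi> n \<omega>)" for n \<omega>
  have [measurable]: "r n \<in> borel_measurable F" for n unfolding r_def by measurable
  \<comment> \<open>Divergence is expressed with countable quantifiers, so that the event is
    \<open>F\<close>-measurable.\<close>
  define D where "D \<omega> \<longleftrightarrow> \<omega> \<in> A \<and> (\<forall>k::nat. \<exists>N. \<forall>n\<ge>N. real k \<le> r n \<omega>)" for \<omega>
  have [measurable]: "Measurable.pred F D" unfolding D_def by measurable
  have D_iff: "D \<omega> \<longleftrightarrow> \<omega> \<in> A \<and> filterlim (\<lambda>n. r n \<omega>) at_top sequentially" for \<omega>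
    unfolding D_def filterlim_at_top eventually_sequentially
    by (meson order_trans real_arch_simple)
  \<comment> \<open>Wealth is normalized together with the position, because in one application it
    tends to minus infinity itself. Where \<open>r n \<omega> = 0\<close> the quotient is 0, and the
    norm bound persists.\<close>
  define z where "z n \<omega> = (1 / r n \<omega>) *\<^sub>R (x n \<omega>, \<xi> n \<omega>)" for n \<omega>
  have z_meas[measurable]: "z n \<in> borel_measurable F" for n unfolding z_def by measurable
  have z_norm: "norm (z n \<omega>) \<le> 1" for n \<omega>
    unfolding z_def norm_scaleR using norm_ge_zero[of "(x n \<omega>, \<xi> n \<omega>)"] by (simp add: r_def)
  obtain \<tau> :: "nat \<Rightarrow> 'a \<Rightarrow> nat" where \<tau>[measurable]: "\<And>k. \<tau> k \<in> measurable F (count_space UNIV)"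
    and \<tau>_mono: "\<And>\<omega>. strict_mono (\<lambda>k. \<tau> k \<omega>)" and conv: "\<And>\<omega>. convergent (\<lambda>k. z (\<tau> k \<omega>) \<omega>)"
    by (rule measurable_subsequence[OF z_meas z_norm]) (rule that)
  define zl where "zl \<omega> = lim (\<lambda>k. z (\<tau> k \<omega>) \<omega>)" for \<omega>
  have zl: "(\<lambda>k. z (\<tau> k \<omega>) \<omega>) \<longlonglongrightarrow> zl \<omega>" for \<omega>
    using conv[of \<omega>] by (simp add: zl_def convergent_LIMSEQ_iff)
  have [measurable]: "(\<lambda>\<omega>. z (\<tau> k \<omega>) \<omega>) \<in> borel_measurable F" for k
    by (rule measurable_compose_countable[where f=z and g="\<tau> k"]) measurable
  have zl_meas[measurable]: "zl \<in> borel_measurable F"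
    by (rule borel_measurable_LIMSEQ_metric[OF _ zl]) measurable
  have [measurable]: "(\<lambda>\<omega>. snd (zl \<omega>)) \<in> borel_measurable F"
    by (rule measurable_compose[OF zl_meas borel_measurable_continuous_onI[OF continuous_on_snd[OF continuous_on_id]]])
  define \<theta> where "\<theta> \<omega> = (if D \<omega> then snd (zl \<omega>) else 0)" for \<omega>
  have \<theta>_meas[measurable]: "\<theta> \<in> borel_measurable F" unfolding \<theta>_def by measurable
  have r_top: "filterlim (\<lambda>k. r (\<tau> k \<omega>) \<omega>) at_top sequentially" if "D \<omega>" for \<omega>
    using filterlim_compose[OF _ filterlim_subseq[OF \<tau>_mono]] that D_iff by blast
  have zl_norm: "norm (zl \<omega>) = 1" if "D \<omega>" for \<omega>
  proof -
    have "eventually (\<lambda>k. r (\<tau> k \<omega>) \<omega> > 0) sequentially"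
      using r_top[OF that] by (simp add: filterlim_at_top_dense)
    then have "eventually (\<lambda>k. norm (z (\<tau> k \<omega>) \<omega>) = 1) sequentially"
      by eventually_elim (simp add: z_def norm_scaleR r_def del: scaleR_Pair)
    then have "(\<lambda>k. norm (z (\<tau> k \<omega>) \<omega>)) \<longlonglongrightarrow> 1" by (rule tendsto_eventually)
    then show ?thesis using LIMSEQ_unique tendsto_norm[OF zl] by blast
  qed
  have inv0: "(\<lambda>k. 1 / r (\<tau> k \<omega>) \<omega>) \<longlonglongrightarrow> 0" if "D \<omega>" for \<omega>
    using tendsto_divide_0[OF tendsto_const filterlim_at_top_imp_at_infinity[OF r_top[OF that]]] .
  \<comment> \<open>Wealths bounded above by \<open>X \<omega>\<close> leave no positive component
    after division by norms tending to infinity.\<close>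
  have zl_fst: "fst (zl \<omega>) \<le> 0" if "D \<omega>" for \<omega>
  proof (rule LIMSEQ_le)
    show "(\<lambda>k. fst (z (\<tau> k \<omega>) \<omega>)) \<longlonglongrightarrow> fst (zl \<omega>)" by (intro tendsto_intros zl)
    show "(\<lambda>k. X \<omega> * (1 / r (\<tau> k \<omega>) \<omega>)) \<longlonglongrightarrow> 0"
      using tendsto_mult_right_zero[OF inv0[OF that]] .
    show "\<exists>N. \<forall>k\<ge>N. fst (z (\<tau> k \<omega>) \<omega>) \<le> X \<omega> * (1 / r (\<tau> k \<omega>) \<omega>)"
      using upper by (auto simp: z_def r_def intro!: divide_right_mono)
  qed
  \<comment> \<open>A negative limiting payoff, multiplied by the diverging norms, would send the
    terminal wealth and hence \<open>V\<close> to minus infinity. The negative parts would then have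
    infinite liminf, contrary to Fatou's lemma and the bound \<open>K\<close>.\<close>
  have pos: "AE \<omega> in M. D \<omega> \<longrightarrow> 0 \<le> fst (zl \<omega>) + snd (zl \<omega>) \<bullet> Y \<omega>"
  proof -
    define h where "h k \<omega> = - pay (x (\<tau> k \<omega>)) (\<xi> (\<tau> k \<omega>)) \<omega>" for k \<omega>
    have [measurable]: "h k \<in> borel_measurable M" for k
      unfolding h_def using measurable_F_M[OF \<tau>[of k]]
      by (intro measurable_compose_countable[where f="\<lambda>i \<omega>. - pay (x i) (\<xi> i) \<omega>" and g="\<tau> k"]) auto
    have "AE \<omega> in M. nce (h k) \<omega> = nce (\<lambda>\<omega>'. - pay (x (\<tau> k \<omega>)) (\<xi> (\<tau> k \<omega>)) \<omega>') \<omega>" for k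
      unfolding h_def
      by (rule nn_cond_exp_paste[of "\<lambda>n \<omega>. ennreal (- pay (x n) (\<xi> n) \<omega>)" "\<tau> k"]) measurable
    then have "AE \<omega> in M. \<forall>k. nce (h k) \<omega> = nce (\<lambda>\<omega>'. - pay (x (\<tau> k \<omega>)) (\<xi> (\<tau> k \<omega>)) \<omega>') \<omega>"
      by (simp add: AE_all_countable)
    moreover have "AE \<omega> in M. \<forall>n. \<omega> \<in> A \<longrightarrow> nce (\<lambda>\<omega>. - pay (x n) (\<xi> n) \<omega>) \<omega> \<le> ennreal (K \<omega>)"
      by (subst AE_all_countable) (use bound in blast)
    moreover have "AE \<omega> in M. nn_cond_exp M F (\<lambda>\<omega>. liminf (\<lambda>k. ennreal (h k \<omega>))) \<omega> \<le> liminf (\<lambda>k. nce (h k) \<omega>)"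
      by (rule nn_cond_exp_Fatou) measurable
    moreover have "AE \<omega> in M. nn_cond_exp M F (\<lambda>\<omega>. liminf (\<lambda>k. ennreal (h k \<omega>))) \<omega> \<noteq> \<infinity> \<longrightarrow>
        liminf (\<lambda>k. ennreal (h k \<omega>)) \<noteq> \<infinity>"
      by (rule nn_cond_exp_finite) measurable
    ultimately show ?thesis
    proof eventually_elim
      case (elim \<omega>)
      show ?case
      proof (intro impI, rule ccontr)
        assume D: "D \<omega>" and neg: "\<not> 0 \<le> fst (zl \<omega>) + snd (zl \<omega>) \<bullet> Y \<omega>"
        then have "\<omega> \<in> A" by (simp add: D_def)
        then have "nce (h k) \<omega> \<le> ennreal (K \<omega>)" for k using elim(1,2) by simp
        then have "liminf (\<lambda>k. nce (h k) \<omega>) \<le> ennreal (K \<omega>)"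
          by (intro Liminf_le) auto
        then have "liminf (\<lambda>k. ennreal (h k \<omega>)) \<noteq> \<infinity>"
          using elim(3,4) by (auto simp: top_unique dest: order_trans)
        moreover have "(\<lambda>k. ennreal (h k \<omega>)) \<longlonglongrightarrow> \<infinity>"
        proof -
          have "(\<lambda>k. fst (z (\<tau> k \<omega>) \<omega>) + snd (z (\<tau> k \<omega>) \<omega>) \<bullet> Y \<omega>) \<longlonglongrightarrow> fst (zl \<omega>) + snd (zl \<omega>) \<bullet> Y \<omega>"
            by (intro tendsto_intros zl)
          then have "filterlim (\<lambda>k. (fst (z (\<tau> k \<omega>) \<omega>) + snd (z (\<tau> k \<omega>) \<omega>) \<bullet> Y \<omega>) * r (\<tau> k \<omega>) \<omega>) at_bot sequentially"
            using neg by (intro filterlim_tendsto_neg_mult_at_bot[OF _ _ r_top[OF D]]) auto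
          moreover have "eventually (\<lambda>k. (fst (z (\<tau> k \<omega>) \<omega>) + snd (z (\<tau> k \<omega>) \<omega>) \<bullet> Y \<omega>) * r (\<tau> k \<omega>) \<omega>
              = x (\<tau> k \<omega>) \<omega> + \<xi> (\<tau> k \<omega>) \<omega> \<bullet> Y \<omega>) sequentially"
          proof -
            have "eventually (\<lambda>k. r (\<tau> k \<omega>) \<omega> > 0) sequentially"
              using r_top[OF D] by (simp add: filterlim_at_top_dense)
            then show ?thesis by eventually_elim (simp add: z_def field_simps)
          qed
          ultimately have "filterlim (\<lambda>k. x (\<tau> k \<omega>) \<omega> + \<xi> (\<tau> k \<omega>) \<omega> \<bullet> Y \<omega>) at_bot sequentially"
            by (simp cong: filterlim_cong)
          then have "filterlim (\<lambda>k. - h k \<omega>) at_bot sequentially"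
            unfolding h_def pay_def using filterlim_compose[OF V_bot] by simp
          then have "filterlim (\<lambda>k. h k \<omega>) at_top sequentially"
            by (simp add: filterlim_uminus_at_top)
          then show ?thesis by (simp add: ennreal_tendsto_top_eq_at_top)
        qed
        ultimately show False using lim_imp_Liminf[OF trivial_limit_sequentially] by metis
      qed
    qed
  qed
  have "AE \<omega> in M. 0 \<le> \<theta> \<omega> \<bullet> Y \<omega>"
    using pos by eventually_elim (use zl_fst in \<open>force simp: \<theta>_def\<close>)
  from NA[OF \<theta>_meas this] have \<theta>Y: "AE \<omega> in M. \<theta> \<omega> \<bullet> Y \<omega> = 0" .
  \<comment> \<open>Payoffs are unchanged since \<open>\<theta> \<bullet> Y = 0\<close>. On the
    divergence event, after division by \<open>r\<close> along the subsequence, the original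
    positions tend to the unit vector \<theta> and the shortened ones to 0; the slack 1 of
    near-minimality vanishes in the limit, a contradiction.\<close>
  define \<xi>' where "\<xi>' n \<omega> = \<xi> n \<omega> - norm (\<xi> n \<omega>) *\<^sub>R \<theta> \<omega>" for n \<omega>
  have "AE \<omega> in M. norm (\<xi> n \<omega>) \<le> norm (\<xi>' n \<omega>) + 1" for n
  proof (rule minimal)
    show "\<xi>' n \<in> borel_measurable F" unfolding \<xi>'_def by measurable
    show "AE \<omega> in M. \<xi>' n \<omega> \<bullet> Y \<omega> = \<xi> n \<omega> \<bullet> Y \<omega>"
      using \<theta>Y by eventually_elim (simp add: \<xi>'_def inner_diff_left)
  qed
  then have "AE \<omega> in M. \<forall>n. norm (\<xi> n \<omega>) \<le> norm (\<xi>' n \<omega>) + 1" by (simp add: AE_all_countable)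
  then show ?thesis using pos \<theta>Y
  proof eventually_elim
    case (elim \<omega>)
    show ?case
    proof (rule ccontr)
      assume "\<not> (\<omega> \<in> A \<longrightarrow> \<not> filterlim (\<lambda>n. norm (x n \<omega>, \<xi> n \<omega>)) at_top sequentially)"
      then have D: "D \<omega>" unfolding D_iff r_def by simp
      \<comment> \<open>This component is nonpositive and, since
        \<open>\<theta> \<bullet> Y = 0\<close>, also nonnegative; hence the whole unit length lies
        in the position.\<close>
      have "fst (zl \<omega>) = 0" using elim(2,3) D zl_fst[OF D] by (simp add: \<theta>_def)
      then have n1: "norm (\<theta> \<omega>) = 1" using zl_norm[OF D] D by (simp add: \<theta>_def norm_prod_def)
      define y where "y k = snd (z (\<tau> k \<omega>) \<omega>)" for k
      have y: "y \<longlonglongrightarrow> \<theta> \<omega>" using tendsto_snd[OF zl[of \<omega>]] D by (simp add: y_def[abs_def] \<theta>_def)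
      have "norm (y k) \<le> norm (y k - norm (y k) *\<^sub>R \<theta> \<omega>) + 1 / r (\<tau> k \<omega>) \<omega>" for k
      proof -
        define n where "n = \<tau> k \<omega>"
        have r0: "r n \<omega> \<ge> 0" by (simp add: r_def)
        have yk: "y k = (1 / r n \<omega>) *\<^sub>R \<xi> n \<omega>" by (simp add: y_def z_def n_def)
        have "y k - norm (y k) *\<^sub>R \<theta> \<omega> = (1 / r n \<omega>) *\<^sub>R \<xi>' n \<omega>"
          unfolding yk \<xi>'_def using r0 by (simp add: scaleR_diff_right)
        then have "norm (y k - norm (y k) *\<^sub>R \<theta> \<omega>) + 1 / r n \<omega> = (norm (\<xi>' n \<omega>) + 1) / r n \<omega>"
          using r0 by (simp add: add_divide_distrib)
        moreover have "norm (y k) = norm (\<xi> n \<omega>) / r n \<omega>" unfolding yk using r0 by simp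
        ultimately show ?thesis using elim(1) r0 by (simp add: n_def divide_right_mono)
      qed
      moreover have "(\<lambda>k. norm (y k - norm (y k) *\<^sub>R \<theta> \<omega>) + 1 / r (\<tau> k \<omega>) \<omega>)
          \<longlonglongrightarrow> norm (\<theta> \<omega> - norm (\<theta> \<omega>) *\<^sub>R \<theta> \<omega>) + 0"
        by (intro tendsto_intros y inv0[OF D])
      ultimately have "norm (\<theta> \<omega>) \<le> norm (\<theta> \<omega> - norm (\<theta> \<omega>) *\<^sub>R \<theta> \<omega>) + 0"
        by (intro LIMSEQ_le[OF tendsto_norm[OF y]]) auto
      then show False using n1 by simp
    qed
  qed
qed

text \<open>Carries the condition \<open>V_bot\<close> one period back. If the values at all wealths
  \<open>- real n\<close> stayed above \<open>- real \<kappa>\<close>, near-optimal positions would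
  have bounded conditional negative parts although the pairs of wealth and position diverge, which
  \<open>no_divergence\<close> forbids.\<close>

lemma value_unbounded_below:
  assumes w[measurable]: "\<And>n::nat. w n \<in> borel_measurable F"
    and approx: "\<And>n. \<exists>\<xi>\<in>borel_measurable F. AE \<omega> in M. ereal (w n \<omega> - 1) \<le> gce (pay (\<lambda>_. - real n) \<xi>) \<omega>"
    and upper: "\<And>n \<xi>. \<xi> \<in> borel_measurable F \<Longrightarrow> AE \<omega> in M. gce (pay (\<lambda>_. - real n / 2) \<xi>) \<omega> \<le> ereal (b \<omega>)"
  shows "AE \<omega> in M. \<forall>\<kappa>::nat. \<exists>n. w n \<omega> < - real \<kappa>"
proof -
  have "\<exists>\<xi>. \<xi> \<in> borel_measurable F \<and> (AE \<omega> in M. ereal (w n \<omega> - 1) \<le> gce (pay (\<lambda>_. - real n) \<xi>) \<omega>) \<and>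
    (\<forall>\<xi>'. \<xi>' \<in> borel_measurable F \<longrightarrow> (AE \<omega> in M. ereal (w n \<omega> - 1) \<le> gce (pay (\<lambda>_. - real n) \<xi>') \<omega>) \<longrightarrow>
        (AE \<omega> in M. (norm (\<xi> \<omega>))\<^sup>2 \<le> (norm (\<xi>' \<omega>))\<^sup>2 + 1))" for n
    by (rule near_minimal_strategy[OF _ _ approx]) auto
  from choice[OF allI[OF this]] obtain \<xi> where *: "\<forall>n. \<xi> n \<in> borel_measurable F \<and> (AE \<omega> in M. ereal (w n \<omega> - 1) \<le> gce (pay (\<lambda>_. - real n) (\<xi> n)) \<omega>) \<and>
    (\<forall>\<xi>'. \<xi>' \<in> borel_measurable F \<longrightarrow> (AE \<omega> in M. ereal (w n \<omega> - 1) \<le> gce (pay (\<lambda>_. - real n) \<xi>') \<omega>) \<longrightarrow>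
        (AE \<omega> in M. (norm (\<xi> n \<omega>))\<^sup>2 \<le> (norm (\<xi>' \<omega>))\<^sup>2 + 1))" ..
  note \<xi>[measurable] = *[rule_format, THEN conjunct1]
  note \<xi>w = *[rule_format, THEN conjunct2, THEN conjunct1]
  note \<xi>min = *[THEN spec, THEN conjunct2, THEN conjunct2, rule_format]
  have "AE \<omega> in M. \<exists>n. w n \<omega> < - real \<kappa>" for \<kappa> :: nat
  proof -
    define A where "A = {\<omega> \<in> space F. \<forall>n. - real \<kappa> \<le> w n \<omega>}"
    have [measurable]: "A \<in> sets F" unfolding A_def by measurable
    have "AE \<omega> in M. \<omega> \<in> A \<longrightarrow> \<not> filterlim (\<lambda>n. norm (- real n, \<xi> n \<omega>)) at_top sequentially"
    \<comment> \<open>The bound \<open>K\<close> is that of \<open>half_bounds\<close> at level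
      \<open>- real \<kappa> - 1\<close>; the 1 is the tolerance in the choice of
      \<open>\<xi> n\<close>.\<close>
    proof (rule no_divergence[where X="\<lambda>_. 0" and K="\<lambda>\<omega>. (b \<omega> + C - p * (- real \<kappa> - 1)) / (p - q)"])
      fix n
      have "AE \<omega> in M. gce (pay (\<lambda>_. - real n / 2) (\<lambda>\<omega>. \<xi> n \<omega> /\<^sub>R 2)) \<omega> \<le> ereal (b \<omega>)"
        by (rule upper) measurable
      with half_bounds[OF borel_measurable_const \<xi>[of n], of "- real n"] \<xi>w[of n]
      show "AE \<omega> in M. \<omega> \<in> A \<longrightarrow> nce (\<lambda>\<omega>. - pay (\<lambda>_. - real n) (\<xi> n) \<omega>) \<omega>
          \<le> ennreal ((b \<omega> + C - p * (- real \<kappa> - 1)) / (p - q))"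
      proof eventually_elim
        case (elim \<omega>)
        show ?case
        proof
          assume "\<omega> \<in> A"
          then have "ereal (- real \<kappa> - 1) \<le> ereal (w n \<omega> - 1)" by (simp add: A_def)
          with elim(2) have "ereal (- real \<kappa> - 1) \<le> gce (pay (\<lambda>_. - real n) (\<xi> n)) \<omega>" by (rule order_trans[rotated])
          with elim(1,3) show "nce (\<lambda>\<omega>. - pay (\<lambda>_. - real n) (\<xi> n) \<omega>) \<omega>
              \<le> ennreal ((b \<omega> + C - p * (- real \<kappa> - 1)) / (p - q))" by blast
        qed
      qed
    next
      fix n \<xi>' assume \<xi>'[measurable]: "\<xi>' \<in> borel_measurable F" and eq: "AE \<omega> in M. \<xi>' \<omega> \<bullet> Y \<omega> = \<xi> n \<omega> \<bullet> Y \<omega>"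
      have "AE \<omega> in M. gce (pay (\<lambda>_. - real n) \<xi>') \<omega> = gce (pay (\<lambda>_. - real n) (\<xi> n)) \<omega>"
        by (rule gce_pay_cong[OF _ _ _ eq]) measurable
      with \<xi>w[of n] have "AE \<omega> in M. ereal (w n \<omega> - 1) \<le> gce (pay (\<lambda>_. - real n) \<xi>') \<omega>"
        by eventually_elim simp
      from \<xi>min[OF \<xi>' this] show "AE \<omega> in M. norm (\<xi> n \<omega>) \<le> norm (\<xi>' \<omega>) + 1"
        by eventually_elim (rule power2_le_imp_le, auto simp: power2_sum intro: add_increasing2)
    qed auto
    with AE_space show ?thesis
    proof eventually_elim
      case (elim \<omega>)
      have "filterlim (\<lambda>n. norm (- real n, \<xi> n \<omega>)) at_top sequentially"
      proof (rule filterlim_at_top_mono[OF filterlim_real_sequentially])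
        show "eventually (\<lambda>n. real n \<le> norm (- real n, \<xi> n \<omega>)) sequentially"
          using norm_fst_le[of "- real n" "\<xi> n \<omega>" for n] by (auto intro!: always_eventually)
      qed
      then have "\<omega> \<notin> A" using elim by blast
      then show ?case using elim(1) subalg by (auto simp: A_def subalgebra_def not_le)
    qed
  qed
  then show ?thesis by (simp add: AE_all_countable)
qed

text \<open>The tolerance \<open>e n\<close> is used twice, for the level reached and for the excess
  of the squared norm. The classes of candidates shrink with \<open>n\<close>, so later choices, and
  their midpoints with earlier ones, compete against the earlier choices; this yields both
  inequalities behind convergence.\<close>

lemma optimal_exists:
  assumes X[measurable]: "X \<in> borel_measurable F"
    and approx: "\<And>e. e > 0 \<Longrightarrow> \<exists>\<xi>\<in>borel_measurable F. AE \<omega> in M. ereal (w \<omega> - e) \<le> gce (pay X \<xi>) \<omega>"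
    and upper: "\<And>\<xi>. \<xi> \<in> borel_measurable F \<Longrightarrow> AE \<omega> in M. gce (pay (\<lambda>\<omega>. X \<omega> / 2) \<xi>) \<omega> \<le> ereal (b \<omega>)"
  obtains \<xi> where "\<xi> \<in> borel_measurable F" "AE \<omega> in M. ereal (w \<omega>) \<le> gce (pay X \<xi>) \<omega>"
proof -
  define e where "e n = 1 / (real n + 1)" for n
  have e: "0 < e n" "e n \<le> 1" for n by (auto simp: e_def)
  have e_anti: "n \<le> m \<Longrightarrow> e m \<le> e n" for n m by (auto simp: e_def intro!: divide_left_mono)
  have "\<exists>\<xi>. \<xi> \<in> borel_measurable F \<and> (AE \<omega> in M. ereal (w \<omega> - e n) \<le> gce (pay X \<xi>) \<omega>) \<and>
    (\<forall>\<xi>'. \<xi>' \<in> borel_measurable F \<longrightarrow> (AE \<omega> in M. ereal (w \<omega> - e n) \<le> gce (pay X \<xi>') \<omega>) \<longrightarrow>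
        (AE \<omega> in M. (norm (\<xi> \<omega>))\<^sup>2 \<le> (norm (\<xi>' \<omega>))\<^sup>2 + e n))" for n
    by (rule near_minimal_strategy[OF X e(1) approx[OF e(1)]])
  from choice[OF allI[OF this]] obtain \<xi> where *: "\<forall>n. \<xi> n \<in> borel_measurable F \<and> (AE \<omega> in M. ereal (w \<omega> - e n) \<le> gce (pay X (\<xi> n)) \<omega>) \<and>
    (\<forall>\<xi>'. \<xi>' \<in> borel_measurable F \<longrightarrow> (AE \<omega> in M. ereal (w \<omega> - e n) \<le> gce (pay X \<xi>') \<omega>) \<longrightarrow>
        (AE \<omega> in M. (norm (\<xi> n \<omega>))\<^sup>2 \<le> (norm (\<xi>' \<omega>))\<^sup>2 + e n))" ..
  note \<xi>[measurable] = *[rule_format, THEN conjunct1]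
  note \<xi>w = *[rule_format, THEN conjunct2, THEN conjunct1]
  note \<xi>min = *[THEN spec, THEN conjunct2, THEN conjunct2, rule_format]
  have sF: "space F \<in> sets F" by simp
  have "AE \<omega> in M. \<omega> \<in> space F \<longrightarrow> \<not> filterlim (\<lambda>n. norm (X \<omega>, \<xi> n \<omega>)) at_top sequentially"
  proof (rule no_divergence[where X=X and K="\<lambda>\<omega>. (b \<omega> + C - p * (w \<omega> - 1)) / (p - q)"])
    fix n
    have "AE \<omega> in M. gce (pay (\<lambda>\<omega>. X \<omega> / 2) (\<lambda>\<omega>. \<xi> n \<omega> /\<^sub>R 2)) \<omega> \<le> ereal (b \<omega>)"
      by (rule upper) measurable
    with half_bounds[OF X \<xi>[of n]] \<xi>w[of n]
    show "AE \<omega> in M. \<omega> \<in> space F \<longrightarrow> nce (\<lambda>\<omega>. - pay X (\<xi> n) \<omega>) \<omega>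
        \<le> ennreal ((b \<omega> + C - p * (w \<omega> - 1)) / (p - q))"
    proof eventually_elim
      case (elim \<omega>)
      have "ereal (w \<omega> - 1) \<le> ereal (w \<omega> - e n)" using e(2) by simp
      with elim(2) have "ereal (w \<omega> - 1) \<le> gce (pay X (\<xi> n)) \<omega>" by (rule order_trans[rotated])
      with elim(1,3) show ?case by blast
    qed
  next
    fix n \<xi>' assume \<xi>'[measurable]: "\<xi>' \<in> borel_measurable F" and eq: "AE \<omega> in M. \<xi>' \<omega> \<bullet> Y \<omega> = \<xi> n \<omega> \<bullet> Y \<omega>"
    have "AE \<omega> in M. gce (pay X \<xi>') \<omega> = gce (pay X (\<xi> n)) \<omega>"
      by (rule gce_pay_cong[OF _ _ _ eq]) measurable
    with \<xi>w[of n] have "AE \<omega> in M. ereal (w \<omega> - e n) \<le> gce (pay X \<xi>') \<omega>"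
      by eventually_elim simp
    from \<xi>min[OF \<xi>' this] show "AE \<omega> in M. norm (\<xi> n \<omega>) \<le> norm (\<xi>' \<omega>) + 1"
    proof eventually_elim
      case (elim \<omega>)
      then have "(norm (\<xi> n \<omega>))\<^sup>2 \<le> (norm (\<xi>' \<omega>) + 1)\<^sup>2"
        unfolding power2_sum using e(2)[of n] norm_ge_zero[of "\<xi>' \<omega>"] by (smt (verit) one_power2 mult_nonneg_nonneg)
      then show ?case by (rule power2_le_imp_le) simp
    qed
  qed (use sF in auto)
  then have bounded: "AE \<omega> in M. \<not> filterlim (\<lambda>n. norm (\<xi> n \<omega>)) at_top sequentially"
    using AE_space
  proof eventually_elim
    case (elim \<omega>)
    show ?case
    proof
      assume *: "filterlim (\<lambda>n. norm (\<xi> n \<omega>)) at_top sequentially"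
      have "filterlim (\<lambda>n. norm (X \<omega>, \<xi> n \<omega>)) at_top sequentially"
        by (rule filterlim_at_top_mono[OF *]) (auto intro!: always_eventually norm_snd_le)
      then show False using elim subalg by (simp add: subalgebra_def)
    qed
  qed
  have \<xi>wm: "AE \<omega> in M. ereal (w \<omega> - e n) \<le> gce (pay X (\<xi> m)) \<omega>" if "n \<le> m" for n m
    using \<xi>w[of m]
  proof eventually_elim
    case (elim \<omega>)
    have "ereal (w \<omega> - e n) \<le> ereal (w \<omega> - e m)" using e_anti[OF that] by simp
    then show ?case using elim by (rule order_trans)
  qed
  have "AE \<omega> in M. n \<le> m \<longrightarrow> (norm (\<xi> n \<omega>))\<^sup>2 \<le> (norm (\<xi> m \<omega>))\<^sup>2 + e n" for n m
    using \<xi>min[OF \<xi> \<xi>wm, of n m] by (cases "n \<le> m") auto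
  then have incr: "AE \<omega> in M. \<forall>n m. n \<le> m \<longrightarrow> (norm (\<xi> n \<omega>))\<^sup>2 \<le> (norm (\<xi> m \<omega>))\<^sup>2 + e n"
    by (simp add: AE_all_countable)
  have "AE \<omega> in M. n \<le> m \<longrightarrow> (norm (\<xi> n \<omega>))\<^sup>2 \<le> (norm ((1/2) *\<^sub>R (\<xi> n \<omega> + \<xi> m \<omega>)))\<^sup>2 + e n" for n m
  proof (cases "n \<le> m")
    case True
    have "AE \<omega> in M. ereal (w \<omega> - e n) \<le> gce (pay X (\<lambda>\<omega>. (1/2) *\<^sub>R (\<xi> n \<omega> + \<xi> m \<omega>))) \<omega>"
    proof (rule gce_midpoint[OF _ _ _ fin fin fin _ \<xi>w[of n] \<xi>wm[OF True]])
      show "AE \<omega> in M. (pay X (\<xi> n) \<omega> + pay X (\<xi> m) \<omega>) / 2 \<le> pay X (\<lambda>\<omega>. (1/2) *\<^sub>R (\<xi> n \<omega> + \<xi> m \<omega>)) \<omega>"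
      proof (rule AE_I2)
        fix \<omega>
        have "X \<omega> + ((1/2) *\<^sub>R (\<xi> n \<omega> + \<xi> m \<omega>)) \<bullet> Y \<omega> = ((X \<omega> + \<xi> n \<omega> \<bullet> Y \<omega>) + (X \<omega> + \<xi> m \<omega> \<bullet> Y \<omega>)) / 2"
          by (simp add: inner_add_left field_simps)
        then show "(pay X (\<xi> n) \<omega> + pay X (\<xi> m) \<omega>) / 2 \<le> pay X (\<lambda>\<omega>. (1/2) *\<^sub>R (\<xi> n \<omega> + \<xi> m \<omega>)) \<omega>"
          unfolding pay_def using concave_half[OF V_concave[of \<omega>], of "X \<omega> + \<xi> n \<omega> \<bullet> Y \<omega>" "X \<omega> + \<xi> m \<omega> \<bullet> Y \<omega>"]
          by metis
      qed
    qed measurable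
    then show ?thesis using \<xi>min[of "\<lambda>\<omega>. (1/2) *\<^sub>R (\<xi> n \<omega> + \<xi> m \<omega>)" n] by simp
  qed simp
  then have "AE \<omega> in M. \<forall>n m. n \<le> m \<longrightarrow> (norm (\<xi> n \<omega>))\<^sup>2 \<le> (norm ((1/2) *\<^sub>R (\<xi> n \<omega> + \<xi> m \<omega>)))\<^sup>2 + e n"
    by (simp add: AE_all_countable)
  with incr bounded have conv: "AE \<omega> in M. convergent (\<lambda>n. \<xi> n \<omega>)"
    by eventually_elim (rule near_minimal_convergent, auto simp: e_def)
  define \<xi>' where "\<xi>' \<omega> = lim (\<lambda>n. \<xi> n \<omega>)" for \<omega>
  have \<xi>'[measurable]: "\<xi>' \<in> borel_measurable F"
    unfolding \<xi>'_def by (rule borel_measurable_lim_metric) measurable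
  define R where "R \<omega> = real_of_ereal (SUP n. ereal (norm (\<xi> n \<omega>)))" for \<omega>
  have [measurable]: "R \<in> borel_measurable F" unfolding R_def by measurable
  have R: "AE \<omega> in M. \<forall>n. norm (\<xi> n \<omega>) \<le> R \<omega>"
    using conv
  proof eventually_elim
    case (elim \<omega>)
    then obtain B where B: "\<And>n. norm (\<xi> n \<omega>) \<le> B"
      using Bseq_def convergent_imp_Bseq by metis
    have le: "(SUP n. ereal (norm (\<xi> n \<omega>))) \<le> ereal B" using B by (intro SUP_least) simp
    have ge: "ereal (norm (\<xi> n \<omega>)) \<le> (SUP n. ereal (norm (\<xi> n \<omega>)))" for n by (rule SUP_upper) simp
    have "\<bar>SUP n. ereal (norm (\<xi> n \<omega>))\<bar> \<noteq> \<infinity>" using le ge[of 0] by auto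
    then have "(SUP n. ereal (norm (\<xi> n \<omega>))) = ereal (R \<omega>)" by (simp add: R_def ereal_real)
    then show ?case using ge by (metis ereal_less_eq(3))
  qed
  \<comment> \<open>Sign vectors: the multiples by \<open>R\<close> are the vertices of a cube
    containing every \<open>\<xi> n \<omega>\<close>. Whatever the direction of \<open>Y\<close>,
    one of these finitely many positions pays at least as much, so the sum of their positive parts
    dominates the sequence.\<close>
  define \<epsilon> :: "'b set \<Rightarrow> 'b" where "\<epsilon> I = (\<Sum>b\<in>Basis. if b \<in> I then b else - b)" for I
  define Z where "Z \<omega> = (\<Sum>I\<in>Pow Basis. max (pay X (\<lambda>\<omega>. R \<omega> *\<^sub>R \<epsilon> I) \<omega>) 0)" for \<omega>
  have [measurable]: "Z \<in> borel_measurable M" unfolding Z_def by measurable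
  have dom: "pay X (\<xi> n) \<omega> \<le> Z \<omega>" if "\<forall>n. norm (\<xi> n \<omega>) \<le> R \<omega>" for n \<omega>
  proof -
    define I where "I = {b \<in> Basis. 0 \<le> Y \<omega> \<bullet> b}"
    have "\<xi> n \<omega> \<bullet> Y \<omega> = (\<Sum>b\<in>Basis. (\<xi> n \<omega> \<bullet> b) * (Y \<omega> \<bullet> b))" by (rule euclidean_inner)
    also have "\<dots> \<le> (\<Sum>b\<in>Basis. R \<omega> * \<bar>Y \<omega> \<bullet> b\<bar>)"
    proof (rule sum_mono)
      fix b :: 'b assume b: "b \<in> Basis"
      have "(\<xi> n \<omega> \<bullet> b) * (Y \<omega> \<bullet> b) \<le> \<bar>\<xi> n \<omega> \<bullet> b\<bar> * \<bar>Y \<omega> \<bullet> b\<bar>" by (metis abs_ge_self abs_mult)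
      also have "\<dots> \<le> R \<omega> * \<bar>Y \<omega> \<bullet> b\<bar>"
        using Basis_le_norm[OF b, of "\<xi> n \<omega>"] that by (intro mult_right_mono) (auto intro: order_trans)
      finally show "(\<xi> n \<omega> \<bullet> b) * (Y \<omega> \<bullet> b) \<le> R \<omega> * \<bar>Y \<omega> \<bullet> b\<bar>" .
    qed
    also have "\<dots> = (R \<omega> *\<^sub>R \<epsilon> I) \<bullet> Y \<omega>"
      unfolding \<epsilon>_def inner_scaleR_left inner_sum_left sum_distrib_left
      by (intro sum.cong) (auto simp: I_def inner_commute)
    finally have "pay X (\<xi> n) \<omega> \<le> pay X (\<lambda>\<omega>. R \<omega> *\<^sub>R \<epsilon> I) \<omega>"
      unfolding pay_def by (intro monoD[OF V_mono]) simp
    also have "\<dots> \<le> max (pay X (\<lambda>\<omega>. R \<omega> *\<^sub>R \<epsilon> I) \<omega>) 0" by simp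
    also have "\<dots> \<le> Z \<omega>"
      unfolding Z_def by (rule member_le_sum) (auto simp: I_def)
    finally show ?thesis .
  qed
  have "AE \<omega> in M. ereal (w \<omega>) \<le> gce (pay X \<xi>') \<omega>"
  proof (rule gce_reverse_Fatou[where h="\<lambda>n. pay X (\<xi> n)" and Z=Z])
    show "AE \<omega> in M. (\<lambda>n. pay X (\<xi> n) \<omega>) \<longlonglongrightarrow> pay X \<xi>' \<omega>"
      using conv
    proof eventually_elim
      case (elim \<omega>)
      then have "(\<lambda>n. \<xi> n \<omega>) \<longlonglongrightarrow> \<xi>' \<omega>" by (simp add: \<xi>'_def convergent_LIMSEQ_iff)
      then show ?case unfolding pay_def
        by (intro continuous_on_tendsto_compose[OF V_cont] tendsto_intros) auto
    qed
    show "AE \<omega> in M. pay X (\<xi> n) \<omega> \<le> Z \<omega>" for n using R by eventually_elim (rule dom)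
    show "0 \<le> Z \<omega>" for \<omega> unfolding Z_def by (rule sum_nonneg) simp
    have "AE \<omega> in M. nn_cond_exp M F (\<lambda>\<omega>. \<Sum>I\<in>Pow Basis. ennreal (pay X (\<lambda>\<omega>. R \<omega> *\<^sub>R \<epsilon> I) \<omega>)) \<omega> \<noteq> \<infinity>"
    proof (rule nn_cond_exp_sum_finite)
      show "AE \<omega> in M. nce (pay X (\<lambda>\<omega>. R \<omega> *\<^sub>R \<epsilon> I)) \<omega> \<noteq> \<infinity>" for I
        by (rule fin) measurable
    qed (simp, measurable)
    moreover have "(\<lambda>\<omega>. \<Sum>I\<in>Pow Basis. ennreal (pay X (\<lambda>\<omega>. R \<omega> *\<^sub>R \<epsilon> I) \<omega>)) = (\<lambda>\<omega>. ennreal (Z \<omega>))"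
      unfolding Z_def by (subst sum_ennreal[symmetric]) (simp_all flip: ennreal_eq_max)
    ultimately show "AE \<omega> in M. nce Z \<omega> \<noteq> \<infinity>" by simp
    show "AE \<omega> in M. ereal (w \<omega> - 1 / (real n + 1)) \<le> gce (pay X (\<xi> n)) \<omega>" for n
      using \<xi>w[of n] by (simp add: e_def)
  qed measurable
  with \<xi>' show ?thesis by (rule that)
qed

end

section \<open>Dynamic programming\<close>

text \<open>The two functions differ only inside a null set \<open>N\<close>, and every measurable
  part of \<open>N\<close> is again null, hence in \<open>G\<close>. This brings
  \<open>W t x\<close>, a priori measurable for \<open>M\<close> alone, down to
  \<open>F t\<close>.\<close>

lemma measurable_sub_AE_eq:
  fixes f g :: "'a \<Rightarrow> 'b::topological_space"
  assumes "subalgebra M G" "null_sets M \<subseteq> sets G"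
    and f: "f \<in> borel_measurable G" and g: "g \<in> borel_measurable M" and eq: "AE \<omega> in M. f \<omega> = g \<omega>"
  shows "g \<in> borel_measurable G"
proof (rule measurableI)
  have sp: "space G = space M" using assms(1) by (simp add: subalgebra_def)
  obtain N where N: "N \<in> null_sets M" "{\<omega> \<in> space M. f \<omega> \<noteq> g \<omega>} \<subseteq> N"
    using eq by (auto elim!: AE_E intro: null_setsI)
  fix B :: "'b set" assume B: "B \<in> sets borel"
  have "g -` B \<inter> space M \<inter> N \<in> null_sets M"
    using N(1) g B by (intro null_set_Int1 measurable_sets) auto
  then have "g -` B \<inter> space M \<inter> N \<in> sets G" using assms(2) by blast
  moreover have "(f -` B \<inter> space G) - N \<in> sets G"
    using f B N(1) assms(2) by (intro sets.Diff measurable_sets) auto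
  moreover have "g -` B \<inter> space G = ((f -` B \<inter> space G) - N) \<union> (g -` B \<inter> space M \<inter> N)"
    using N(2) sp by auto
  ultimately show "g -` B \<inter> space G \<in> sets G" by auto
qed simp

lemma (in finite_measure_subalgebra) gen_cond_exp_cong:
  assumes [measurable]: "f \<in> borel_measurable M" "g \<in> borel_measurable M" and eq: "AE \<omega> in M. f \<omega> = g \<omega>"
  shows "AE \<omega> in M. nn_cond_exp M F (\<lambda>\<omega>. e2ennreal (f \<omega>)) \<omega> = nn_cond_exp M F (\<lambda>\<omega>. e2ennreal (g \<omega>)) \<omega>"
    "AE \<omega> in M. gen_cond_exp M F f \<omega> = gen_cond_exp M F g \<omega>"
proof -
  show *: "AE \<omega> in M. nn_cond_exp M F (\<lambda>\<omega>. e2ennreal (f \<omega>)) \<omega> = nn_cond_exp M F (\<lambda>\<omega>. e2ennreal (g \<omega>)) \<omega>"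
    using eq by (intro nn_cond_exp_cong) (auto elim!: eventually_mono)
  have "AE \<omega> in M. nn_cond_exp M F (\<lambda>\<omega>. e2ennreal (- f \<omega>)) \<omega> = nn_cond_exp M F (\<lambda>\<omega>. e2ennreal (- g \<omega>)) \<omega>"
    using eq by (intro nn_cond_exp_cong) (auto elim!: eventually_mono)
  with * show "AE \<omega> in M. gen_cond_exp M F f \<omega> = gen_cond_exp M F g \<omega>"
    by eventually_elim (simp add: gen_cond_exp_def)
qed

text \<open>Lets an inequality known almost surely for each single argument hold for all arguments
  off one null set.\<close>

lemma continuous_le_on_Rats:
  fixes f g :: "real \<Rightarrow> real"
  assumes "continuous_on UNIV f" "continuous_on UNIV g" "\<And>r::rat. f (of_rat r) \<le> g (of_rat r)"
  shows "f x \<le> g x"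
proof -
  have "closed {x. f x \<le> g x}" using assms(1,2) by (rule closed_Collect_le)
  moreover have "\<rat> \<subseteq> {x. f x \<le> g x}" using assms(3) by (auto elim!: Rats_cases)
  ultimately have "closure \<rat> \<subseteq> {x. f x \<le> g x}" by (metis closure_minimal)
  then show ?thesis by (auto simp: Rats_closure_real)
qed

locale utility_market =
  fixes M :: "'a measure" and F :: "nat \<Rightarrow> 'a measure" and S :: "nat \<Rightarrow> 'a \<Rightarrow> real ^ 'd" and T :: nat
    and U :: "real \<Rightarrow> real" and W :: "nat \<Rightarrow> real \<Rightarrow> 'a \<Rightarrow> ereal" and p q C :: real
  assumes mk: "market M F S T" and no_arb: "no_arbitrage M F S T"
    and vf: "value_functions M F S T U W"
    and init: "\<And>x. has_gen_exp M (W 0 x)" "\<And>x. gen_exp M (W 0 x) < \<infinity>"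
    and U_concave: "concave_on UNIV U" and U_mono: "mono U" and U_bot: "filterlim U at_bot at_bot"
    and U_halving: "halving p q C U" and pq: "0 < q" "q < p" "0 \<le> C"

sublocale utility_market \<subseteq> prob_space M
  using mk by (simp add: market_def)

section \<open>Regular versions of the value functions, built backwards from the horizon\<close>

context utility_market
begin

lemma sub: "t \<le> T \<Longrightarrow> subalgebra M (F t)"
  using mk by (simp add: market_def)

lemma fms: "t \<le> T \<Longrightarrow> finite_measure_subalgebra M (F t)"
  by (simp add: finite_measure_subalgebra_def finite_measure_subalgebra_axioms_def sub finite_measure_axioms)

lemma F_mono: "s \<le> t \<Longrightarrow> t \<le> T \<Longrightarrow> f \<in> measurable (F s) N \<Longrightarrow> f \<in> measurable (F t) N"
  using mk unfolding market_def measurable_def subalgebra_def by (smt (verit) mem_Collect_eq order_trans subsetD)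

lemma F_M: "t \<le> T \<Longrightarrow> f \<in> measurable (F t) N \<Longrightarrow> f \<in> measurable M N"
  using measurable_from_subalg sub by blast

lemma nested: "s \<le> t \<Longrightarrow> t \<le> T \<Longrightarrow> subalgebra (F t) (F s)"
  using mk unfolding market_def subalgebra_def by (metis order_trans)

lemma null_F: "t \<le> T \<Longrightarrow> null_sets M \<subseteq> sets (F t)"
  using mk unfolding market_def by blast

lemma \<Delta>_meas: "t < T \<Longrightarrow> \<Delta> S (Suc t) \<in> borel_measurable (F (Suc t))"
proof -
  assume t: "t < T"
  have S: "S i \<in> borel_measurable (F i)" if "i \<le> T" for i
    using mk that unfolding market_def by blast
  have [measurable]: "S (Suc t) \<in> borel_measurable (F (Suc t))" by (rule S) (use t in simp)
  have [measurable]: "S t \<in> borel_measurable (F (Suc t))"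
    by (rule F_mono[of t]) (use t S in simp_all)
  show ?thesis unfolding \<Delta>_def[abs_def] by simp
qed

text \<open>A one-period arbitrage becomes a multi-period one by taking zero positions in all other
  periods.\<close>

lemma one_step_NA:
  assumes t: "t < T" and \<theta>: "\<theta> \<in> borel_measurable (F t)" and pos: "AE \<omega> in M. 0 \<le> \<theta> \<omega> \<bullet> \<Delta> S (Suc t) \<omega>"
  shows "AE \<omega> in M. \<theta> \<omega> \<bullet> \<Delta> S (Suc t) \<omega> = 0"
proof -
  define \<phi> where "\<phi> i = (if i = Suc t then \<theta> else (\<lambda>_. 0))" for i
  have "\<phi> \<in> strategies F T" using \<theta> by (auto simp: strategies_def \<phi>_def \<Xi>_def)
  moreover have "wealth S 0 \<phi> T \<omega> = \<theta> \<omega> \<bullet> \<Delta> S (Suc t) \<omega>" for \<omega>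
  proof -
    have "\<phi> i \<omega> \<bullet> \<Delta> S i \<omega> = (if i = Suc t then \<theta> \<omega> \<bullet> \<Delta> S (Suc t) \<omega> else 0)" for i
      by (simp add: \<phi>_def)
    then show ?thesis using t by (simp add: wealth_def)
  qed
  moreover have "(AE \<omega> in M. 0 \<le> wealth S 0 \<phi> T \<omega>) \<longrightarrow> (AE \<omega> in M. wealth S 0 \<phi> T \<omega> = 0)"
    using no_arb calculation(1) unfolding no_arbitrage_def by blast
  ultimately show ?thesis using pos by simp
qed

text \<open>The pathwise properties have no exceptional set; only the link to \<open>W t\<close> is
  almost sure. The lower bound by \<open>U\<close> reflects the possibility of not trading and keeps
  the preceding values above minus infinity.\<close>

definition good :: "nat \<Rightarrow> ('a \<Rightarrow> real \<Rightarrow> real) \<Rightarrow> bool" where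
  "good t V \<longleftrightarrow> (\<forall>x. (\<lambda>\<omega>. V \<omega> x) \<in> borel_measurable (F t)) \<and>
     (\<forall>\<omega>. mono (V \<omega>) \<and> concave_on UNIV (V \<omega>) \<and> filterlim (V \<omega>) at_bot at_bot \<and>
       halving p q C (V \<omega>) \<and> (\<forall>x. U x \<le> V \<omega> x)) \<and>
     (AE \<omega> in M. \<forall>x. W t x \<omega> = ereal (V \<omega> x))"

lemma good_T: "good T (\<lambda>_. U)"
  using vf U_concave U_mono U_bot U_halving by (simp add: good_def value_functions_def)

lemma value_functions_step: "t < T \<Longrightarrow> regular_version M (W (t + 1))"
  "t < T \<Longrightarrow> \<xi> \<in> borel_measurable (F t) \<Longrightarrow> has_gen_cond_exp M (F t) (\<lambda>\<omega>. W (t + 1) (x + \<xi> \<omega> \<bullet> \<Delta> S (t + 1) \<omega>) \<omega>)"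
  "t < T \<Longrightarrow> is_ess_sup M ((\<lambda>\<xi>. gen_cond_exp M (F t) (\<lambda>\<omega>. W (t + 1) (x + \<xi> \<omega> \<bullet> \<Delta> S (t + 1) \<omega>) \<omega>)) ` \<Xi> F t) (W t x)"
  "t < T \<Longrightarrow> AE \<omega> in M. W t x \<omega> < \<infinity>"
  using vf by (auto simp: value_functions_def \<Xi>_def)

lemma good_meas:
  assumes "t \<le> T" "good t V" "X \<in> borel_measurable (F t)"
  shows "(\<lambda>\<omega>. V \<omega> (X \<omega>)) \<in> borel_measurable (F t)"
proof (rule measurable_random_continuous[where V=V and X=X])
  show "(\<lambda>\<omega>. V \<omega> x) \<in> borel_measurable (F t)" for x using assms(2) by (simp add: good_def)
  show "continuous_on UNIV (V \<omega>)" for \<omega>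
    using assms(2) by (intro concave_UNIV_continuous) (simp add: good_def)
qed (rule assms)

text \<open>Finiteness of the essential supremum controls every competitor: as \<infinity> -
  \<infinity> = \<infinity> in \<open>ereal\<close>, a conditional expectation below \<infinity> has
  a finite positive part.\<close>

lemma continuation:
  assumes t: "t < T" and V: "good (Suc t) V" and \<xi>: "\<xi> \<in> borel_measurable (F t)"
  shows "AE \<omega> in M. nn_cond_exp M (F t) (\<lambda>\<omega>. ennreal (V \<omega> (x + \<xi> \<omega> \<bullet> \<Delta> S (Suc t) \<omega>))) \<omega> \<noteq> \<infinity>"
    and "AE \<omega> in M. gen_cond_exp M (F t) (\<lambda>\<omega>. ereal (V \<omega> (x + \<xi> \<omega> \<bullet> \<Delta> S (Suc t) \<omega>))) \<omega> =
      gen_cond_exp M (F t) (\<lambda>\<omega>. W (t + 1) (x + \<xi> \<omega> \<bullet> \<Delta> S (t + 1) \<omega>) \<omega>) \<omega>"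
    and "AE \<omega> in M. gen_cond_exp M (F t) (\<lambda>\<omega>. ereal (V \<omega> (x + \<xi> \<omega> \<bullet> \<Delta> S (Suc t) \<omega>))) \<omega> \<le> W t x \<omega>"
proof -
  interpret finite_measure_subalgebra M "F t" using fms t by simp
  let ?f = "\<lambda>\<omega>. W (t + 1) (x + \<xi> \<omega> \<bullet> \<Delta> S (t + 1) \<omega>) \<omega>"
  let ?g = "\<lambda>\<omega>. ereal (V \<omega> (x + \<xi> \<omega> \<bullet> \<Delta> S (Suc t) \<omega>))"
  have hg: "has_gen_cond_exp M (F t) ?f" by (rule value_functions_step(2)[OF t \<xi>])
  have fm: "?f \<in> borel_measurable M" using hg by (simp add: has_gen_cond_exp_def)
  have [measurable]: "\<xi> \<in> borel_measurable (F (Suc t))" "\<Delta> S (Suc t) \<in> borel_measurable (F (Suc t))"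
    using F_mono[OF _ _ \<xi>, of "Suc t"] \<Delta>_meas t by auto
  have "(\<lambda>\<omega>. V \<omega> (x + \<xi> \<omega> \<bullet> \<Delta> S (Suc t) \<omega>)) \<in> borel_measurable (F (Suc t))"
    by (rule good_meas[OF _ V]) (use t in \<open>simp, measurable\<close>)
  then have "(\<lambda>\<omega>. V \<omega> (x + \<xi> \<omega> \<bullet> \<Delta> S (Suc t) \<omega>)) \<in> borel_measurable M"
    using F_M[of "Suc t"] t by simp
  then have gm: "?g \<in> borel_measurable M" by simp
  have eq: "AE \<omega> in M. ?f \<omega> = ?g \<omega>"
    using V unfolding good_def by (auto elim!: eventually_mono)
  note cong = gen_cond_exp_cong[OF fm gm eq]
  show 2: "AE \<omega> in M. gen_cond_exp M (F t) ?g \<omega> = gen_cond_exp M (F t) ?f \<omega>"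
    using cong(2) by eventually_elim simp
  have up: "AE \<omega> in M. gen_cond_exp M (F t) ?f \<omega> \<le> W t x \<omega>"
    using value_functions_step(3)[OF t, of x] \<xi> by (auto simp: is_ess_sup_def \<Xi>_def)
  show 3: "AE \<omega> in M. gen_cond_exp M (F t) ?g \<omega> \<le> W t x \<omega>"
    using 2 up by eventually_elim simp
  have "AE \<omega> in M. \<not> (nn_cond_exp M (F t) (\<lambda>\<omega>. e2ennreal (?f \<omega>)) \<omega> = \<infinity> \<and>
      nn_cond_exp M (F t) (\<lambda>\<omega>. e2ennreal (- ?f \<omega>)) \<omega> = \<infinity>)"
    using hg by (simp add: has_gen_cond_exp_def)
  with up value_functions_step(4)[OF t, of x] cong(1)
  show "AE \<omega> in M. nn_cond_exp M (F t) (\<lambda>\<omega>. ennreal (V \<omega> (x + \<xi> \<omega> \<bullet> \<Delta> S (Suc t) \<omega>))) \<omega> \<noteq> \<infinity>"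
  proof eventually_elim
    case (elim \<omega>)
    have "gen_cond_exp M (F t) ?f \<omega> < \<infinity>" using elim(1,2) by (rule le_less_trans)
    then have "nn_cond_exp M (F t) (\<lambda>\<omega>. e2ennreal (?f \<omega>)) \<omega> \<noteq> \<infinity>"
      by (auto simp: gen_cond_exp_def)
    then show ?case using elim(3) by simp
  qed
qed

lemma one_step:
  assumes t: "t < T" and V: "good (Suc t) V"
  shows "one_step M (F t) (\<Delta> S (Suc t)) V p q C"
proof -
  interpret finite_measure_subalgebra M "F t" using fms t by simp
  show ?thesis
  proof
    show "\<Delta> S (Suc t) \<in> borel_measurable M" using F_M[OF _ \<Delta>_meas] t by simp
    show "(\<lambda>\<omega>. V \<omega> x) \<in> borel_measurable M" for x
      using V F_M[of "Suc t"] t by (auto simp: good_def)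
    show "AE \<omega> in M. nce (\<lambda>\<omega>. V \<omega> (x + \<xi> \<omega> \<bullet> \<Delta> S (Suc t) \<omega>)) \<omega> \<noteq> \<infinity>" if "\<xi> \<in> borel_measurable (F t)" for x \<xi>
      using continuation(1)[OF t V that] .
  qed (use V pq one_step_NA[OF t] in \<open>auto simp: good_def\<close>)
qed

text \<open>Almost surely the essential supremum is a countable supremum \<open>Z\<close> of
  \<open>F t\<close>-measurable functions. This gives measurability and, by a least index,
  near-optimal positions. The zero position is worth at least \<open>U x\<close>, so the value is
  real.\<close>

lemma value_const:
  assumes t: "t < T" and V: "good (Suc t) V"
  shows "AE \<omega> in M. W t x \<omega> = ereal (real_of_ereal (W t x \<omega>)) \<and> U x \<le> real_of_ereal (W t x \<omega>)"
    and "(\<lambda>\<omega>. real_of_ereal (W t x \<omega>)) \<in> borel_measurable (F t)"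
    and "e > 0 \<Longrightarrow> \<exists>\<xi>\<in>borel_measurable (F t). AE \<omega> in M. ereal (real_of_ereal (W t x \<omega>) - e)
      \<le> gen_cond_exp M (F t) (\<lambda>\<omega>. ereal (V \<omega> (x + \<xi> \<omega> \<bullet> \<Delta> S (Suc t) \<omega>))) \<omega>"
proof -
  interpret one_step M "F t" "\<Delta> S (Suc t)" V p q C by (rule one_step[OF t V])
  have le: "AE \<omega> in M. gce (pay (\<lambda>_. x) \<xi>) \<omega> \<le> W t x \<omega>" if "\<xi> \<in> borel_measurable (F t)" for \<xi>
    using continuation(3)[OF t V that, of x] by (simp add: pay_def)
  have gm[measurable]: "gce (pay (\<lambda>_. x) \<xi>) \<in> borel_measurable M" for \<xi>
    using measurable_F_M[OF measurable_gce] .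
  have Wm: "W t x \<in> borel_measurable M" using value_functions_step(3)[OF t] by (simp add: is_ess_sup_def)
  have ne: "borel_measurable (F t) \<noteq> ({} :: ('a \<Rightarrow> real ^ 'd) set)"
    using borel_measurable_const[of "0 :: real ^ 'd" "F t"] by blast
  obtain s :: "nat \<Rightarrow> 'a \<Rightarrow> real ^ 'd" where s: "range s \<subseteq> borel_measurable (F t)"
    "\<And>\<xi>. \<xi> \<in> borel_measurable (F t) \<Longrightarrow> AE \<omega> in M. gce (pay (\<lambda>_. x) \<xi>) \<omega> \<le> (SUP n. gce (pay (\<lambda>_. x) (s n)) \<omega>)"
    by (rule countable_ess_sup[of "borel_measurable (F t)" "\<lambda>\<xi>. gce (pay (\<lambda>_. x) \<xi>)"]) (use ne in auto)
  have sm[measurable]: "s n \<in> borel_measurable (F t)" for n using s(1) by blast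
  define Z where "Z \<omega> = (SUP n. gce (pay (\<lambda>_. x) (s n)) \<omega>)" for \<omega>
  have Zm[measurable]: "Z \<in> borel_measurable (F t)" unfolding Z_def by measurable
  have "AE \<omega> in M. W t x \<omega> \<le> Z \<omega>"
  proof -
    have "\<forall>f\<in>(\<lambda>\<xi>. gen_cond_exp M (F t) (\<lambda>\<omega>. W (t + 1) (x + \<xi> \<omega> \<bullet> \<Delta> S (t + 1) \<omega>) \<omega>)) ` \<Xi> F t. AE \<omega> in M. f \<omega> \<le> Z \<omega>"
    proof safe
      fix \<xi> :: "'a \<Rightarrow> real ^ 'd" assume "\<xi> \<in> \<Xi> F t"
      then have \<xi>: "\<xi> \<in> borel_measurable (F t)" by (simp add: \<Xi>_def)
      show "AE \<omega> in M. gen_cond_exp M (F t) (\<lambda>\<omega>. W (t + 1) (x + \<xi> \<omega> \<bullet> \<Delta> S (t + 1) \<omega>) \<omega>) \<omega> \<le> Z \<omega>"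
        using s(2)[OF \<xi>] continuation(2)[OF t V \<xi>, of x]
        by eventually_elim (simp add: pay_def Z_def)
    qed
    then show ?thesis using value_functions_step(3)[OF t, of x] measurable_F_M[OF Zm] by (simp add: is_ess_sup_def)
  qed
  moreover have "AE \<omega> in M. \<forall>n. gce (pay (\<lambda>_. x) (s n)) \<omega> \<le> W t x \<omega>"
    using le[OF sm] by (simp add: AE_all_countable)
  ultimately have WZ: "AE \<omega> in M. W t x \<omega> = Z \<omega>"
    by eventually_elim (auto simp: Z_def intro!: antisym SUP_least)
  have "(\<lambda>_. 0) \<in> borel_measurable (F t)" by simp
  note le0 = le[OF this]
  have "AE \<omega> in M. ereal (U x) \<le> gce (pay (\<lambda>_. x) (\<lambda>_. 0)) \<omega>"
  proof -
    have "AE \<omega> in M. gce (\<lambda>_. U x) \<omega> \<le> gce (pay (\<lambda>_. x) (\<lambda>_. 0)) \<omega>"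
      by (rule gce_mono) (use V in \<open>auto simp: pay_def good_def\<close>)
    with gce_const[of "U x"] show ?thesis by eventually_elim simp
  qed
  with le0 value_functions_step(4)[OF t, of x]
  show real: "AE \<omega> in M. W t x \<omega> = ereal (real_of_ereal (W t x \<omega>)) \<and> U x \<le> real_of_ereal (W t x \<omega>)"
  proof eventually_elim
    case (elim \<omega>)
    then have "ereal (U x) \<le> W t x \<omega>" by (metis order_trans)
    with elim(2) show ?case by (cases "W t x \<omega>") auto
  qed
  show "(\<lambda>\<omega>. real_of_ereal (W t x \<omega>)) \<in> borel_measurable (F t)"
  proof (rule measurable_sub_AE_eq)
    show "(\<lambda>\<omega>. real_of_ereal (Z \<omega>)) \<in> borel_measurable (F t)" by measurable
    show "AE \<omega> in M. real_of_ereal (Z \<omega>) = real_of_ereal (W t x \<omega>)" using WZ by eventually_elim simp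
  qed (use t sub null_F Wm in auto)
  assume e: "e > 0"
  \<comment> \<open>Where \<open>Z\<close> is infinite there may be no such index and
    \<open>LEAST\<close> is unspecified; this concerns a null set only.\<close>
  define N where "N \<omega> = (LEAST n. Z \<omega> - ereal e < gce (pay (\<lambda>_. x) (s n)) \<omega>)" for \<omega>
  have N[measurable]: "N \<in> measurable (F t) (count_space UNIV)" unfolding N_def by measurable
  define \<xi> where "\<xi> \<omega> = s (N \<omega>) \<omega>" for \<omega>
  have \<xi>: "\<xi> \<in> borel_measurable (F t)"
    unfolding \<xi>_def by (rule measurable_compose_countable[where f=s and g=N]) measurable
  have "AE \<omega> in M. gce (pay (\<lambda>_. x) \<xi>) \<omega> = gce (pay (\<lambda>_. x) (s (N \<omega>))) \<omega>"
    unfolding \<xi>_def by (rule gce_pay_paste) measurable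
  then have "AE \<omega> in M. ereal (real_of_ereal (W t x \<omega>) - e) \<le> gce (pay (\<lambda>_. x) \<xi>) \<omega>"
    using WZ real
  proof eventually_elim
    case (elim \<omega>)
    obtain w where w: "Z \<omega> = ereal w" using elim(2,3) by metis
    have "\<exists>n. Z \<omega> - ereal e < gce (pay (\<lambda>_. x) (s n)) \<omega>"
    proof -
      have "Z \<omega> - ereal e < Z \<omega>" using e by (simp add: w)
      then show ?thesis unfolding Z_def[of \<omega>] by (simp add: less_SUP_iff)
    qed
    then have "Z \<omega> - ereal e < gce (pay (\<lambda>_. x) (s (N \<omega>))) \<omega>" unfolding N_def by (rule LeastI_ex)
    then show ?case using elim(1,2) w by (simp add: less_imp_le)
  qed
  then show "\<exists>\<xi>\<in>borel_measurable (F t). AE \<omega> in M. ereal (real_of_ereal (W t x \<omega>) - e)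
      \<le> gen_cond_exp M (F t) (\<lambda>\<omega>. ereal (V \<omega> (x + \<xi> \<omega> \<bullet> \<Delta> S (Suc t) \<omega>))) \<omega>"
    using \<xi> unfolding pay_def by blast
qed

text \<open>Monotonicity and concavity come with the regular version, which is supplied for positive
  \<open>t\<close> only. Halving and the bound by \<open>U\<close> are known for each
  \<open>x\<close> and extend from the rationals by continuity. Divergence at minus infinity rests
  on absence of arbitrage.\<close>

lemma good_step:
  assumes t: "0 < t" "t < T" and V: "good (Suc t) V"
  obtains V' where "good t V'"
proof -
  interpret one_step M "F t" "\<Delta> S (Suc t)" V p q C by (rule one_step[OF t(2) V])
  define w where "w x \<omega> = real_of_ereal (W t x \<omega>)" for x \<omega>
  note vc = value_const(1)[OF t(2) V, folded w_def]
  have approx: "\<exists>\<xi>\<in>borel_measurable (F t). AE \<omega> in M. ereal (w x \<omega> - e) \<le> gce (pay (\<lambda>_. x) \<xi>) \<omega>" if "e > 0" for x e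
    using value_const(3)[OF t(2) V that, of x] unfolding w_def pay_def .
  have wm[measurable]: "w x \<in> borel_measurable (F t)" for x
    using value_const(2)[OF t(2) V, of x] by (simp add: w_def[abs_def])
  have up: "AE \<omega> in M. gce (pay (\<lambda>_. x) \<xi>) \<omega> \<le> ereal (w x \<omega>)" if "\<xi> \<in> borel_measurable (F t)" for x \<xi>
    using continuation(3)[OF t(2) V that, of x] vc[of x] by eventually_elim (simp add: pay_def)
  have reg: "AE \<omega> in M. (\<forall>x. W t x \<omega> = ereal (w x \<omega>)) \<and> mono (\<lambda>x. w x \<omega>) \<and> concave_on UNIV (\<lambda>x. w x \<omega>)"
  proof -
    have "regular_version M (W t)" using value_functions_step(1)[of "t - 1"] t by simp
    then have "AE \<omega> in M. (\<forall>x. \<bar>W t x \<omega>\<bar> \<noteq> \<infinity>) \<and> mono (\<lambda>x. W t x \<omega>) \<and> concave_on UNIV (\<lambda>x. real_of_ereal (W t x \<omega>))"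
      by (simp add: regular_version_def)
    then show ?thesis
    proof eventually_elim
      case (elim \<omega>)
      then have eq: "\<forall>x. W t x \<omega> = ereal (w x \<omega>)" by (simp add: w_def ereal_real)
      then have "mono (\<lambda>x. w x \<omega>)" using elim by (auto simp: mono_def)
      with eq elim show ?case by (simp add: w_def)
    qed
  qed
  \<comment> \<open>Half of a \<open>1 / (n + 1)\<close>-optimal position at \<open>x\<close>
    competes at \<open>x / 2\<close>; afterwards the tolerance tends to 0.\<close>
  have half: "AE \<omega> in M. p * max (w x \<omega>) 0 - q * max (- w x \<omega>) 0 - C \<le> w (x / 2) \<omega>" for x
  proof -
    have "AE \<omega> in M. p * max (w x \<omega> - 1 / (real n + 1)) 0 - q * max (- (w x \<omega> - 1 / (real n + 1))) 0 - C \<le> w (x / 2) \<omega>" for n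
    proof -
      obtain \<xi> where \<xi>[measurable]: "\<xi> \<in> borel_measurable (F t)"
        and 1: "AE \<omega> in M. ereal (w x \<omega> - 1 / (real n + 1)) \<le> gce (pay (\<lambda>_. x) \<xi>) \<omega>"
        using approx[of "1 / (real n + 1)" x] by auto
      have 2: "AE \<omega> in M. gce (pay (\<lambda>_. x / 2) (\<lambda>\<omega>. \<xi> \<omega> /\<^sub>R 2)) \<omega> \<le> ereal (w (x / 2) \<omega>)"
        by (rule up) measurable
      show ?thesis using half_bounds[OF borel_measurable_const \<xi>, of x] 1 2
        by eventually_elim blast
    qed
    then have "AE \<omega> in M. \<forall>n. p * max (w x \<omega> - 1 / (real n + 1)) 0 - q * max (- (w x \<omega> - 1 / (real n + 1))) 0 - C \<le> w (x / 2) \<omega>"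
      unfolding AE_all_countable by (rule allI)
    then show ?thesis
    proof eventually_elim
      case (elim \<omega>)
      have e0: "(\<lambda>n. 1 / (real n + 1)) \<longlonglongrightarrow> 0"
        using LIMSEQ_inverse_real_of_nat by (simp add: inverse_eq_divide add.commute)
      have "(\<lambda>n. p * max (w x \<omega> - 1 / (real n + 1)) 0 - q * max (- (w x \<omega> - 1 / (real n + 1))) 0 - C)
        \<longlonglongrightarrow> p * max (w x \<omega> - 0) 0 - q * max (- (w x \<omega> - 0)) 0 - C"
        by (intro tendsto_intros e0)
      then show ?case using elim by (intro LIMSEQ_le_const2[of _ "p * max (w x \<omega>) 0 - q * max (- w x \<omega>) 0 - C"]) auto
    qed
  qed
  have "AE \<omega> in M. \<forall>\<kappa>::nat. \<exists>n. w (- real n) \<omega> < - real \<kappa>"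
  proof (rule value_unbounded_below)
    show "\<exists>\<xi>\<in>borel_measurable (F t). AE \<omega> in M. ereal (w (- real n) \<omega> - 1) \<le> gce (pay (\<lambda>_. - real n) \<xi>) \<omega>" for n
      using approx[of 1 "- real n"] by simp
    \<comment> \<open>As \<open>- real n / 2 \<le> 0\<close>, the single bound \<open>w 0\<close>
      serves all \<open>n\<close>.\<close>
    show "AE \<omega> in M. gce (pay (\<lambda>_. - real n / 2) \<xi>) \<omega> \<le> ereal (w 0 \<omega>)" if "\<xi> \<in> borel_measurable (F t)" for n \<xi>
      using up[OF that, of "- real n / 2"] reg
    proof eventually_elim
      case (elim \<omega>)
      have "w (- real n / 2) \<omega> \<le> w 0 \<omega>" using elim(2) by (auto simp: mono_def)
      with elim(1) show ?case by (metis ereal_less_eq(3) order_trans)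
    qed
  qed measurable
  moreover have "AE \<omega> in M. \<forall>r::rat. p * max (w (of_rat r) \<omega>) 0 - q * max (- w (of_rat r) \<omega>) 0 - C \<le> w (of_rat r / 2) \<omega>"
    using half by (simp add: AE_all_countable)
  moreover have "AE \<omega> in M. \<forall>r::rat. U (of_rat r) \<le> w (of_rat r) \<omega>"
    using vc by (simp add: AE_all_countable)
  ultimately have "AE \<omega> in M. (\<forall>x. W t x \<omega> = ereal (w x \<omega>)) \<and> mono (\<lambda>x. w x \<omega>) \<and> concave_on UNIV (\<lambda>x. w x \<omega>) \<and>
      filterlim (\<lambda>x. w x \<omega>) at_bot at_bot \<and> halving p q C (\<lambda>x. w x \<omega>) \<and> (\<forall>x. U x \<le> w x \<omega>)"
    using reg
  proof eventually_elim
    case (elim \<omega>)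
    have cont: "continuous_on UNIV (\<lambda>x. w x \<omega>)" using elim(4) by (auto intro: concave_UNIV_continuous)
    have "continuous_on UNIV (\<lambda>x. w (x / 2) \<omega>)"
      by (rule continuous_on_compose2[OF cont]) (auto intro!: continuous_intros)
    then have "p * max (w x \<omega>) 0 - q * max (- w x \<omega>) 0 - C \<le> w (x / 2) \<omega>" for x
      by (rule continuous_le_on_Rats[rotated]) (use elim(2) cont in \<open>auto intro!: continuous_intros\<close>)
    moreover have "U x \<le> w x \<omega>" for x
      by (rule continuous_le_on_Rats[OF concave_UNIV_continuous[OF U_concave] cont]) (use elim(3) in auto)
    moreover have "filterlim (\<lambda>x. w x \<omega>) at_bot at_bot"
      unfolding filterlim_at_bot
    proof
      fix Z :: real
      obtain \<kappa> :: nat where "- Z \<le> real \<kappa>" using real_arch_simple by blast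
      moreover obtain n where "w (- real n) \<omega> < - real \<kappa>" using elim(1) by blast
      ultimately have "w x \<omega> \<le> Z" if "x \<le> - real n" for x
        using elim(4) that by (smt (verit) monoD)
      then show "eventually (\<lambda>x. w x \<omega> \<le> Z) at_bot" by (auto simp: eventually_at_bot_linorder)
    qed
    ultimately show ?case using elim(4) by (simp add: halving_def)
  qed
  then obtain N where N: "\<And>\<omega>. \<omega> \<in> space M - N \<Longrightarrow> (\<forall>x. W t x \<omega> = ereal (w x \<omega>)) \<and> mono (\<lambda>x. w x \<omega>) \<and> concave_on UNIV (\<lambda>x. w x \<omega>) \<and>
      filterlim (\<lambda>x. w x \<omega>) at_bot at_bot \<and> halving p q C (\<lambda>x. w x \<omega>) \<and> (\<forall>x. U x \<le> w x \<omega>)"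
    and N0: "N \<in> null_sets M"
    by (rule AE_E3) auto
  have [measurable]: "N \<in> sets (F t)" using N0 null_F[of t] t by auto
  have sp: "space (F t) = space M" using sub t by (simp add: subalgebra_def)
  \<comment> \<open>On the exceptional null set \<open>U\<close> itself is inserted, which has all
    the pathwise properties.\<close>
  define V' where "V' \<omega> x = (if \<omega> \<in> space (F t) - N then w x \<omega> else U x)" for \<omega> x
  have "good t V'"
    unfolding good_def
  proof (intro conjI allI)
    show "(\<lambda>\<omega>. V' \<omega> x) \<in> borel_measurable (F t)" for x unfolding V'_def by measurable
    have V'_eq: "V' \<omega> = (if \<omega> \<in> space (F t) - N then (\<lambda>x. w x \<omega>) else U)" for \<omega>
      by (auto simp: V'_def)
    show "mono (V' \<omega>)" "concave_on UNIV (V' \<omega>)" "filterlim (V' \<omega>) at_bot at_bot" "halving p q C (V' \<omega>)"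
      "U x \<le> V' \<omega> x" for \<omega> x
      using N[of \<omega>] U_mono U_concave U_bot U_halving unfolding V'_eq sp by auto
    show "AE \<omega> in M. \<forall>x. W t x \<omega> = ereal (V' \<omega> x)"
      using AE_not_in[OF N0] AE_space
      by eventually_elim (use N sp in \<open>auto simp: V'_def\<close>)
  qed
  then show ?thesis by (rule that)
qed

lemma good_exists: "0 < t \<Longrightarrow> t \<le> T \<Longrightarrow> \<exists>V. good t V"
proof (induction "T - t" arbitrary: t)
  case 0
  then have "t = T" by simp
  then show ?case using good_T by blast
next
  case (Suc n)
  then have "\<exists>V. good (Suc t) V" "t < T" by auto
  then show ?case using good_step Suc.prems by metis
qed

text \<open>The value field \<open>v t\<close> is regular for \<open>t > 0\<close>. At time \<open>0\<close>, where no regularity is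
  assumed, it may be evaluated at constants only; \<open>wealths t\<close> collects the admitted arguments.\<close>

definition v :: "nat \<Rightarrow> 'a \<Rightarrow> real \<Rightarrow> real" where
  "v t = (if t = T then (\<lambda>_. U) else if t = 0 then (\<lambda>\<omega> x. real_of_ereal (W 0 x \<omega>)) else (SOME V. good t V))"

definition wealths :: "nat \<Rightarrow> ('a \<Rightarrow> real) set" where
  "wealths t = (if t = 0 then range (\<lambda>c _. c) else borel_measurable (F t))"

lemma good_v: "0 < t \<Longrightarrow> t \<le> T \<Longrightarrow> good t (v t)"
  using someI_ex[OF good_exists[of t]] good_T by (auto simp: v_def)

lemma v_T: "v T = (\<lambda>_. U)"
  by (simp add: v_def)

lemma v_0:
  shows "AE \<omega> in M. W 0 x \<omega> = ereal (v 0 \<omega> x)" "AE \<omega> in M. U x \<le> v 0 \<omega> x"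
    "(\<lambda>\<omega>. v 0 \<omega> x) \<in> borel_measurable (F 0)"
proof -
  have "(AE \<omega> in M. W 0 x \<omega> = ereal (v 0 \<omega> x) \<and> U x \<le> v 0 \<omega> x) \<and> (\<lambda>\<omega>. v 0 \<omega> x) \<in> borel_measurable (F 0)"
  proof (cases "T = 0")
    case True
    have "v 0 = (\<lambda>_. U)" using arg_cong[OF True[symmetric], of v] v_T by (rule trans)
    moreover have "W 0 = W T" by (rule arg_cong[OF True[symmetric]])
    ultimately show ?thesis using vf by (simp add: value_functions_def)
  next
    case False
    then show ?thesis
      using value_const(1,2)[of 0 "v (Suc 0)" x] good_v[of "Suc 0"]
      by (simp add: v_def[of 0])
  qed
  then show "AE \<omega> in M. W 0 x \<omega> = ereal (v 0 \<omega> x)" "AE \<omega> in M. U x \<le> v 0 \<omega> x"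
    "(\<lambda>\<omega>. v 0 \<omega> x) \<in> borel_measurable (F 0)" by auto
qed

section \<open>Values at random wealth and optimal one-period positions\<close>

lemma wealths_meas: "X \<in> wealths t \<Longrightarrow> X \<in> borel_measurable (F t)"
  by (auto simp: wealths_def split: if_splits)

lemma v_meas:
  assumes "t \<le> T" "X \<in> wealths t" shows "(\<lambda>\<omega>. v t \<omega> (X \<omega>)) \<in> borel_measurable (F t)"
proof (cases "t = 0")
  case True
  then show ?thesis using assms v_0(3) by (auto simp: wealths_def)
next
  case False
  then show ?thesis using good_meas[OF assms(1) good_v wealths_meas[OF assms(2)]] assms(1) by simp
qed

lemma wealths_step:
  assumes "t < T" "X \<in> wealths t" "\<xi> \<in> borel_measurable (F t)"
  shows "(\<lambda>\<omega>. X \<omega> + \<xi> \<omega> \<bullet> \<Delta> S (Suc t) \<omega>) \<in> wealths (Suc t)"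
proof -
  have [measurable]: "X \<in> borel_measurable (F (Suc t))" "\<xi> \<in> borel_measurable (F (Suc t))"
    "\<Delta> S (Suc t) \<in> borel_measurable (F (Suc t))"
    using F_mono[of t "Suc t"] wealths_meas assms \<Delta>_meas by auto
  have "(\<lambda>\<omega>. X \<omega> + \<xi> \<omega> \<bullet> \<Delta> S (Suc t) \<omega>) \<in> borel_measurable (F (Suc t))" by measurable
  then show ?thesis by (simp add: wealths_def)
qed

lemma wealths_half: "X \<in> wealths t \<Longrightarrow> (\<lambda>\<omega>. X \<omega> / 2) \<in> wealths t"
  by (auto simp: wealths_def split: if_splits)

text \<open>Constants give grid-valued wealths by pasting. For the upper bound wealth is rounded up,
  which only raises the payoff, and the grid is refined. For near-optimality it is rounded down, on
  a grid fine enough at the given \<omega>. Continuity of \<open>v t\<close> is available for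
  positive \<open>t\<close>; at time 0 wealth is constant.\<close>

lemma value_random:
  assumes t: "t < T" and X: "X \<in> wealths t"
  shows "\<xi> \<in> borel_measurable (F t) \<Longrightarrow>
      AE \<omega> in M. gen_cond_exp M (F t) (\<lambda>\<omega>. ereal (v (Suc t) \<omega> (X \<omega> + \<xi> \<omega> \<bullet> \<Delta> S (Suc t) \<omega>))) \<omega> \<le> ereal (v t \<omega> (X \<omega>))"
    and "e > 0 \<Longrightarrow> \<exists>\<xi>\<in>borel_measurable (F t). AE \<omega> in M. ereal (v t \<omega> (X \<omega>) - e)
      \<le> gen_cond_exp M (F t) (\<lambda>\<omega>. ereal (v (Suc t) \<omega> (X \<omega> + \<xi> \<omega> \<bullet> \<Delta> S (Suc t) \<omega>))) \<omega>"
proof -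
  have V: "good (Suc t) (v (Suc t))" using t good_v by simp
  interpret one_step M "F t" "\<Delta> S (Suc t)" "v (Suc t)" p q C by (rule one_step[OF t V])
  have W: "AE \<omega> in M. W t x \<omega> = ereal (v t \<omega> x)" for x
  proof (cases "t = 0")
    case False
    then have "AE \<omega> in M. \<forall>x. W t x \<omega> = ereal (v t \<omega> x)" using good_v[of t] t by (simp add: good_def)
    then show ?thesis by eventually_elim simp
  qed (use v_0 in simp)
  have up: "AE \<omega> in M. gce (pay (\<lambda>_. x) \<xi>) \<omega> \<le> ereal (v t \<omega> x)" if "\<xi> \<in> borel_measurable (F t)" for x \<xi>
    using continuation(3)[OF t V that, of x] W[of x] by eventually_elim (simp add: pay_def)
  have approx: "\<exists>\<xi>\<in>borel_measurable (F t). AE \<omega> in M. ereal (v t \<omega> x - e) \<le> gce (pay (\<lambda>_. x) \<xi>) \<omega>" if e: "e > 0" for x e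
  proof -
    obtain \<xi> where \<xi>: "\<xi> \<in> borel_measurable (F t)" "AE \<omega> in M. ereal (real_of_ereal (W t x \<omega>) - e) \<le> gce (pay (\<lambda>_. x) \<xi>) \<omega>"
      using value_const(3)[OF t V e, of x] unfolding pay_def by blast
    have "AE \<omega> in M. ereal (v t \<omega> x - e) \<le> gce (pay (\<lambda>_. x) \<xi>) \<omega>"
      using \<xi>(2) W[of x] by eventually_elim simp
    with \<xi>(1) show ?thesis by blast
  qed
  \<comment> \<open>The offset \<open>d = 1\<close> serves rounding up and \<open>d = 0\<close>
    rounding down.\<close>
  have grid: "(\<lambda>k. (of_int \<lfloor>real (Suc k) * x\<rfloor> + d) / real (Suc k)) \<longlonglongrightarrow> x" if d: "0 \<le> d" "d \<le> 1" for x d :: real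
  proof (rule tendsto_sandwich)
    have inv: "(\<lambda>k. 1 / real (Suc k)) \<longlonglongrightarrow> 0"
      using LIMSEQ_inverse_real_of_nat by (simp add: inverse_eq_divide)
    show "(\<lambda>k. x - 1 / real (Suc k)) \<longlonglongrightarrow> x" "(\<lambda>k. x + 1 / real (Suc k)) \<longlonglongrightarrow> x"
      using tendsto_diff[OF tendsto_const[of x] inv] tendsto_add[OF tendsto_const[of x] inv] by simp_all
    show "eventually (\<lambda>k. x - 1 / real (Suc k) \<le> (of_int \<lfloor>real (Suc k) * x\<rfloor> + d) / real (Suc k)) sequentially"
    proof (intro always_eventually allI)
      fix k
      have "(real (Suc k) * x - 1) / real (Suc k) \<le> (of_int \<lfloor>real (Suc k) * x\<rfloor> + d) / real (Suc k)"
        using d by (intro divide_right_mono) linarith+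
      then show "x - 1 / real (Suc k) \<le> (of_int \<lfloor>real (Suc k) * x\<rfloor> + d) / real (Suc k)"
        by (simp add: diff_divide_distrib)
    qed
    show "eventually (\<lambda>k. (of_int \<lfloor>real (Suc k) * x\<rfloor> + d) / real (Suc k) \<le> x + 1 / real (Suc k)) sequentially"
    proof (intro always_eventually allI)
      fix k
      have "(of_int \<lfloor>real (Suc k) * x\<rfloor> + d) / real (Suc k) \<le> (real (Suc k) * x + 1) / real (Suc k)"
        using d by (intro divide_right_mono) linarith+
      then show "(of_int \<lfloor>real (Suc k) * x\<rfloor> + d) / real (Suc k) \<le> x + 1 / real (Suc k)"
        by (simp add: add_divide_distrib)
    qed
  qed
  have [measurable]: "X \<in> borel_measurable (F t)" by (rule wealths_meas[OF X])
  show "AE \<omega> in M. gen_cond_exp M (F t) (\<lambda>\<omega>. ereal (v (Suc t) \<omega> (X \<omega> + \<xi> \<omega> \<bullet> \<Delta> S (Suc t) \<omega>))) \<omega> \<le> ereal (v t \<omega> (X \<omega>))"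
    if \<xi>[measurable]: "\<xi> \<in> borel_measurable (F t)"
  proof (cases "t = 0")
    case True
    then obtain c where "X = (\<lambda>_. c)" using X by (auto simp: wealths_def)
    then show ?thesis using up[OF that, of c] by (simp add: pay_def)
  next
    case False
    then have G: "good t (v t)" using good_v t by simp
    define x where "x k i = (of_int i + 1) / real (Suc k)" for k and i :: int
    define N where "N k \<omega> = \<lfloor>real (Suc k) * X \<omega>\<rfloor>" for k \<omega>
    have N[measurable]: "N k \<in> measurable (F t) (count_space UNIV)" for k unfolding N_def by measurable
    have [measurable]: "(\<lambda>\<omega>. x k (N k \<omega>)) \<in> borel_measurable (F t)" for k by measurable
    have Xx: "X \<omega> \<le> x k (N k \<omega>)" for k \<omega>
    proof -
      have "real (Suc k) * X \<omega> \<le> of_int \<lfloor>real (Suc k) * X \<omega>\<rfloor> + 1" by linarith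
      then have "X \<omega> * real (Suc k) \<le> of_int (N k \<omega>) + 1" by (simp only: N_def mult.commute)
      then show ?thesis unfolding x_def by (subst pos_le_divide_eq) auto
    qed
    have "AE \<omega> in M. gce (pay X \<xi>) \<omega> \<le> ereal (v t \<omega> (x k (N k \<omega>)))" for k
    proof -
      have "AE \<omega> in M. gce (pay X \<xi>) \<omega> \<le> gce (pay (\<lambda>\<omega>. x k (N k \<omega>)) \<xi>) \<omega>"
      proof (rule gce_mono)
        show "AE \<omega> in M. pay X \<xi> \<omega> \<le> pay (\<lambda>\<omega>. x k (N k \<omega>)) \<xi> \<omega>"
          unfolding pay_def by (intro AE_I2 monoD[OF V_mono]) (simp add: Xx)
      qed measurable
      moreover have "AE \<omega> in M. gce (\<lambda>\<omega>. (\<lambda>i. pay (\<lambda>_. x k i) \<xi>) (N k \<omega>) \<omega>) \<omega> = gce ((\<lambda>i. pay (\<lambda>_. x k i) \<xi>) (N k \<omega>)) \<omega>"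
        by (rule gce_paste) measurable
      moreover have "AE \<omega> in M. \<forall>i. gce (pay (\<lambda>_. x k i) \<xi>) \<omega> \<le> ereal (v t \<omega> (x k i))"
        using up[OF that] by (simp add: AE_all_countable)
      ultimately show ?thesis
      proof eventually_elim
        case (elim \<omega>)
        note elim(1)
        also have "gce (pay (\<lambda>\<omega>. x k (N k \<omega>)) \<xi>) \<omega> = gce (pay (\<lambda>_. x k (N k \<omega>)) \<xi>) \<omega>"
          using elim(2) by (simp add: pay_def)
        also have "\<dots> \<le> ereal (v t \<omega> (x k (N k \<omega>)))" using elim(3) by blast
        finally show ?case .
      qed
    qed
    then have "AE \<omega> in M. \<forall>k. gce (pay X \<xi>) \<omega> \<le> ereal (v t \<omega> (x k (N k \<omega>)))"
      by (simp add: AE_all_countable)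
    then have "AE \<omega> in M. gce (pay X \<xi>) \<omega> \<le> ereal (v t \<omega> (X \<omega>))"
    proof eventually_elim
      case (elim \<omega>)
      have "continuous_on UNIV (v t \<omega>)" using G by (auto simp: good_def intro: concave_UNIV_continuous)
      then have "(\<lambda>k. v t \<omega> (x k (N k \<omega>))) \<longlonglongrightarrow> v t \<omega> (X \<omega>)"
        by (rule continuous_on_tendsto_compose) (use grid[of 1 "X \<omega>"] in \<open>auto simp: x_def N_def\<close>)
      then have lim: "(\<lambda>k. ereal (v t \<omega> (x k (N k \<omega>)))) \<longlonglongrightarrow> ereal (v t \<omega> (X \<omega>))" by simp
      show ?case by (rule LIMSEQ_le_const[OF lim]) (use elim in blast)
    qed
    then show ?thesis by (simp add: pay_def)
  qed
  assume e: "e > 0"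
  show "\<exists>\<xi>\<in>borel_measurable (F t). AE \<omega> in M. ereal (v t \<omega> (X \<omega>) - e)
      \<le> gen_cond_exp M (F t) (\<lambda>\<omega>. ereal (v (Suc t) \<omega> (X \<omega> + \<xi> \<omega> \<bullet> \<Delta> S (Suc t) \<omega>))) \<omega>"
  proof (cases "t = 0")
    case True
    then obtain c where "X = (\<lambda>_. c)" using X by (auto simp: wealths_def)
    then show ?thesis using approx[OF e, of c] by (simp add: pay_def)
  next
    case False
    then have G: "good t (v t)" using good_v t by simp
    define x where "x k i = of_int i / real (Suc k)" for k and i :: int
    define y where "y = (\<lambda>(k, i). x k i)"
    have "\<forall>j. \<exists>\<xi>. \<xi> \<in> borel_measurable (F t) \<and> (AE \<omega> in M. ereal (v t \<omega> (y j) - e / 2) \<le> gce (pay (\<lambda>_. y j) \<xi>) \<omega>)"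
      using approx[of "e / 2"] e by (simp add: Bex_def)
    from choice[OF this] obtain \<eta> where \<eta>: "\<forall>j. \<eta> j \<in> borel_measurable (F t) \<and>
      (AE \<omega> in M. ereal (v t \<omega> (y j) - e / 2) \<le> gce (pay (\<lambda>_. y j) (\<eta> j)) \<omega>)" ..
    note [measurable] = \<eta>[rule_format, THEN conjunct1]
    define N where "N k \<omega> = \<lfloor>real (Suc k) * X \<omega>\<rfloor>" for k \<omega>
    have N[measurable]: "N k \<in> measurable (F t) (count_space UNIV)" for k unfolding N_def by measurable
    have xN[measurable]: "(\<lambda>\<omega>. x k (N k \<omega>)) \<in> borel_measurable (F t)" for k by measurable
    have Xx: "x k (N k \<omega>) \<le> X \<omega>" for k \<omega>
    proof -
      have "of_int \<lfloor>real (Suc k) * X \<omega>\<rfloor> \<le> real (Suc k) * X \<omega>" by linarith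
      then have "of_int (N k \<omega>) \<le> X \<omega> * real (Suc k)" by (simp only: N_def mult.commute)
      then show ?thesis unfolding x_def by (subst pos_divide_le_eq) auto
    qed
    have vX[measurable]: "(\<lambda>\<omega>. v t \<omega> (X \<omega>)) \<in> borel_measurable (F t)"
      by (rule v_meas[OF _ X]) (use t in simp)
    have vx[measurable]: "(\<lambda>\<omega>. v t \<omega> (x k (N k \<omega>))) \<in> borel_measurable (F t)" for k
      by (rule good_meas[OF _ G xN]) (use t in simp)
    \<comment> \<open>The first grid on which rounding down costs less than half of the tolerance;
      the other half is spent on the positions \<open>\<eta> j\<close>.\<close>
    define K where "K \<omega> = (LEAST k. v t \<omega> (X \<omega>) - e / 2 < v t \<omega> (x k (N k \<omega>)))" for \<omega>
    have K[measurable]: "K \<in> measurable (F t) (count_space UNIV)" unfolding K_def by measurable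
    have Kw: "v t \<omega> (X \<omega>) - e / 2 < v t \<omega> (x (K \<omega>) (N (K \<omega>) \<omega>))" for \<omega>
      unfolding K_def
    proof (rule LeastI_ex)
      have "continuous_on UNIV (v t \<omega>)" using G by (auto simp: good_def intro: concave_UNIV_continuous)
      then have lim: "(\<lambda>k. v t \<omega> (x k (N k \<omega>))) \<longlonglongrightarrow> v t \<omega> (X \<omega>)"
        by (rule continuous_on_tendsto_compose) (use grid[of 0 "X \<omega>"] in \<open>auto simp: x_def N_def\<close>)
      have "eventually (\<lambda>k. v t \<omega> (X \<omega>) - e / 2 < v t \<omega> (x k (N k \<omega>))) sequentially"
        using e by (intro order_tendstoD(1)[OF lim]) simp
      then show "\<exists>k. v t \<omega> (X \<omega>) - e / 2 < v t \<omega> (x k (N k \<omega>))"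
        by (auto simp: eventually_sequentially)
    qed
    define I where "I \<omega> = (K \<omega>, N (K \<omega>) \<omega>)" for \<omega>
    have NK[measurable]: "(\<lambda>\<omega>. N (K \<omega>) \<omega>) \<in> measurable (F t) (count_space UNIV)"
      by (rule measurable_compose_countable[where f=N and g=K]) measurable
    have I[measurable]: "I \<in> measurable (F t) (count_space UNIV)"
    proof -
      have "I \<in> measurable (F t) (count_space UNIV \<Otimes>\<^sub>M count_space UNIV)" unfolding I_def by measurable
      then show ?thesis by (simp add: pair_measure_countable)
    qed
    define \<xi> where "\<xi> \<omega> = \<eta> (I \<omega>) \<omega>" for \<omega>
    have \<xi>[measurable]: "\<xi> \<in> borel_measurable (F t)"
      unfolding \<xi>_def by (rule measurable_compose_countable[where f=\<eta> and g=I]) measurable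
    have ym[measurable]: "(\<lambda>\<omega>. y (I \<omega>)) \<in> borel_measurable (F t)" by measurable
    have "AE \<omega> in M. gce (pay (\<lambda>\<omega>. y (I \<omega>)) \<xi>) \<omega> \<le> gce (pay X \<xi>) \<omega>"
    proof (rule gce_mono)
      show "AE \<omega> in M. pay (\<lambda>\<omega>. y (I \<omega>)) \<xi> \<omega> \<le> pay X \<xi> \<omega>"
        unfolding pay_def by (intro AE_I2 monoD[OF V_mono]) (simp add: Xx y_def I_def)
    qed measurable
    moreover have "AE \<omega> in M. gce (\<lambda>\<omega>. (\<lambda>j. pay (\<lambda>_. y j) (\<eta> j)) (I \<omega>) \<omega>) \<omega> = gce ((\<lambda>j. pay (\<lambda>_. y j) (\<eta> j)) (I \<omega>)) \<omega>"
      by (rule gce_paste) measurable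
    moreover have "AE \<omega> in M. \<forall>j. ereal (v t \<omega> (y j) - e / 2) \<le> gce (pay (\<lambda>_. y j) (\<eta> j)) \<omega>"
      unfolding AE_all_countable using \<eta> by blast
    ultimately have "AE \<omega> in M. ereal (v t \<omega> (X \<omega>) - e) \<le> gce (pay X \<xi>) \<omega>"
    proof eventually_elim
      case (elim \<omega>)
      have "ereal (v t \<omega> (X \<omega>) - e) \<le> ereal (v t \<omega> (y (I \<omega>)) - e / 2)"
        using Kw[of \<omega>] by (simp add: y_def I_def)
      also have "\<dots> \<le> gce (pay (\<lambda>_. y (I \<omega>)) (\<eta> (I \<omega>))) \<omega>"
        using elim(3) by blast
      also have "\<dots> = gce (pay (\<lambda>\<omega>. y (I \<omega>)) \<xi>) \<omega>" using elim(2) by (simp add: pay_def \<xi>_def)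
      also have "\<dots> \<le> gce (pay X \<xi>) \<omega>" by (rule elim(1))
      finally show ?case .
    qed
    with \<xi> show ?thesis unfolding pay_def by blast
  qed
qed

text \<open>The upper bound demanded at half the wealth is the value there, which dominates every
  one-period competitor.\<close>

lemma optimal_step:
  assumes t: "t < T" and X: "X \<in> wealths t"
  shows "\<exists>\<xi>\<in>borel_measurable (F t). AE \<omega> in M. ereal (v t \<omega> (X \<omega>))
      \<le> gen_cond_exp M (F t) (\<lambda>\<omega>. ereal (v (Suc t) \<omega> (X \<omega> + \<xi> \<omega> \<bullet> \<Delta> S (Suc t) \<omega>))) \<omega>"
proof -
  interpret one_step M "F t" "\<Delta> S (Suc t)" "v (Suc t)" p q C
    by (rule one_step[OF t]) (use t good_v in simp)
  obtain \<xi> where "\<xi> \<in> borel_measurable (F t)" "AE \<omega> in M. ereal (v t \<omega> (X \<omega>)) \<le> gce (pay X \<xi>) \<omega>"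
  proof (rule optimal_exists[where b="\<lambda>\<omega>. v t \<omega> (X \<omega> / 2)"])
    show "X \<in> borel_measurable (F t)" by (rule wealths_meas[OF X])
    show "\<exists>\<xi>\<in>borel_measurable (F t). AE \<omega> in M. ereal (v t \<omega> (X \<omega>) - e) \<le> gce (pay X \<xi>) \<omega>" if "e > 0" for e
      using value_random(2)[OF t X that] unfolding pay_def .
    show "AE \<omega> in M. gce (pay (\<lambda>\<omega>. X \<omega> / 2) \<xi>) \<omega> \<le> ereal (v t \<omega> (X \<omega> / 2))" if "\<xi> \<in> borel_measurable (F t)" for \<xi>
      using value_random(1)[OF t wealths_half[OF X] that] unfolding pay_def .
  qed
  then show ?thesis unfolding pay_def by blast
qed

lemma value_finite:
  assumes t: "t < T" and X: "X \<in> wealths t" and \<xi>: "\<xi> \<in> borel_measurable (F t)"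
  shows "AE \<omega> in M. nn_cond_exp M (F t) (\<lambda>\<omega>. ennreal (v (Suc t) \<omega> (X \<omega> + \<xi> \<omega> \<bullet> \<Delta> S (Suc t) \<omega>))) \<omega> \<noteq> \<infinity>"
proof -
  interpret one_step M "F t" "\<Delta> S (Suc t)" "v (Suc t)" p q C
    by (rule one_step[OF t]) (use t good_v in simp)
  show ?thesis using fin[OF wealths_meas[OF X] \<xi>] unfolding pay_def .
qed

end

section \<open>Verification\<close>

text \<open>Inequalities between values are carried as sums; only at the end, where the two
  right-hand terms are finite, are they turned into differences.\<close>

lemma ennreal_diff_le_diff:
  assumes "a + b \<le> c + d" "c \<noteq> \<infinity>" "d \<noteq> \<infinity>"
  shows "enn2ereal a - enn2ereal d \<le> enn2ereal c - enn2ereal b"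
proof -
  obtain c' d' where cd: "c = ennreal c'" "0 \<le> c'" "d = ennreal d'" "0 \<le> d'"
    using assms(2,3) by (metis ennreal_finiteE)
  have "a + b \<noteq> \<infinity>" using assms(1) cd by (auto simp: top_unique)
  then have "a \<noteq> \<infinity>" "b \<noteq> \<infinity>" by auto
  then obtain a' b' where ab: "a = ennreal a'" "0 \<le> a'" "b = ennreal b'" "0 \<le> b'"
    by (metis ennreal_finiteE)
  have "a' + b' \<le> c' + d'" using assms(1) ab cd by (simp flip: ennreal_plus)
  then show ?thesis using ab cd by simp
qed

lemma (in finite_measure_subalgebra) nn_integral_nn_cond_exp:
  assumes "f \<in> borel_measurable M"
  shows "(\<integral>\<^sup>+\<omega>. nn_cond_exp M F f \<omega> \<partial>M) = (\<integral>\<^sup>+\<omega>. f \<omega> \<partial>M)"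
  using nn_cond_exp_intg[of "\<lambda>_. 1" f] assms by simp

section \<open>The initial value as an upper bound, and its attainment\<close>

context utility_market
begin

lemma wealth_Suc: "wealth S c \<phi> (Suc t) \<omega> = wealth S c \<phi> t \<omega> + \<phi> (Suc t) \<omega> \<bullet> \<Delta> S (Suc t) \<omega>"
  by (simp add: wealth_def)

lemma strategies_meas: "\<phi> \<in> strategies F T \<Longrightarrow> t < T \<Longrightarrow> \<phi> (Suc t) \<in> borel_measurable (F t)"
  by (force simp: strategies_def \<Xi>_def)

lemma wealth_in_wealths:
  assumes "\<phi> \<in> strategies F T"
  shows "t \<le> T \<Longrightarrow> wealth S c \<phi> t \<in> wealths t"
proof (induction t)
  case 0
  have "wealth S c \<phi> 0 = (\<lambda>_. c)" by (auto simp: wealth_def)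
  then show ?case by (simp add: wealths_def)
next
  case (Suc t)
  then show ?case
    using wealths_step[of t "wealth S c \<phi> t" "\<phi> (Suc t)"] strategies_meas[OF assms] by (simp add: wealth_Suc[abs_def])
qed

lemma tower:
  assumes t: "t < T" and "f \<in> borel_measurable M"
  shows "AE \<omega> in M. nn_cond_exp M (F t) (nn_cond_exp M (F (Suc t)) f) \<omega> = nn_cond_exp M (F t) f \<omega>"
proof -
  interpret finite_measure_subalgebra M "F t" using fms t by simp
  have "AE \<omega> in M. nn_cond_exp M (F t) f \<omega> = nn_cond_exp M (F t) (nn_cond_exp M (F (Suc t)) f) \<omega>"
    using t by (intro nn_cond_exp_nested_subalg sub nested assms(2)) auto
  then show ?thesis by eventually_elim simp
qed

lemma gen_exp_W0:
  "gen_exp M (W 0 x) = enn2ereal (\<integral>\<^sup>+\<omega>. ennreal (v 0 \<omega> x) \<partial>M) - enn2ereal (\<integral>\<^sup>+\<omega>. ennreal (- v 0 \<omega> x) \<partial>M)"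
  "(\<integral>\<^sup>+\<omega>. ennreal (v 0 \<omega> x) \<partial>M) \<noteq> \<infinity>"
proof -
  have 1: "(\<integral>\<^sup>+\<omega>. e2ennreal (W 0 x \<omega>) \<partial>M) = (\<integral>\<^sup>+\<omega>. ennreal (v 0 \<omega> x) \<partial>M)"
    "(\<integral>\<^sup>+\<omega>. e2ennreal (- W 0 x \<omega>) \<partial>M) = (\<integral>\<^sup>+\<omega>. ennreal (- v 0 \<omega> x) \<partial>M)"
    using v_0(1)[of x] by (auto intro!: nn_integral_cong_AE elim!: eventually_mono)
  show 2: "gen_exp M (W 0 x) = enn2ereal (\<integral>\<^sup>+\<omega>. ennreal (v 0 \<omega> x) \<partial>M) - enn2ereal (\<integral>\<^sup>+\<omega>. ennreal (- v 0 \<omega> x) \<partial>M)"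
    unfolding gen_exp_def 1 ..
  show "(\<integral>\<^sup>+\<omega>. ennreal (v 0 \<omega> x) \<partial>M) \<noteq> \<infinity>"
    using init(1)[of x] init(2)[of x] unfolding 2 has_gen_exp_def 1 by auto
qed

lemma v_0_meas[measurable]: "(\<lambda>\<omega>. v 0 \<omega> x) \<in> borel_measurable M"
  using F_M[OF _ v_0(3)] by simp

text \<open>Along any strategy the values form a generalized supermartingale, so the terminal
  utility conditioned to time \<open>t\<close> is at most \<open>X t\<close>; this follows by
  backward induction and the tower property. The inequality is stated between sums because the
  conditional positive part \<open>?Q t\<close> turns out finite only during the induction.\<close>

lemma exp_utility_le:
  assumes \<phi>: "\<phi> \<in> admissible M F S T U c"
  shows "exp_utility M S T U c \<phi> \<le> gen_exp M (W 0 c)"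
proof -
  have \<phi>s: "\<phi> \<in> strategies F T" using \<phi> by (simp add: admissible_def)
  define X where "X t \<omega> = v t \<omega> (wealth S c \<phi> t \<omega>)" for t \<omega>
  define f where "f \<omega> = U (wealth S c \<phi> T \<omega>)" for \<omega>
  have XF: "X t \<in> borel_measurable (F t)" if "t \<le> T" for t
    unfolding X_def by (rule v_meas[OF that wealth_in_wealths[OF \<phi>s that]])
  have XM[measurable]: "X t \<in> borel_measurable M" if "t \<le> T" for t by (rule F_M[OF that XF[OF that]])
  have XT: "X T = f" by (simp add: X_def[abs_def] f_def[abs_def] v_T)
  have fM[measurable]: "f \<in> borel_measurable M" using XM[of T] by (simp add: XT)
  have hg: "\<not> ((\<integral>\<^sup>+\<omega>. ennreal (f \<omega>) \<partial>M) = \<infinity> \<and> (\<integral>\<^sup>+\<omega>. ennreal (- f \<omega>) \<partial>M) = \<infinity>)"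
    using \<phi> by (simp add: admissible_def has_gen_exp_def f_def)
  have eu: "exp_utility M S T U c \<phi> = enn2ereal (\<integral>\<^sup>+\<omega>. ennreal (f \<omega>) \<partial>M) - enn2ereal (\<integral>\<^sup>+\<omega>. ennreal (- f \<omega>) \<partial>M)"
    by (simp add: exp_utility_def gen_exp_def f_def)
  show ?thesis
  proof (cases "(\<integral>\<^sup>+\<omega>. ennreal (- f \<omega>) \<partial>M) = \<infinity>")
    \<comment> \<open>An infinite expected negative part makes the expected utility minus infinity;
      otherwise the conditional negative parts are finite at every date.\<close>
    case True
    then have "(\<integral>\<^sup>+\<omega>. ennreal (f \<omega>) \<partial>M) \<noteq> \<infinity>" using hg by simp
    then have "exp_utility M S T U c \<phi> = - \<infinity>"
      unfolding eu True by (cases "\<integral>\<^sup>+\<omega>. ennreal (f \<omega>) \<partial>M") auto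
    then show ?thesis by simp
  next
    case False
    let ?Q = "\<lambda>t. nn_cond_exp M (F t) (\<lambda>\<omega>. ennreal (f \<omega>))" and ?R = "\<lambda>t. nn_cond_exp M (F t) (\<lambda>\<omega>. ennreal (- f \<omega>))"
    have R_fin: "AE \<omega> in M. ?R t \<omega> \<noteq> \<infinity>" if "t \<le> T" for t
    proof -
      interpret finite_measure_subalgebra M "F t" using fms that by simp
      show ?thesis using False by (intro nn_integral_noteq_infinite) (simp_all add: nn_integral_nn_cond_exp)
    qed
    have main: "AE \<omega> in M. ?Q t \<omega> + ennreal (- X t \<omega>) \<le> ennreal (X t \<omega>) + ?R t \<omega>" if "t \<le> T" for t
      using that
    proof (induction rule: inc_induct)
      case base
      interpret finite_measure_subalgebra M "F T" using fms by simp
      have "f \<in> borel_measurable (F T)" using XF[of T] by (simp add: XT)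
      then have "(\<lambda>\<omega>. ennreal (f \<omega>)) \<in> borel_measurable (F T)" "(\<lambda>\<omega>. ennreal (- f \<omega>)) \<in> borel_measurable (F T)"
        by measurable
      from nn_cond_exp_F_meas[OF this(1)] nn_cond_exp_F_meas[OF this(2)] show ?case
        by eventually_elim (simp add: XT)
    next
      case (step t)
      then have t: "t < T" and [simp]: "t \<le> T" "Suc t \<le> T" by auto
      interpret finite_measure_subalgebra M "F t" using fms t by simp
      have [measurable]: "X (Suc t) \<in> borel_measurable M" by (rule XM) simp
      have 1: "AE \<omega> in M. ennreal 1 * nn_cond_exp M (F t) (?Q (Suc t)) \<omega> + ennreal 1 * nce (\<lambda>\<omega>. - X (Suc t) \<omega>) \<omega> + ennreal 0 * nn_cond_exp M (F t) (\<lambda>_. 0) \<omega>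
        \<le> ennreal 1 * nce (X (Suc t)) \<omega> + ennreal 1 * nn_cond_exp M (F t) (?R (Suc t)) \<omega> + ennreal 0 * nn_cond_exp M (F t) (\<lambda>_. 0) \<omega>"
        by (rule nn_cond_exp_le3) (use step.IH in simp_all)
      have 2: "AE \<omega> in M. gce (X (Suc t)) \<omega> \<le> ereal (X t \<omega>)"
        using value_random(1)[OF t wealth_in_wealths[OF \<phi>s] strategies_meas[OF \<phi>s t]] by (simp add: X_def wealth_Suc)
      have 3: "AE \<omega> in M. nce (X (Suc t)) \<omega> \<noteq> \<infinity>"
        using value_finite[OF t wealth_in_wealths[OF \<phi>s] strategies_meas[OF \<phi>s t]] by (simp add: X_def wealth_Suc)
      have 4: "AE \<omega> in M. nn_cond_exp M (F t) (?Q (Suc t)) \<omega> = ?Q t \<omega>"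
        "AE \<omega> in M. nn_cond_exp M (F t) (?R (Suc t)) \<omega> = ?R t \<omega>"
        by (rule tower[OF t], measurable)+
      have 5: "AE \<omega> in M. ?R t \<omega> \<noteq> \<infinity>" by (rule R_fin) simp
      from 1 2 3 4 5 show ?case
      proof eventually_elim
        case (elim \<omega>)
        obtain P where P: "nce (X (Suc t)) \<omega> = ennreal P" "0 \<le> P" using elim(3) by (rule ennreal_finiteE)
        obtain R where R: "?R t \<omega> = ennreal R" "0 \<le> R" using elim(6) by (rule ennreal_finiteE)
        have le: "?Q t \<omega> + nce (\<lambda>\<omega>. - X (Suc t) \<omega>) \<omega> \<le> ennreal (P + R)"
          using elim(1,4,5) P R by simp
        then have "?Q t \<omega> + nce (\<lambda>\<omega>. - X (Suc t) \<omega>) \<omega> \<noteq> \<infinity>" by (auto simp: top_unique)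
        then have fin: "?Q t \<omega> \<noteq> \<infinity>" "nce (\<lambda>\<omega>. - X (Suc t) \<omega>) \<omega> \<noteq> \<infinity>" by auto
        obtain Q where Q: "?Q t \<omega> = ennreal Q" "0 \<le> Q" using fin(1) by (rule ennreal_finiteE)
        obtain m where m: "nce (\<lambda>\<omega>. - X (Suc t) \<omega>) \<omega> = ennreal m" "0 \<le> m" using fin(2) by (rule ennreal_finiteE)
        have "Q + m \<le> P + R" using le P R Q m by (simp flip: ennreal_plus)
        moreover have "P \<le> X t \<omega> + m" using elim(2) P m unfolding gce_le_ereal_iff[OF elim(3)] by simp
        ultimately have "Q \<le> X t \<omega> + R" by simp
        then have "ennreal 1 * ennreal Q + ennreal 1 * ennreal (- X t \<omega>) + ennreal 0 * ennreal 0
            \<le> ennreal 1 * ennreal (X t \<omega>) + ennreal 1 * ennreal R + ennreal 0 * ennreal 0"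
          using Q R by (intro ennreal_le3) (auto simp: max_def)
        then show ?case using Q R by simp
      qed
    qed
    interpret finite_measure_subalgebra M "F 0" using fms by simp
    have X0: "X 0 = (\<lambda>\<omega>. v 0 \<omega> c)" by (auto simp: X_def wealth_def)
    have [measurable]: "X 0 \<in> borel_measurable M" by (rule XM) simp
    have "(\<integral>\<^sup>+\<omega>. ?Q 0 \<omega> + ennreal (- X 0 \<omega>) \<partial>M) \<le> (\<integral>\<^sup>+\<omega>. ennreal (X 0 \<omega>) + ?R 0 \<omega> \<partial>M)"
      by (rule nn_integral_mono_AE[OF main]) simp
    then have "(\<integral>\<^sup>+\<omega>. ennreal (f \<omega>) \<partial>M) + (\<integral>\<^sup>+\<omega>. ennreal (- X 0 \<omega>) \<partial>M)
        \<le> (\<integral>\<^sup>+\<omega>. ennreal (X 0 \<omega>) \<partial>M) + (\<integral>\<^sup>+\<omega>. ennreal (- f \<omega>) \<partial>M)"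
      by (simp add: nn_integral_add nn_integral_nn_cond_exp)
    then show ?thesis unfolding eu gen_exp_W0(1)
      by (intro ennreal_diff_le_diff) (use False gen_exp_W0(2)[of c] in \<open>simp_all add: X0\<close>)
  qed
qed

text \<open>Equality in every one-step problem only makes the values a martingale in the generalized sense;
  comparing with the halved strategy shows that the positive part of the terminal utility is integrable.\<close>

lemma exp_utility_ge:
  assumes \<phi>s: "\<phi> \<in> strategies F T"
    and opt: "\<And>t. t < T \<Longrightarrow> AE \<omega> in M. ereal (v t \<omega> (wealth S c \<phi> t \<omega>))
      \<le> gen_cond_exp M (F t) (\<lambda>\<omega>. ereal (v (Suc t) \<omega> (wealth S c \<phi> (Suc t) \<omega>))) \<omega>"
  shows "\<phi> \<in> admissible M F S T U c" "gen_exp M (W 0 c) \<le> exp_utility M S T U c \<phi>"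
proof -
  define X where "X t \<omega> = v t \<omega> (wealth S c \<phi> t \<omega>)" for t \<omega>
  \<comment> \<open>The value along the halved wealth, which is the wealth of half the strategy
    started from \<open>c / 2\<close>.\<close>
  define H where "H t \<omega> = v t \<omega> (wealth S c \<phi> t \<omega> / 2)" for t \<omega>
  define f where "f \<omega> = U (wealth S c \<phi> T \<omega>)" for \<omega>
  have XF: "X t \<in> borel_measurable (F t)" if "t \<le> T" for t
    unfolding X_def by (rule v_meas[OF that wealth_in_wealths[OF \<phi>s that]])
  have HF: "H t \<in> borel_measurable (F t)" if "t \<le> T" for t
    unfolding H_def by (rule v_meas[OF that wealths_half[OF wealth_in_wealths[OF \<phi>s that]]])
  have XM: "X t \<in> borel_measurable M" if "t \<le> T" for t by (rule F_M[OF that XF[OF that]])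
  have HM: "H t \<in> borel_measurable M" if "t \<le> T" for t by (rule F_M[OF that HF[OF that]])
  have XT: "X T = f" by (simp add: X_def[abs_def] f_def[abs_def] v_T)
  have HT: "p * max (f \<omega>) 0 - q * max (- f \<omega>) 0 - C \<le> H T \<omega>" for \<omega>
    using U_halving by (simp add: H_def f_def v_T halving_def)
  have fM[measurable]: "f \<in> borel_measurable M" using XM[of T] by (simp add: XT)
  let ?Q = "\<lambda>t. nn_cond_exp M (F t) (\<lambda>\<omega>. ennreal (f \<omega>))" and ?R = "\<lambda>t. nn_cond_exp M (F t) (\<lambda>\<omega>. ennreal (- f \<omega>))"
  \<comment> \<open>The last inequality is the halving inequality of the terminal utility
    conditioned to time \<open>t\<close>. Carrying it along is what makes \<open>Q\<close> finite;
    optimality alone bounds \<open>Q - R\<close> from below.\<close>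
  have main: "AE \<omega> in M. \<exists>Q R. ?Q t \<omega> = ennreal Q \<and> ?R t \<omega> = ennreal R \<and> 0 \<le> Q \<and> 0 \<le> R \<and>
      X t \<omega> \<le> Q - R \<and> p * Q - q * R - C \<le> H t \<omega>" if "t \<le> T" for t
    using that
  proof (induction rule: inc_induct)
    case base
    interpret finite_measure_subalgebra M "F T" using fms by simp
    have "f \<in> borel_measurable (F T)" using XF[of T] by (simp add: XT)
    then have "(\<lambda>\<omega>. ennreal (f \<omega>)) \<in> borel_measurable (F T)" "(\<lambda>\<omega>. ennreal (- f \<omega>)) \<in> borel_measurable (F T)"
      by measurable
    from nn_cond_exp_F_meas[OF this(1)] nn_cond_exp_F_meas[OF this(2)] show ?case
    proof eventually_elim
      case (elim \<omega>)
      show ?case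
        using HT[of \<omega>] elim ennreal_eq_max[of "f \<omega>"] ennreal_eq_max[of "- f \<omega>"]
        by (intro exI[of _ "max (f \<omega>) 0"] exI[of _ "max (- f \<omega>) 0"]) (auto simp: XT max_def)
    qed
  next
    case (step t)
    then have t: "t < T" and [simp]: "t \<le> T" "Suc t \<le> T" by auto
    interpret finite_measure_subalgebra M "F t" using fms t by simp
    have [measurable]: "X (Suc t) \<in> borel_measurable M" "H (Suc t) \<in> borel_measurable M" by (simp_all add: XM HM)
    have w: "wealth S c \<phi> t \<in> wealths t" by (rule wealth_in_wealths[OF \<phi>s]) simp
    have \<phi>t[measurable]: "\<phi> (Suc t) \<in> borel_measurable (F t)" by (rule strategies_meas[OF \<phi>s t])
    have \<phi>h: "(\<lambda>\<omega>. \<phi> (Suc t) \<omega> /\<^sub>R 2) \<in> borel_measurable (F t)" by measurable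
    have half: "wealth S c \<phi> t \<omega> / 2 + (\<phi> (Suc t) \<omega> /\<^sub>R 2) \<bullet> \<Delta> S (Suc t) \<omega> = wealth S c \<phi> (Suc t) \<omega> / 2" for \<omega>
      by (simp add: wealth_Suc field_simps)
    have X1: "AE \<omega> in M. ereal (X t \<omega>) \<le> gce (X (Suc t)) \<omega>" using opt[OF t] by (simp add: X_def)
    have X2: "AE \<omega> in M. nce (X (Suc t)) \<omega> \<noteq> \<infinity>"
      using value_finite[OF t w \<phi>t] by (simp add: X_def wealth_Suc)
    have H1: "AE \<omega> in M. gce (H (Suc t)) \<omega> \<le> ereal (H t \<omega>)"
      using value_random(1)[OF t wealths_half[OF w] \<phi>h] unfolding half H_def .
    have H2: "AE \<omega> in M. nce (H (Suc t)) \<omega> \<noteq> \<infinity>"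
      using value_finite[OF t wealths_half[OF w] \<phi>h] unfolding half H_def .
    have tow: "AE \<omega> in M. nn_cond_exp M (F t) (?Q (Suc t)) \<omega> = ?Q t \<omega>"
      "AE \<omega> in M. nn_cond_exp M (F t) (?R (Suc t)) \<omega> = ?R t \<omega>"
      by (rule tower[OF t], measurable)+
    \<comment> \<open>Multiplying \<open>X \<le> Q - R\<close> by \<open>q\<close> removes
      \<open>R\<close> from the halving inequality: \<open>(p - q) Q + q X \<le> H + C\<close>. As
      \<open>p - q > 0\<close>, conditioning yields finiteness of \<open>Q\<close> at time
      \<open>t\<close> before anything is known about \<open>R\<close> there.\<close>
    have I1: "AE \<omega> in M. ennreal (p - q) * nn_cond_exp M (F t) (?Q (Suc t)) \<omega> + ennreal q * nce (X (Suc t)) \<omega> + ennreal 1 * nce (\<lambda>\<omega>. - H (Suc t) \<omega>) \<omega>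
        \<le> ennreal 1 * nce (H (Suc t)) \<omega> + ennreal q * nce (\<lambda>\<omega>. - X (Suc t) \<omega>) \<omega> + ennreal C * nce (\<lambda>_. 1) \<omega>"
    proof (rule nn_cond_exp_le3)
      show "AE \<omega> in M. ennreal (p - q) * ?Q (Suc t) \<omega> + ennreal q * ennreal (X (Suc t) \<omega>) + ennreal 1 * ennreal (- H (Suc t) \<omega>)
        \<le> ennreal 1 * ennreal (H (Suc t) \<omega>) + ennreal q * ennreal (- X (Suc t) \<omega>) + ennreal C * ennreal 1"
        using step.IH
      proof eventually_elim
        case (elim \<omega>)
        then obtain Q R where QR: "?Q (Suc t) \<omega> = ennreal Q" "0 \<le> Q" "X (Suc t) \<omega> \<le> Q - R" "p * Q - q * R - C \<le> H (Suc t) \<omega>"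
          by blast
        have "q * X (Suc t) \<omega> \<le> q * (Q - R)" using QR(3) pq by (intro mult_left_mono) auto
        then have "(p - q) * Q + q * X (Suc t) \<omega> \<le> H (Suc t) \<omega> + C" using QR(4) by (simp add: algebra_simps)
        then show ?case unfolding QR(1) using pq QR(2) by (intro ennreal_le3) (auto simp: max_def)
      qed
    qed measurable
    \<comment> \<open>Once \<open>Q\<close> is finite, \<open>R\<close> is controlled through
      \<open>X \<le> Q - R\<close>.\<close>
    have I2: "AE \<omega> in M. ennreal 1 * nn_cond_exp M (F t) (?R (Suc t)) \<omega> + ennreal 1 * nce (X (Suc t)) \<omega> + ennreal 0 * nce (\<lambda>_. 1) \<omega>
        \<le> ennreal 1 * nn_cond_exp M (F t) (?Q (Suc t)) \<omega> + ennreal 1 * nce (\<lambda>\<omega>. - X (Suc t) \<omega>) \<omega> + ennreal 0 * nce (\<lambda>_. 1) \<omega>"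
    proof (rule nn_cond_exp_le3)
      show "AE \<omega> in M. ennreal 1 * ?R (Suc t) \<omega> + ennreal 1 * ennreal (X (Suc t) \<omega>) + ennreal 0 * ennreal 1
        \<le> ennreal 1 * ?Q (Suc t) \<omega> + ennreal 1 * ennreal (- X (Suc t) \<omega>) + ennreal 0 * ennreal 1"
        using step.IH
      proof eventually_elim
        case (elim \<omega>)
        then obtain Q R where QR: "?Q (Suc t) \<omega> = ennreal Q" "?R (Suc t) \<omega> = ennreal R" "0 \<le> Q" "0 \<le> R" "X (Suc t) \<omega> \<le> Q - R"
          by blast
        then show ?case unfolding QR(1,2) by (intro ennreal_le3) (auto simp: max_def)
      qed
    qed measurable
    \<comment> \<open>With both parts finite, the halving inequality itself can be conditioned down
      to time \<open>t\<close>.\<close>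
    have I3: "AE \<omega> in M. ennreal p * nn_cond_exp M (F t) (?Q (Suc t)) \<omega> + ennreal 1 * nce (\<lambda>\<omega>. - H (Suc t) \<omega>) \<omega> + ennreal 0 * nce (\<lambda>_. 1) \<omega>
        \<le> ennreal 1 * nce (H (Suc t)) \<omega> + ennreal q * nn_cond_exp M (F t) (?R (Suc t)) \<omega> + ennreal C * nce (\<lambda>_. 1) \<omega>"
    proof (rule nn_cond_exp_le3)
      show "AE \<omega> in M. ennreal p * ?Q (Suc t) \<omega> + ennreal 1 * ennreal (- H (Suc t) \<omega>) + ennreal 0 * ennreal 1
        \<le> ennreal 1 * ennreal (H (Suc t) \<omega>) + ennreal q * ?R (Suc t) \<omega> + ennreal C * ennreal 1"
        using step.IH
      proof eventually_elim
        case (elim \<omega>)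
        then obtain Q R where QR: "?Q (Suc t) \<omega> = ennreal Q" "?R (Suc t) \<omega> = ennreal R" "0 \<le> Q" "0 \<le> R" "p * Q - q * R - C \<le> H (Suc t) \<omega>"
          by blast
        then show ?case unfolding QR(1,2) using pq by (intro ennreal_le3) (auto simp: max_def)
      qed
    qed measurable
    have one: "AE \<omega> in M. nce (\<lambda>_. 1) \<omega> = 1" using nn_cond_exp_one by simp
    from I1 I2 I3 tow X1 X2 H1 H2 one show ?case
    proof eventually_elim
      case (elim \<omega>)
      obtain P where P: "nce (X (Suc t)) \<omega> = ennreal P" "0 \<le> P" using elim(7) by (rule ennreal_finiteE)
      obtain m where m: "nce (\<lambda>\<omega>. - X (Suc t) \<omega>) \<omega> = ennreal m" "0 \<le> m" "X t \<omega> + m \<le> P"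
        using elim(6) P unfolding ereal_le_gce_iff[OF elim(7)] by auto
      obtain K where K: "nce (H (Suc t)) \<omega> = ennreal K" "0 \<le> K" using elim(9) by (rule ennreal_finiteE)
      have "ennreal (p - q) * ?Q t \<omega> \<le> ennreal (p - q) * ?Q t \<omega> + ennreal q * nce (X (Suc t)) \<omega> + ennreal 1 * nce (\<lambda>\<omega>. - H (Suc t) \<omega>) \<omega>"
        by (simp add: add.assoc)
      also have "\<dots> \<le> ennreal (K + q * m + C)" using elim(1,4,10) K m pq by (simp add: ennreal_mult)
      finally have "?Q t \<omega> \<noteq> \<infinity>" using pq by (auto simp: ennreal_mult_top top_unique)
      then obtain Q where Q: "?Q t \<omega> = ennreal Q" "0 \<le> Q" by (rule ennreal_finiteE)
      have R1: "?R t \<omega> + ennreal P \<le> ennreal (Q + m)" using elim(2,4,5,10) P m Q by simp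
      then have "?R t \<omega> \<noteq> \<infinity>" by (auto simp: top_unique)
      then obtain R where R: "?R t \<omega> = ennreal R" "0 \<le> R" by (rule ennreal_finiteE)
      have RP: "R + P \<le> Q + m" using R1 R P Q m by (simp flip: ennreal_plus)
      have L1: "ennreal (p * Q) + nce (\<lambda>\<omega>. - H (Suc t) \<omega>) \<omega> \<le> ennreal (K + q * R + C)"
        using elim(3,4,5,10) K Q R pq by (simp add: ennreal_mult)
      then have "nce (\<lambda>\<omega>. - H (Suc t) \<omega>) \<omega> \<noteq> \<infinity>" by (auto simp: top_unique)
      then obtain L where L: "nce (\<lambda>\<omega>. - H (Suc t) \<omega>) \<omega> = ennreal L" "0 \<le> L" by (rule ennreal_finiteE)
      have "p * Q + L \<le> K + q * R + C" using L1 L K Q R pq by (simp flip: ennreal_plus)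
      moreover have "K \<le> H t \<omega> + L" using elim(8) K L unfolding gce_le_ereal_iff[OF elim(9)] by simp
      ultimately show ?case using Q R RP m(3) by (intro exI[of _ Q] exI[of _ R]) auto
    qed
  qed
  interpret finite_measure_subalgebra M "F 0" using fms by simp
  have X0: "X 0 = (\<lambda>\<omega>. v 0 \<omega> c)" and H0: "H 0 = (\<lambda>\<omega>. v 0 \<omega> (c / 2))" by (auto simp: X_def H_def wealth_def)
  have [measurable]: "X 0 \<in> borel_measurable M" "H 0 \<in> borel_measurable M" by (simp_all add: XM HM)
  have UX: "AE \<omega> in M. U c \<le> X 0 \<omega>" using v_0(2)[of c] by (simp add: X0)
  have main0: "AE \<omega> in M. \<exists>Q R. ?Q 0 \<omega> = ennreal Q \<and> ?R 0 \<omega> = ennreal R \<and> 0 \<le> Q \<and> 0 \<le> R \<and>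
      X 0 \<omega> \<le> Q - R \<and> p * Q - q * R - C \<le> H 0 \<omega>" by (rule main) simp
  \<comment> \<open>The initial value is at least \<open>U c\<close>, so
    \<open>R \<le> Q + \<bar>U c\<bar>\<close>. The halving inequality then bounds
    \<open>(p - q) Q\<close> by the initial value at \<open>c / 2\<close>, whose positive part is
    integrable, plus a constant.\<close>
  have "(\<integral>\<^sup>+\<omega>. ennreal (p - q) * ?Q 0 \<omega> \<partial>M) \<le> (\<integral>\<^sup>+\<omega>. ennreal (H 0 \<omega>) + ennreal (C + q * \<bar>U c\<bar>) \<partial>M)"
  proof (rule nn_integral_mono_AE)
    show "AE \<omega> in M. ennreal (p - q) * ?Q 0 \<omega> \<le> ennreal (H 0 \<omega>) + ennreal (C + q * \<bar>U c\<bar>)"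
      using main0 UX
    proof eventually_elim
      case (elim \<omega>)
      then obtain Q R where QR: "?Q 0 \<omega> = ennreal Q" "0 \<le> Q" "X 0 \<omega> \<le> Q - R" "p * Q - q * R - C \<le> H 0 \<omega>"
        by blast
      have "- \<bar>U c\<bar> \<le> Q - R" using elim(2) QR(3) by linarith
      then have "q * (- \<bar>U c\<bar>) \<le> q * (Q - R)" using pq by (intro mult_left_mono) auto
      then have "(p - q) * Q \<le> H 0 \<omega> + (C + q * \<bar>U c\<bar>)" using QR(4) by (simp add: algebra_simps)
      then have "(p - q) * Q \<le> max (H 0 \<omega>) 0 + (C + q * \<bar>U c\<bar>)" by (simp add: max_def)
      then have "ennreal ((p - q) * Q) \<le> ennreal (max (H 0 \<omega>) 0 + (C + q * \<bar>U c\<bar>))" by (rule ennreal_leI)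
      then show ?case using pq QR(1,2) by (simp add: ennreal_mult flip: ennreal_eq_max)
    qed
  qed
  also have "\<dots> < \<infinity>"
    using gen_exp_W0(2)[of "c / 2"] by (simp add: nn_integral_add H0 emeasure_space_1 less_top)
  finally have "ennreal (p - q) * (\<integral>\<^sup>+\<omega>. ennreal (f \<omega>) \<partial>M) \<noteq> \<infinity>"
    by (simp add: nn_integral_cmult nn_integral_nn_cond_exp top_unique)
  then have fin: "(\<integral>\<^sup>+\<omega>. ennreal (f \<omega>) \<partial>M) \<noteq> \<infinity>"
    using pq by (auto simp: ennreal_mult_top)
  show "\<phi> \<in> admissible M F S T U c"
  proof -
    have "(\<lambda>\<omega>. ereal (f \<omega>)) \<in> borel_measurable M" by measurable
    then show ?thesis using \<phi>s fin by (simp add: admissible_def has_gen_exp_def f_def)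
  qed
  \<comment> \<open>The same lower bound makes the negative part of the initial value integrable, so
    that the final sums can be turned into differences.\<close>
  have "(\<integral>\<^sup>+\<omega>. ennreal (- X 0 \<omega>) \<partial>M) \<le> (\<integral>\<^sup>+\<omega>. ennreal \<bar>U c\<bar> \<partial>M)"
    by (rule nn_integral_mono_AE) (use UX in \<open>auto elim!: eventually_mono intro!: ennreal_leI\<close>)
  then have finX: "(\<integral>\<^sup>+\<omega>. ennreal (- X 0 \<omega>) \<partial>M) \<noteq> \<infinity>"
    by (auto simp: emeasure_space_1 top_unique)
  have "(\<integral>\<^sup>+\<omega>. ennreal (X 0 \<omega>) + ?R 0 \<omega> \<partial>M) \<le> (\<integral>\<^sup>+\<omega>. ?Q 0 \<omega> + ennreal (- X 0 \<omega>) \<partial>M)"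
  proof (rule nn_integral_mono_AE)
    show "AE \<omega> in M. ennreal (X 0 \<omega>) + ?R 0 \<omega> \<le> ?Q 0 \<omega> + ennreal (- X 0 \<omega>)"
      using main0
    proof eventually_elim
      case (elim \<omega>)
      then obtain Q R where QR: "?Q 0 \<omega> = ennreal Q" "?R 0 \<omega> = ennreal R" "0 \<le> Q" "0 \<le> R" "X 0 \<omega> \<le> Q - R" by blast
      then have "ennreal 1 * ennreal (X 0 \<omega>) + ennreal 1 * ennreal R + ennreal 0 * ennreal 0
          \<le> ennreal 1 * ennreal Q + ennreal 1 * ennreal (- X 0 \<omega>) + ennreal 0 * ennreal 0"
        by (intro ennreal_le3) (auto simp: max_def)
      then show ?case using QR by simp
    qed
  qed
  then have "(\<integral>\<^sup>+\<omega>. ennreal (X 0 \<omega>) \<partial>M) + (\<integral>\<^sup>+\<omega>. ennreal (- f \<omega>) \<partial>M)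
      \<le> (\<integral>\<^sup>+\<omega>. ennreal (f \<omega>) \<partial>M) + (\<integral>\<^sup>+\<omega>. ennreal (- X 0 \<omega>) \<partial>M)"
    by (simp add: nn_integral_add nn_integral_nn_cond_exp)
  from ennreal_diff_le_diff[OF this fin finX]
  show "gen_exp M (W 0 c) \<le> exp_utility M S T U c \<phi>"
    unfolding gen_exp_W0(1) exp_utility_def by (simp add: X0 gen_exp_def f_def)
qed

text \<open>One-period optimizers depend on the wealth already reached, so positions and wealth are
  constructed together, forward in time.\<close>

lemma optimal_strategy:
  obtains \<phi> where "\<phi> \<in> admissible M F S T U c" "exp_utility M S T U c \<phi> = gen_exp M (W 0 c)"
proof -
  define sel where "sel t X = (SOME \<xi>. \<xi> \<in> borel_measurable (F t) \<and> (AE \<omega> in M. ereal (v t \<omega> (X \<omega>))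
      \<le> gen_cond_exp M (F t) (\<lambda>\<omega>. ereal (v (Suc t) \<omega> (X \<omega> + \<xi> \<omega> \<bullet> \<Delta> S (Suc t) \<omega>))) \<omega>))" for t X
  have sel: "sel t X \<in> borel_measurable (F t)" "AE \<omega> in M. ereal (v t \<omega> (X \<omega>))
      \<le> gen_cond_exp M (F t) (\<lambda>\<omega>. ereal (v (Suc t) \<omega> (X \<omega> + sel t X \<omega> \<bullet> \<Delta> S (Suc t) \<omega>))) \<omega>"
    if "t < T" "X \<in> wealths t" for t X
    using someI_ex[OF optimal_step[OF that, unfolded Bex_def]] unfolding sel_def by blast+
  define x where "x = rec_nat (\<lambda>_. c) (\<lambda>t X \<omega>. X \<omega> + sel t X \<omega> \<bullet> \<Delta> S (Suc t) \<omega>)"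
  have x0: "x 0 = (\<lambda>_. c)" and xS: "x (Suc t) = (\<lambda>\<omega>. x t \<omega> + sel t (x t) \<omega> \<bullet> \<Delta> S (Suc t) \<omega>)" for t
    by (simp_all add: x_def)
  have x: "t \<le> T \<Longrightarrow> x t \<in> wealths t" for t
  proof (induction t)
    case (Suc t)
    then show ?case unfolding xS by (intro wealths_step sel) auto
  qed (simp add: x0 wealths_def)
  \<comment> \<open>Position \<open>i\<close> is held over the period ending at \<open>i\<close>; it
    is chosen from the information and wealth at \<open>i - 1\<close>.\<close>
  define \<phi> where "\<phi> i = sel (i - 1) (x (i - 1))" for i
  have w: "wealth S c \<phi> t = x t" for t
  proof (induction t)
    case (Suc t)
    then show ?case by (simp add: wealth_Suc[abs_def] xS \<phi>_def)
  qed (auto simp: wealth_def x0)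
  have \<phi>s: "\<phi> \<in> strategies F T"
    using sel(1) x by (auto simp: strategies_def \<Xi>_def \<phi>_def)
  have opt: "AE \<omega> in M. ereal (v t \<omega> (wealth S c \<phi> t \<omega>))
      \<le> gen_cond_exp M (F t) (\<lambda>\<omega>. ereal (v (Suc t) \<omega> (wealth S c \<phi> (Suc t) \<omega>))) \<omega>" if "t < T" for t
    using sel(2)[OF that x] that by (simp add: w xS)
  show ?thesis
    using that exp_utility_ge[OF \<phi>s opt] exp_utility_le by (meson antisym)
qed

end

theorem theorem2p7:
  fixes M :: "'a measure" and F :: "nat \<Rightarrow> 'a measure"
    and S :: "nat \<Rightarrow> 'a \<Rightarrow> real ^ 'd" and T :: nat and U :: "real \<Rightarrow> real"
  assumes "market M F S T"
    and "no_arbitrage M F S T"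
    and "well_posed M F S T U"
    and "growth_at_plus_infinity U \<or> growth_at_minus_infinity U"
  shows "\<forall>c. \<exists>\<phi>\<in>admissible M F S T U c.
           max_utility M F S T U c = exp_utility M S T U c \<phi> \<and> max_utility M F S T U c < \<infinity>"
proof
  fix c
  have U: "concave_on UNIV U" "mono U" "U 0 = 0"
    using assms(4) by (auto simp: growth_at_plus_infinity_def growth_at_minus_infinity_def)
  show "\<exists>\<phi>\<in>admissible M F S T U c.
           max_utility M F S T U c = exp_utility M S T U c \<phi> \<and> max_utility M F S T U c < \<infinity>"
  proof (cases "\<exists>a b. U a < U b")
    case True
    then have bot: "filterlim U at_bot at_bot" using concave_mono_at_bot[OF U(1,2)] by blast
    obtain W where W: "value_functions M F S T U W"
      "\<And>x. has_gen_exp M (W 0 x)" "\<And>x. gen_exp M (W 0 x) < \<infinity>"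
      using assms(3) by (auto simp: well_posed_def)
    obtain p q C where pq: "0 < q" "q < p" "0 \<le> C" "halving p q C U"
      using halving_growth[OF assms(4)] .
    interpret utility_market M F S T U W p q C
      by unfold_locales (use assms W U bot pq in auto)
    obtain \<phi> where \<phi>: "\<phi> \<in> admissible M F S T U c" "exp_utility M S T U c \<phi> = gen_exp M (W 0 c)"
      by (rule optimal_strategy)
    have "max_utility M F S T U c = exp_utility M S T U c \<phi>"
      unfolding max_utility_def
    proof (rule antisym)
      show "(SUP \<psi>\<in>admissible M F S T U c. exp_utility M S T U c \<psi>) \<le> exp_utility M S T U c \<phi>"
        unfolding \<phi>(2) by (rule SUP_least) (rule exp_utility_le)
      show "exp_utility M S T U c \<phi> \<le> (SUP \<psi>\<in>admissible M F S T U c. exp_utility M S T U c \<psi>)"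
        by (rule SUP_upper[OF \<phi>(1)])
    qed
    moreover have "exp_utility M S T U c \<phi> < \<infinity>" using \<phi>(2) W(3)[of c] by simp
    ultimately show ?thesis using \<phi>(1) by auto
  next
    case False
    then have "U x = 0" for x using U(3) by (metis linorder_less_linear)
    then have U0: "U = (\<lambda>_. 0)" by auto
    have "(\<lambda>_ _. 0) \<in> admissible M F S T U c"
      by (simp add: admissible_def strategies_def \<Xi>_def has_gen_exp_def U0)
    moreover have eu: "exp_utility M S T U c \<phi> = 0" for \<phi>
      by (simp add: exp_utility_def gen_exp_def U0)
    \<comment> \<open>The supremum runs over a nonempty set, so it is the common value 0 and not the
      bottom of \<open>ereal\<close>.\<close>
    moreover have "max_utility M F S T U c = 0"
      using calculation(1) unfolding max_utility_def eu by (metis SUP_const empty_iff)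
    ultimately show ?thesis by auto
  qed
qed

end
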